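(* Let $\mathbb{X}$ be a standard Borel space, $\zeta\in\mathcal{P}(\mathbb{X})$, and let $\mathbb{Y}^1,\mathbb{Y}^2$ be compact standard Borel spaces, all fixed. Let $\nu$ and $\mu$ be information structures on $\mathbb{X}\times\mathbb{Y}^1\times\mathbb{Y}^2$ (with $\mathbb{X}$-marginal $\zeta$), each absolutely continuous with respect to a product measure $\zeta\otimes\bar Q^1\otimes\bar Q^2$ (with reference probability measures $\bar Q^1,\bar Q^2$ that may depend on the information structure). Then $\mu$ is better for the maximizer than $\nu$ (that is, $\nu\lesssim\mu$) over all games in $\tilde{\mathbb{G}}_\zeta(\mathbb{X},\mathbb{Y}^1,\mathbb{Y}^2)$ if and only if there exist stochastic kernels $\kappa^1\in K^1$ and $\kappa^2\in K^2$ such that $$\kappa^1\nu=\kappa^2\mu .$$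
   Context: A standard Borel space is a Borel subset of a complete separable metric space; $\mathcal{P}(\cdot)$ denotes the set of Borel probability measures. The state of nature $x$ has law $\zeta$; player $i\in\{1,2\}$ observes only $y^i\in\mathbb{Y}^i$. Player 1 is the minimizer and player 2 is the maximizer. Information structure: a joint probability measure $\mu(dx,dy^1,dy^2)$ on $\mathbb{X}\times\mathbb{Y}^1\times\mathbb{Y}^2$ whose marginal on $\mathbb{X}$ is $\zeta$. Absolute continuity with respect to a product measure means: there are probability measures $\bar Q^i$ on $\mathbb{Y}^i$ ($i=1,2$) and an integrable function $f$ with $\mu(A\times B\times C)=\int_{A\times B\times C} f(x,y^1,y^2)\,\zeta(dx)\bar Q^1(dy^1)\bar Q^2(dy^2)$ for all Borel $A\subset\mathbb{X}$, $B\subset\mathbb{Y}^1$, $C\subset\mathbb{Y}^2$. Game: a triple $G=(c,\mathbb{U}^1,\mathbb{U}^2)$ of standard Borel action spaces $\mathbb{U}^1,\mathbb{U}^2$ and a measurable bounded cost $c:\mathbb{X}\times\mathbb{U}^1\times\mathbb{U}^2\to\mathbb{R}$. The class $\tilde{\mathbb{G}}_\zeta(\mathbb{X},\mathbb{Y}^1,\mathbb{Y}^2)$ consists of all games in which $\mathbb{U}^1,\mathbb{U}^2$ are compact and $c$ is bounded and, for every $x\in\mathbb{X}$, $c(x,\cdot,\cdot)$ is continuous in the players' actions $(u^1,u^2)$. Policies: $\Gamma^i$ is the set of randomized policies of player $i$, i.e. $u^i=\gamma^i(y^i,\omega^i)$ with $\gamma^i$ measurable and $\omega^i$ independent noise;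 equivalently stochastic kernels $\gamma^i(du^i|y^i)$ from $\mathbb{Y}^i$ to $\mathbb{U}^i$. The expected cost is $$V_G^\mu(\gamma^1,\gamma^2)=\int c(x,u^1,u^2)\,\gamma^1(du^1|y^1)\gamma^2(du^2|y^2)\,\mu(dx,dy^1,dy^2).$$ An equilibrium is a pair $(\gamma^{1,*},\gamma^{2,*})$ with $\inf_{\gamma^1\in\Gamma^1}V_G^\mu(\gamma^1,\gamma^{2,*})=V_G^\mu(\gamma^{1,*},\gamma^{2,*})=\sup_{\gamma^2\in\Gamma^2}V_G^\mu(\gamma^{1,*},\gamma^2)$; $V^*(G,\mu)$ denotes $V_G^\mu$ evaluated at equilibrium policies. $\nu\lesssim\mu$ over a class of games $\mathbb{G}$ means $V^*(G,\mu)\ge V^*(G,\nu)$ for all $G\in\mathbb{G}$. $K^i$ is the set of all stochastic kernels from $\mathbb{Y}^i$ to $\mathbb{Y}^i$. For $\kappa^i\in K^i$, $\kappa^i\mu$ is the information structure in which player $i$'s measurement is garbled: writing $-i$ for the other player, $(\kappa^i\mu)(B,dy^{-i},dx)=\int_{\mathbb{Y}^i}\kappa^i(B|y^i)\,\mu(dy^i,dy^{-i},dx)$ for $B\in\mathcal{B}(\mathbb{Y}^i)$. *)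

theory Defs
  imports "HOL-Probability.Probability"
begin

text \<open>
  A standard Borel space is represented by a Borel subset \<open>S\<close> of a Polish type, with the
  \<open>\<sigma>\<close>-algebra \<open>borel_on S\<close>. The set of Borel probability measures on \<open>S\<close> is
  \<open>space (prob_algebra (borel_on S))\<close>, and a stochastic kernel from \<open>S\<close> to \<open>T\<close> is a measurable
  map from \<open>borel_on S\<close> to \<open>prob_algebra (borel_on T)\<close>.
\<close>

abbreviation standard_borel :: "'a::polish_space set \<Rightarrow> bool" where
  "standard_borel S \<equiv> S \<in> sets borel"

abbreviation borel_on :: "'a::topological_space set \<Rightarrow> 'a measure" where
  "borel_on S \<equiv> restrict_space borel S"

definition kernels ::
    "'a::topological_space set \<Rightarrow> 'b::topological_space set \<Rightarrow> ('a \<Rightarrow> 'b measure) set" where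
  "kernels S T = borel_on S \<rightarrow>\<^sub>M prob_algebra (borel_on T)"


definition info_structure ::
    "'x::polish_space set \<Rightarrow> 'y1::polish_space set \<Rightarrow> 'y2::polish_space set \<Rightarrow> 'x measure
      \<Rightarrow> ('x \<times> 'y1 \<times> 'y2) measure \<Rightarrow> bool" where
  "info_structure X Y1 Y2 \<zeta> \<mu> \<longleftrightarrow>
     \<mu> \<in> space (prob_algebra (borel_on X \<Otimes>\<^sub>M borel_on Y1 \<Otimes>\<^sub>M borel_on Y2)) \<and>
     distr \<mu> (borel_on X) fst = \<zeta>"

definition abs_cont_product ::
    "'x::polish_space set \<Rightarrow> 'y1::polish_space set \<Rightarrow> 'y2::polish_space set \<Rightarrow> 'x measure
      \<Rightarrow> ('x \<times> 'y1 \<times> 'y2) measure \<Rightarrow> bool" where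
  "abs_cont_product X Y1 Y2 \<zeta> \<mu> \<longleftrightarrow>
     (\<exists>Q1 \<in> space (prob_algebra (borel_on Y1)). \<exists>Q2 \<in> space (prob_algebra (borel_on Y2)).
      \<exists>f :: 'x \<times> 'y1 \<times> 'y2 \<Rightarrow> real.
        integrable (\<zeta> \<Otimes>\<^sub>M Q1 \<Otimes>\<^sub>M Q2) f \<and>
        (\<forall>A \<in> sets (borel_on X). \<forall>B \<in> sets (borel_on Y1). \<forall>C \<in> sets (borel_on Y2).
           measure \<mu> (A \<times> B \<times> C) = (LINT z:A \<times> B \<times> C|\<zeta> \<Otimes>\<^sub>M Q1 \<Otimes>\<^sub>M Q2. f z)))"


text \<open>The game \<open>(c, U1, U2)\<close>; only the values of \<open>c\<close> on \<open>X \<times> U1 \<times> U2\<close> matter.\<close>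

type_synonym ('x, 'u1, 'u2) game = "('x \<times> 'u1 \<times> 'u2 \<Rightarrow> real) \<times> 'u1 set \<times> 'u2 set"

text \<open>Action sets are nonempty, since otherwise a player has no policy at all.\<close>

definition compact_continuous_games ::
    "'x::polish_space set \<Rightarrow> ('x, 'u1::polish_space, 'u2::polish_space) game set" where
  "compact_continuous_games X = {(c, U1, U2).
     standard_borel U1 \<and> compact U1 \<and> U1 \<noteq> {} \<and>
     standard_borel U2 \<and> compact U2 \<and> U2 \<noteq> {} \<and>
     c \<in> borel_measurable (borel_on X \<Otimes>\<^sub>M borel_on U1 \<Otimes>\<^sub>M borel_on U2) \<and>
     (\<exists>b. \<forall>x\<in>X. \<forall>u1\<in>U1. \<forall>u2\<in>U2. \<bar>c (x, u1, u2)\<bar> \<le> b) \<and>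
     (\<forall>x\<in>X. continuous_on (U1 \<times> U2) (\<lambda>(u1, u2). c (x, u1, u2)))}"

definition expected_cost ::
    "('x, 'u1, 'u2) game \<Rightarrow> ('x \<times> 'y1 \<times> 'y2) measure
      \<Rightarrow> ('y1 \<Rightarrow> 'u1 measure) \<Rightarrow> ('y2 \<Rightarrow> 'u2 measure) \<Rightarrow> real" where
  "expected_cost G \<mu> \<gamma>1 \<gamma>2 =
     (\<integral>(x, y1, y2). (\<integral>u1. (\<integral>u2. fst G (x, u1, u2) \<partial>\<gamma>2 y2) \<partial>\<gamma>1 y1) \<partial>\<mu>)"

text \<open>Player 1 minimizes and player 2 maximizes; randomized policies are stochastic kernels.\<close>

definition equilibrium ::
    "'y1::polish_space set \<Rightarrow> 'y2::polish_space set
      \<Rightarrow> ('x, 'u1::polish_space, 'u2::polish_space) game \<Rightarrow> ('x \<times> 'y1 \<times> 'y2) measure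
      \<Rightarrow> ('y1 \<Rightarrow> 'u1 measure) \<Rightarrow> ('y2 \<Rightarrow> 'u2 measure) \<Rightarrow> bool" where
  "equilibrium Y1 Y2 G \<mu> \<gamma>1 \<gamma>2 \<longleftrightarrow> (case G of (c, U1, U2) \<Rightarrow>
     \<gamma>1 \<in> kernels Y1 U1 \<and> \<gamma>2 \<in> kernels Y2 U2 \<and>
     (INF \<gamma>\<in>kernels Y1 U1. expected_cost G \<mu> \<gamma> \<gamma>2) = expected_cost G \<mu> \<gamma>1 \<gamma>2 \<and>
     (SUP \<gamma>\<in>kernels Y2 U2. expected_cost G \<mu> \<gamma>1 \<gamma>) = expected_cost G \<mu> \<gamma>1 \<gamma>2)"

definition game_value ::
    "'y1::polish_space set \<Rightarrow> 'y2::polish_space set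
      \<Rightarrow> ('x, 'u1::polish_space, 'u2::polish_space) game \<Rightarrow> ('x \<times> 'y1 \<times> 'y2) measure \<Rightarrow> real" where
  "game_value Y1 Y2 G \<mu> =
     (THE v. \<exists>\<gamma>1 \<gamma>2. equilibrium Y1 Y2 G \<mu> \<gamma>1 \<gamma>2 \<and> v = expected_cost G \<mu> \<gamma>1 \<gamma>2)"

text \<open>\<open>better_for_maximizer Y1 Y2 \<G> \<nu> \<mu>\<close> is \<open>\<nu> \<lesssim> \<mu>\<close> over the class of games \<open>\<G>\<close>.\<close>

definition better_for_maximizer ::
    "'y1::polish_space set \<Rightarrow> 'y2::polish_space set
      \<Rightarrow> ('x, 'u1::polish_space, 'u2::polish_space) game set
      \<Rightarrow> ('x \<times> 'y1 \<times> 'y2) measure \<Rightarrow> ('x \<times> 'y1 \<times> 'y2) measure \<Rightarrow> bool" where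
  "better_for_maximizer Y1 Y2 \<G> \<nu> \<mu> \<longleftrightarrow>
     (\<forall>G\<in>\<G>. game_value Y1 Y2 G \<mu> \<ge> game_value Y1 Y2 G \<nu>)"


text \<open>
  In \<^const>\<open>distr\<close> below, \<open>\<mu>\<close> only supplies the \<open>\<sigma>\<close>-algebra of the product space. The lemmas
  \<open>emeasure_garble1\<close> and \<open>emeasure_garble2\<close> give the defining formulas on measurable rectangles.
\<close>

definition garble1 ::
    "('y1 \<Rightarrow> 'y1 measure) \<Rightarrow> ('x \<times> 'y1 \<times> 'y2) measure \<Rightarrow> ('x \<times> 'y1 \<times> 'y2) measure" where
  "garble1 \<kappa> \<mu> = \<mu> \<bind> (\<lambda>(x, y1, y2). distr (\<kappa> y1) \<mu> (\<lambda>y. (x, y, y2)))"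

definition garble2 ::
    "('y2 \<Rightarrow> 'y2 measure) \<Rightarrow> ('x \<times> 'y1 \<times> 'y2) measure \<Rightarrow> ('x \<times> 'y1 \<times> 'y2) measure" where
  "garble2 \<kappa> \<mu> = \<mu> \<bind> (\<lambda>(x, y1, y2). distr (\<kappa> y2) \<mu> (\<lambda>y. (x, y1, y)))"

lemma emeasure_garble1:
  assumes mu: "\<mu> \<in> space (prob_algebra (borel_on X \<Otimes>\<^sub>M borel_on Y1 \<Otimes>\<^sub>M borel_on Y2))"
    and k: "\<kappa> \<in> kernels Y1 Y1"
    and A: "A \<in> sets (borel_on X)" and B: "B \<in> sets (borel_on Y1)"
    and C: "C \<in> sets (borel_on Y2)"
  shows "emeasure (garble1 \<kappa> \<mu>) (A \<times> B \<times> C) =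
    (\<integral>\<^sup>+(x, y1, y2). emeasure (\<kappa> y1) B * indicator (A \<times> C) (x, y2) \<partial>\<mu>)"
proof -
  let ?P = "borel_on X \<Otimes>\<^sub>M borel_on Y1 \<Otimes>\<^sub>M borel_on Y2"
  let ?D = "\<lambda>(x, y1, y2). distr (\<kappa> y1) ?P (\<lambda>y. (x, y, y2))"
  have sets_mu: "sets \<mu> = sets ?P" using mu by (simp add: space_prob_algebra)
  have k': "\<kappa> \<in> borel_on Y1 \<rightarrow>\<^sub>M prob_algebra (borel_on Y1)" using k by (simp add: kernels_def)
  have D: "?D \<in> ?P \<rightarrow>\<^sub>M prob_algebra ?P"
    using k' by measurable
  have R: "A \<times> B \<times> C \<in> sets ?P" using A B C by auto
  have eq: "garble1 \<kappa> \<mu> = \<mu> \<bind> ?D"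
    unfolding garble1_def using sets_mu by (simp cong: distr_cong)
  have "emeasure (garble1 \<kappa> \<mu>) (A \<times> B \<times> C) = (\<integral>\<^sup>+z. emeasure (?D z) (A \<times> B \<times> C) \<partial>\<mu>)"
    unfolding eq by (rule emeasure_bind_prob_algebra[OF mu D R])
  also have "\<dots> = (\<integral>\<^sup>+(x, y1, y2). emeasure (\<kappa> y1) B * indicator (A \<times> C) (x, y2) \<partial>\<mu>)"
  proof (rule nn_integral_cong)
    fix z assume z: "z \<in> space \<mu>"
    obtain x y1 y2 where z_eq: "z = (x, y1, y2)" by (cases z)
    have sp: "x \<in> space (borel_on X)" "y1 \<in> space (borel_on Y1)" "y2 \<in> space (borel_on Y2)"
      using z z_eq sets_eq_imp_space_eq[OF sets_mu] by (auto simp: space_pair_measure)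
    have sk: "sets (\<kappa> y1) = sets (borel_on Y1)"
      using measurable_space[OF k' sp(2)] by (simp add: space_prob_algebra)
    have "(\<lambda>y. (x, y, y2)) \<in> borel_on Y1 \<rightarrow>\<^sub>M ?P" using sp by measurable
    hence m: "(\<lambda>y. (x, y, y2)) \<in> \<kappa> y1 \<rightarrow>\<^sub>M ?P" using sk by (simp cong: measurable_cong_sets)
    have "emeasure (?D z) (A \<times> B \<times> C) =
        emeasure (\<kappa> y1) ((\<lambda>y. (x, y, y2)) -` (A \<times> B \<times> C) \<inter> space (\<kappa> y1))"
      using emeasure_distr[OF m R] by (simp add: z_eq)
    also have "(\<lambda>y. (x, y, y2)) -` (A \<times> B \<times> C) \<inter> space (\<kappa> y1) =
        (if (x, y2) \<in> A \<times> C then B else {})"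
      using sets.sets_into_space[OF B] sets_eq_imp_space_eq[OF sk] by auto
    finally show "emeasure (?D z) (A \<times> B \<times> C) =
        (case z of (x, y1, y2) \<Rightarrow> emeasure (\<kappa> y1) B * indicator (A \<times> C) (x, y2))"
      by (simp add: z_eq indicator_def)
  qed
  finally show ?thesis .
qed

lemma emeasure_garble2:
  assumes mu: "\<mu> \<in> space (prob_algebra (borel_on X \<Otimes>\<^sub>M borel_on Y1 \<Otimes>\<^sub>M borel_on Y2))"
    and k: "\<kappa> \<in> kernels Y2 Y2"
    and A: "A \<in> sets (borel_on X)" and B: "B \<in> sets (borel_on Y1)"
    and C: "C \<in> sets (borel_on Y2)"
  shows "emeasure (garble2 \<kappa> \<mu>) (A \<times> B \<times> C) =
    (\<integral>\<^sup>+(x, y1, y2). emeasure (\<kappa> y2) C * indicator (A \<times> B) (x, y1) \<partial>\<mu>)"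
proof -
  let ?P = "borel_on X \<Otimes>\<^sub>M borel_on Y1 \<Otimes>\<^sub>M borel_on Y2"
  let ?D = "\<lambda>(x, y1, y2). distr (\<kappa> y2) ?P (\<lambda>y. (x, y1, y))"
  have sets_mu: "sets \<mu> = sets ?P" using mu by (simp add: space_prob_algebra)
  have k': "\<kappa> \<in> borel_on Y2 \<rightarrow>\<^sub>M prob_algebra (borel_on Y2)" using k by (simp add: kernels_def)
  have D: "?D \<in> ?P \<rightarrow>\<^sub>M prob_algebra ?P"
    using k' by measurable
  have R: "A \<times> B \<times> C \<in> sets ?P" using A B C by auto
  have eq: "garble2 \<kappa> \<mu> = \<mu> \<bind> ?D"
    unfolding garble2_def using sets_mu by (simp cong: distr_cong)
  have "emeasure (garble2 \<kappa> \<mu>) (A \<times> B \<times> C) = (\<integral>\<^sup>+z. emeasure (?D z) (A \<times> B \<times> C) \<partial>\<mu>)"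
    unfolding eq by (rule emeasure_bind_prob_algebra[OF mu D R])
  also have "\<dots> = (\<integral>\<^sup>+(x, y1, y2). emeasure (\<kappa> y2) C * indicator (A \<times> B) (x, y1) \<partial>\<mu>)"
  proof (rule nn_integral_cong)
    fix z assume z: "z \<in> space \<mu>"
    obtain x y1 y2 where z_eq: "z = (x, y1, y2)" by (cases z)
    have sp: "x \<in> space (borel_on X)" "y1 \<in> space (borel_on Y1)" "y2 \<in> space (borel_on Y2)"
      using z z_eq sets_eq_imp_space_eq[OF sets_mu] by (auto simp: space_pair_measure)
    have sk: "sets (\<kappa> y2) = sets (borel_on Y2)"
      using measurable_space[OF k' sp(3)] by (simp add: space_prob_algebra)
    have "(\<lambda>y. (x, y1, y)) \<in> borel_on Y2 \<rightarrow>\<^sub>M ?P" using sp by measurable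
    hence m: "(\<lambda>y. (x, y1, y)) \<in> \<kappa> y2 \<rightarrow>\<^sub>M ?P" using sk by (simp cong: measurable_cong_sets)
    have "emeasure (?D z) (A \<times> B \<times> C) =
        emeasure (\<kappa> y2) ((\<lambda>y. (x, y1, y)) -` (A \<times> B \<times> C) \<inter> space (\<kappa> y2))"
      using emeasure_distr[OF m R] by (simp add: z_eq)
    also have "(\<lambda>y. (x, y1, y)) -` (A \<times> B \<times> C) \<inter> space (\<kappa> y2) =
        (if (x, y1) \<in> A \<times> B then C else {})"
      using sets.sets_into_space[OF C] sets_eq_imp_space_eq[OF sk] by auto
    finally show "emeasure (?D z) (A \<times> B \<times> C) =
        (case z of (x, y1, y2) \<Rightarrow> emeasure (\<kappa> y2) C * indicator (A \<times> B) (x, y1))"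
      by (simp add: z_eq indicator_def)
  qed
  finally show ?thesis .
qed


text \<open>
  A formula cannot quantify over the types that carry the action spaces. Every compact standard
  Borel space is homeomorphic to a compact subset of the Polish space of real sequences with the
  product topology, so games with action spaces there represent all games up to relabelling of
  actions. Conversely, the order over games with action spaces in arbitrary Polish types is
  expressed by \<open>compact_continuous_games\<close> with free type variables for the actions.
\<close>

type_synonym 'x universal_game = "('x, nat \<Rightarrow> real, nat \<Rightarrow> real) game"

end

theory Submission
  imports Defs "HOL-Real_Asymp.Real_Asymp"
begin

text \<open>
  Sufficiency: if \<open>\<kappa>1 \<nu> = \<kappa>2 \<mu>\<close>, let the minimizer under \<open>\<nu>\<close> apply \<open>\<kappa>1\<close> before the policy that is
  optimal under \<open>\<mu>\<close>, and let the maximizer under \<open>\<mu>\<close> apply \<open>\<kappa>2\<close> before the policy that is optimal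
  under \<open>\<nu>\<close>. Both plays have the same cost, which lies above the value under \<open>\<nu>\<close> and below the
  value under \<open>\<mu>\<close>.

  Necessity: if the convex sets of all \<open>\<kappa>1 \<nu>\<close> and of all \<open>\<kappa>2 \<mu>\<close> are disjoint, a continuous bounded
  function separates them. Take it as the cost of the game in which the actions are the points of
  \<open>Y1\<close> and \<open>Y2\<close>. Under \<open>\<mu>\<close> the minimizer can report the observation truthfully, and so can the
  maximizer under \<open>\<nu>\<close>; separation makes the value under \<open>\<nu>\<close> strictly larger.

  Both parts need compactness of the set of policies. Instead of a topology on kernels, the proof
  uses that every sequence of kernels has forward convex combinations that converge weakly at almost
  every observation. A strictly convex regularization makes this sufficient for the existence of
  equilibria.
\<close>

section \<open>Forward averages of functions\<close>

text \<open>What survives passage to forward averages is an eventual bound on a quantity that is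
  affine or convex in one policy while the opponent stays fixed. Averaging both players of the game
  at once would destroy such a bound, as the cost is bilinear; each compactness argument about the
  game therefore moves a single player. The obstacle is that a minimax argument must find one policy
  of player 1 that is good against all policies of player 2, an intersection of uncountably many
  sets, whereas averages are extracted for one sequence at a time. Strict convexity removes it:
  every reply of player 2 yields a suitable point, and all these points are equivalent. The
  regularizer and the separating functional come from the same device: countably many continuous
  test functions weighted by a geometric distribution, which charges every index and so condenses a
  countable family of scalar statements into one integral.\<close>

abbreviation pmf_mean :: "'a pmf \<Rightarrow> ('a \<Rightarrow> real) \<Rightarrow> real" where
  "pmf_mean p h \<equiv> measure_pmf.expectation p h"

lemma pmf_expectation_bounded:
  fixes h :: "'a \<Rightarrow> real"
  assumes "\<And>m. m \<in> set_pmf q \<Longrightarrow> \<bar>h m\<bar> \<le> B"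
  shows "integrable (measure_pmf q) h" and "\<bar>pmf_mean q h\<bar> \<le> B"
proof -
  have ae: "AE m in measure_pmf q. \<bar>h m\<bar> \<le> B"
    using assms by (simp add: AE_measure_pmf_iff)
  show i: "integrable (measure_pmf q) h"
    using ae by (intro measure_pmf.integrable_const_bound[where B=B]) auto
  have "\<bar>pmf_mean q h\<bar> \<le> pmf_mean q (\<lambda>m. \<bar>h m\<bar>)"
    by (rule integral_abs_bound)
  also have "\<dots> \<le> pmf_mean q (\<lambda>_. B)"
    using ae i by (intro integral_mono_AE) auto
  finally show "\<bar>pmf_mean q h\<bar> \<le> B" by simp
qed

text \<open>The tower rule; it merges two successive rounds of averaging into one.\<close>

lemma expectation_bind_pmf_bounded:
  fixes h :: "'b \<Rightarrow> real"
  assumes "\<And>m. \<bar>h m\<bar> \<le> B"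
  shows "pmf_mean (bind_pmf p q) h
    = pmf_mean p (\<lambda>m. pmf_mean (q m) h)"
proof -
  have "integral\<^sup>L (measure_pmf p \<bind> (\<lambda>x. measure_pmf (q x))) h
      = (\<integral>m. integral\<^sup>L (measure_pmf (q m)) h \<partial>measure_pmf p)"
    by (rule integral_bind[where K="count_space UNIV" and B=B and B'=1])
      (use assms measure_pmf.finite_measure_axioms in
        \<open>auto simp: measure_pmf.emeasure_space_1 space_subprob_algebra prob_space_imp_subprob_space measure_pmf.prob_space_axioms\<close>)
  then show ?thesis by (simp add: measure_pmf_bind)
qed

text \<open>A countable index set makes joint measurability in the point and the index a matter of
  each index separately.\<close>

lemma measurable_pmf_average:
  fixes f :: "nat \<Rightarrow> 'a \<Rightarrow> real"
  assumes [measurable]: "\<And>n. f n \<in> borel_measurable M"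
  shows "(\<lambda>x. pmf_mean q (\<lambda>m. f m x)) \<in> borel_measurable M"
proof -
  have "(\<lambda>(x, m). f m x) \<in> borel_measurable (M \<Otimes>\<^sub>M measure_pmf q)"
  proof -
    have "(\<lambda>(x, m). f m x) \<in> borel_measurable (M \<Otimes>\<^sub>M count_space UNIV)"
      by measurable
    then show ?thesis
      by (simp cong: measurable_cong_sets sets_pair_measure_cong)
  qed
  then show ?thesis
    using measure_pmf.borel_measurable_lebesgue_integral[of "\<lambda>x m. f m x" M q] by simp
qed

text \<open>By monotone convergence the sum of the absolute increments has finite integral, the
  bounds forming a geometric series. It is finite almost everywhere, and telescoping turns absolute
  summability into convergence.\<close>

lemma AE_convergent_of_summable_L1:
  fixes h :: "nat \<Rightarrow> 'a \<Rightarrow> real"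
  assumes i: "\<And>k. integrable M (h k)"
    and b: "\<And>k. (\<integral>x. \<bar>h (Suc k) x - h k x\<bar> \<partial>M) \<le> (1/2)^k"
  shows "AE x in M. convergent (\<lambda>k. h k x)"
proof -
  note [measurable] = borel_measurable_integrable[OF i]
  have "(\<integral>\<^sup>+x. (\<Sum>k. ennreal \<bar>h (Suc k) x - h k x\<bar>) \<partial>M)
      = (\<Sum>k. \<integral>\<^sup>+x. ennreal \<bar>h (Suc k) x - h k x\<bar> \<partial>M)"
    by (rule nn_integral_suminf) measurable
  also have "\<dots> \<le> (\<Sum>k. ennreal ((1/2)^k))"
  proof (rule suminf_le)
    fix k
    have "(\<integral>\<^sup>+x. ennreal \<bar>h (Suc k) x - h k x\<bar> \<partial>M) = ennreal (\<integral>x. \<bar>h (Suc k) x - h k x\<bar> \<partial>M)"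
      using i by (intro nn_integral_eq_integral) auto
    then show "(\<integral>\<^sup>+x. ennreal \<bar>h (Suc k) x - h k x\<bar> \<partial>M) \<le> ennreal ((1/2)^k)"
      using b[of k] by (simp add: ennreal_leI)
  qed auto
  also have "\<dots> < \<infinity>"
    by (subst suminf_ennreal2) (auto simp: summable_geometric)
  finally have "AE x in M. (\<Sum>k. ennreal \<bar>h (Suc k) x - h k x\<bar>) \<noteq> \<infinity>"
    by (intro nn_integral_PInf_AE) auto
  then show ?thesis
  proof eventually_elim
    fix x assume "(\<Sum>k. ennreal \<bar>h (Suc k) x - h k x\<bar>) \<noteq> \<infinity>"
    then have "summable (\<lambda>k. \<bar>h (Suc k) x - h k x\<bar>)"
      by (intro summable_suminf_not_top) auto
    then have "summable (\<lambda>k. h (Suc k) x - h k x)"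
      by (rule summable_rabs_cancel)
    then have "convergent (\<lambda>n. \<Sum>k<n. h (Suc k) x - h k x)"
      by (simp add: summable_iff_convergent)
    then have "convergent (\<lambda>n. h n x - h 0 x)"
      using sum_lessThan_telescope[of "\<lambda>k. h k x"] by simp
    then have "convergent (\<lambda>n. (h n x - h 0 x) + h 0 x)"
      by (intro convergent_add convergent_const)
    then show "convergent (\<lambda>k. h k x)" by simp
  qed
qed

text \<open>
  Among the averages with weights on \<open>{n..}\<close> pick one that almost minimizes
  the \<open>L\<^sup>2\<close> norm; by the parallelogram law these almost minimizers form a Cauchy sequence.
\<close>

lemma tail_averages_converge:
  fixes f :: "nat \<Rightarrow> 'a \<Rightarrow> real"
  assumes "prob_space M" and meas [measurable]: "\<And>n. f n \<in> borel_measurable M"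
    and bd: "\<And>n x. x \<in> space M \<Longrightarrow> \<bar>f n x\<bar> \<le> B"
  obtains p :: "nat \<Rightarrow> nat pmf" where "\<And>n. set_pmf (p n) \<subseteq> {n..}"
    and "AE x in M. convergent (\<lambda>n. pmf_mean (p n) (\<lambda>m. f m x))"
proof -
  interpret prob_space M by fact
  define avg where "avg q x = pmf_mean q (\<lambda>m. f m x)" for q x
  define J where "J q = (\<integral>x. (avg q x)\<^sup>2 \<partial>M)" for q
  define S where "S n = {q::nat pmf. set_pmf q \<subseteq> {n..}}" for n
  \<comment> \<open>These infima increase with n because fewer weights are admissible, and they are
    bounded; their convergence controls the distance between almost minimizers.\<close>
  define d where "d n = Inf (J ` S n)" for n
  have [measurable]: "avg q \<in> borel_measurable M" for q
    unfolding avg_def by (rule measurable_pmf_average) measurable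
  have avg_bd: "\<bar>avg q x\<bar> \<le> B" if "x \<in> space M" for q x
    unfolding avg_def using bd[OF that] by (rule pmf_expectation_bounded)
  have avg2_bd: "(avg q x)\<^sup>2 \<le> B\<^sup>2" if "x \<in> space M" for q x
    using avg_bd[OF that] by (metis abs_le_square_iff abs_of_nonneg abs_ge_zero order_trans)
  have int2 [simp]: "integrable M (\<lambda>x. (avg q x)\<^sup>2)" for q
    using avg2_bd by (intro integrable_const_bound[where B="B\<^sup>2"]) auto
  have int1 [simp]: "integrable M (avg q)" for q
    using avg_bd by (intro integrable_const_bound[where B=B]) auto
  have int11 [simp]: "integrable M (\<lambda>x. avg q x * avg r x)" for q r
  proof (rule integrable_const_bound[where B="B * B"])
    show "AE x in M. norm (avg q x * avg r x) \<le> B * B"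
      using avg_bd by (auto simp: abs_mult intro!: mult_mono order_trans[OF abs_ge_zero])
  qed measurable
  have J0: "0 \<le> J q" for q by (simp add: J_def)
  have JB: "J q \<le> B\<^sup>2" for q
  proof -
    have "J q \<le> (\<integral>x. B\<^sup>2 \<partial>M)"
      unfolding J_def by (rule integral_mono) (auto intro: avg2_bd)
    then show ?thesis by (simp add: prob_space)
  qed
  have bdd: "bdd_below (J ` S n)" for n using J0 by (auto intro!: bdd_belowI)
  have S_ne: "S n \<noteq> {}" for n
    by (auto simp: S_def intro!: exI[of _ "return_pmf n"])
  have d_le: "d n \<le> J q" if "q \<in> S n" for n q
    unfolding d_def using that by (intro cInf_lower bdd) auto
  have S_anti: "S n \<subseteq> S m" if "m \<le> n" for m n using that by (auto simp: S_def)
  have d_mono: "d m \<le> d n" if "m \<le> n" for m n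
    unfolding d_def by (rule cInf_superset_mono) (use S_ne S_anti[OF that] bdd in auto)
  have dB: "d n \<le> B\<^sup>2" for n
    using S_ne[of n] d_le[of _ n] JB by (metis ex_in_conv order_trans)
  have "\<exists>q. q \<in> S n \<and> J q < d n + 1 / real (Suc n)" for n
  proof -
    have "Inf (J ` S n) < d n + 1 / real (Suc n)" by (simp add: d_def)
    then show ?thesis
      using cInf_lessD[of "J ` S n" "d n + 1 / real (Suc n)"] S_ne[of n] by auto
  qed
  then obtain g where gS: "\<And>n. g n \<in> S n" and gJ: "\<And>n. J (g n) < d n + 1 / real (Suc n)"
    by metis
  have par: "(\<integral>x. (avg q x - avg r x)\<^sup>2 \<partial>M) \<le> 2 * J q + 2 * J r - 4 * d n"
    if "q \<in> S n" "r \<in> S n" for q r n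
  proof -
    \<comment> \<open>A fair coin between q and r realizes the midpoint of the two averages by a
      weight that still lives on the tail, hence competes in the infimum \<open>d n\<close>.\<close>
    define h where "h = bind_pmf (pmf_of_set {True, False}) (\<lambda>b. if b then q else r)"
    have hS: "h \<in> S n" using that by (auto simp: S_def h_def split: if_splits)
    have avgh: "avg h x = (avg q x + avg r x) / 2" if "x \<in> space M" for x
      unfolding avg_def h_def
      by (subst expectation_bind_pmf_bounded[where B=B])
        (use bd[OF that] in \<open>auto simp: integral_pmf_of_set\<close>)
    have "4 * J h = (\<integral>x. 4 * (avg h x)\<^sup>2 \<partial>M)" by (simp add: J_def)
    also have "\<dots> = (\<integral>x. 2 * (avg q x)\<^sup>2 + 2 * (avg r x)\<^sup>2 - (avg q x - avg r x)\<^sup>2 \<partial>M)"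
      by (intro Bochner_Integration.integral_cong) (auto simp: avgh power2_eq_square field_simps)
    also have "\<dots> = 2 * J q + 2 * J r - (\<integral>x. (avg q x - avg r x)\<^sup>2 \<partial>M)"
    proof -
      have "integrable M (\<lambda>x. (avg q x - avg r x)\<^sup>2)"
        by (simp add: power2_diff mult.assoc)
      then show ?thesis by (simp add: J_def)
    qed
    finally show ?thesis using d_le[OF hS] by simp
  qed
  have dist_g: "(\<integral>x. (avg (g m) x - avg (g n) x)\<^sup>2 \<partial>M) \<le> 2 * (d m - d n) + 4 / real (Suc n)"
    if "n \<le> m" for m n
  proof -
    have this1: "g m \<in> S n" using gS[of m] S_anti[OF that] by auto
    have "J (g m) \<le> d m + 1 / real (Suc m)" "J (g n) \<le> d n + 1 / real (Suc n)"
      using gJ[of m] gJ[of n] by auto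
    with par[OF this1 gS[of n]]
    have "(\<integral>x. (avg (g m) x - avg (g n) x)\<^sup>2 \<partial>M)
        \<le> 2 * (d m + 1 / real (Suc m)) + 2 * (d n + 1 / real (Suc n)) - 4 * d n" by argo
    moreover have "1 / real (Suc m) \<le> 1 / real (Suc n)" using that by (simp add: frac_le)
    ultimately show ?thesis by simp
  qed
  have "convergent d"
    by (rule Bseq_mono_convergent) (use d_mono dB d_le J0 in
      \<open>auto intro!: BseqI'[of _ "B\<^sup>2"] simp: abs_le_iff d_def intro: cInf_greatest S_ne\<close>,
      metis (no_types, lifting) J0 S_ne cINF_greatest d_def neg_le_0_iff_le order_trans zero_le_power2)
  then have cd: "Cauchy d" by (simp add: Cauchy_convergent_iff)
  have "\<exists>N. \<forall>m n. N \<le> n \<longrightarrow> n \<le> m \<longrightarrow>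
      (\<integral>x. (avg (g m) x - avg (g n) x)\<^sup>2 \<partial>M) \<le> (1/4)^k" for k :: nat
  proof -
    \<comment> \<open>In \<open>dist_g\<close> the terms \<open>2 * (d m - d n)\<close> and
      \<open>4 / real (Suc n)\<close> are each given half of \<open>(1/4)^k\<close>.\<close>
    have e: "(0::real) < (1/4)^k / 4" by simp
    obtain N1 where N1: "\<And>m n. m \<ge> N1 \<Longrightarrow> n \<ge> N1 \<Longrightarrow> norm (d m - d n) < (1/4)^k / 4"
      using CauchyD[OF cd e] by blast
    obtain N2 where N2: "inverse (real (Suc N2)) < (1/4)^k / 8"
      using reals_Archimedean[of "(1/4)^k / 8"] by auto
    show ?thesis
    proof (intro exI[of _ "max N1 N2"] allI impI)
      fix m n assume n: "max N1 N2 \<le> n" and nm: "n \<le> m"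
      have "4 / real (Suc n) \<le> 4 * inverse (real (Suc N2))"
        using n by (simp add: field_simps)
      moreover have "d m - d n < (1/4)^k / 4" using N1[of m n] n nm by (simp only: real_norm_def) linarith
      ultimately show "(\<integral>x. (avg (g m) x - avg (g n) x)\<^sup>2 \<partial>M) \<le> (1/4)^k"
        using dist_g[OF nm] N2 by argo
    qed
  qed
  then obtain N where N: "\<And>k m n. N k \<le> n \<Longrightarrow> n \<le> m \<Longrightarrow>
      (\<integral>x. (avg (g m) x - avg (g n) x)\<^sup>2 \<partial>M) \<le> (1/4)^k" by metis
  \<comment> \<open>Summing the thresholds makes the indices monotone and at least
    \<open>N k\<close>; the summand k keeps the weights beyond k.\<close>
  define r where "r k = (\<Sum>j\<le>k. N j) + k" for k
  have rN: "N k \<le> r k" for k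
    unfolding r_def by (rule trans_le_add1) (rule member_le_sum, auto)
  have rk: "k \<le> r k" "r k \<le> r (Suc k)" for k by (auto simp: r_def)
  have ae: "AE x in M. convergent (\<lambda>k. avg (g (r k)) x)"
  proof (rule AE_convergent_of_summable_L1)
    fix k
    let ?D = "\<lambda>x. avg (g (r (Suc k))) x - avg (g (r k)) x"
    have iD: "integrable M (\<lambda>x. (?D x)\<^sup>2)" by (simp add: power2_diff mult.assoc)
    \<comment> \<open>The inequality of arithmetic and geometric means with weight
      \<open>2^k\<close> stands in for Cauchy-Schwarz: a squared distance of at most
      \<open>(1/4)^k\<close> makes both summands at most \<open>(1/2)^k\<close>.\<close>
    have "(\<integral>x. \<bar>?D x\<bar> \<partial>M) \<le> (\<integral>x. (2^k * (?D x)\<^sup>2 + (1/2)^k) / 2 \<partial>M)"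
    proof (rule integral_mono)
      fix x
      have am_gm: "2 * (c * \<bar>y\<bar>) \<le> c * c * y\<^sup>2 + 1" for c y :: real
      proof -
        have "0 \<le> (c * \<bar>y\<bar> - 1)\<^sup>2" by simp
        also have "\<dots> = c * c * \<bar>y\<bar>\<^sup>2 + 1 - 2 * (c * \<bar>y\<bar>)"
          by (simp add: power2_eq_square algebra_simps)
        finally show ?thesis by simp
      qed
      from am_gm[of "2^k" "?D x"]
      show "\<bar>?D x\<bar> \<le> (2^k * (?D x)\<^sup>2 + (1/2)^k) / 2"
        by (simp add: field_simps power_one_over)
    qed (use iD in auto)
    also have "\<dots> = (2^k * (\<integral>x. (?D x)\<^sup>2 \<partial>M) + (1/2)^k) / 2"
      using iD by (simp add: prob_space)
    also have "\<dots> \<le> (2^k * (1/4)^k + (1/2)^k) / 2"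
      using N[OF rN[of k] rk(2)[of k]] by (simp add: mult_left_mono)
    also have "\<dots> = (1/2)^k"
      by (simp flip: power_mult_distrib)
    finally show "(\<integral>x. \<bar>?D x\<bar> \<partial>M) \<le> (1/2)^k" .
  qed simp
  show ?thesis
  proof (rule that[of "\<lambda>k. g (r k)"])
    show "set_pmf (g (r n)) \<subseteq> {n..}" for n
      using gS[of "r n"] rk(1)[of n] by (auto simp: S_def)
    show "AE x in M. convergent (\<lambda>n. pmf_mean (g (r n)) (\<lambda>m. f m x))"
      using ae by (simp add: avg_def)
  qed
qed

section \<open>Compact spaces as subsets of the line\<close>

text \<open>
  The code \<open>s\<close> writes in ternary which balls of a countable family contain a point. Finitely many
  balls of small radius cover the compact set, so a long common prefix of two codes forces the
  points to be close, and decoding is uniformly continuous.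
\<close>

lemma ternary_digits_close:
  fixes a b :: "nat \<Rightarrow> bool"
  defines "v \<equiv> \<lambda>a::nat \<Rightarrow> bool. \<Sum>k. of_bool (a k) * (1/3::real)^k"
  assumes "\<bar>v a - v b\<bar> < (1/3)^N / 2" and "k \<le> N"
  shows "a k = b k"
proof (rule ccontr)
  have sm: "summable (\<lambda>k. of_bool (a k) * (1/3::real)^k)" for a :: "nat \<Rightarrow> bool"
    by (rule summable_comparison_test'[where g="\<lambda>k. (1/3::real)^k"]) auto
  assume "a k \<noteq> b k"
  \<comment> \<open>At the least disagreement m the leading term has size \<open>(1/3)^m\<close>,
    while all later digits together contribute at most half of it. Base 3 leaves this gap; binary
    expansions have none.\<close>
  define m where "m = (LEAST k. a k \<noteq> b k)"
  have m: "a m \<noteq> b m" unfolding m_def by (rule LeastI) fact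
  have mN: "m \<le> N" using Least_le[of "\<lambda>k. a k \<noteq> b k", OF \<open>a k \<noteq> b k\<close>] assms(3) by (simp add: m_def)
  have lt: "a j = b j" if "j < m" for j using not_less_Least[of j] that by (auto simp: m_def)
  define t where "t = (\<lambda>k. (of_bool (a k) - of_bool (b k)) * (1/3::real)^k)"
  have st: "summable t" unfolding t_def left_diff_distrib by (intro summable_diff sm)
  have "v a - v b = suminf t"
    unfolding v_def t_def left_diff_distrib by (rule suminf_diff) (rule sm)+
  also have "\<dots> = (\<Sum>j. t (j + Suc m)) + (\<Sum>j<Suc m. t j)"
    by (rule suminf_split_initial_segment[OF st])
  also have "(\<Sum>j<Suc m. t j) = t m" by (simp add: t_def lt)
  finally have eq: "v a - v b = (\<Sum>j. t (j + Suc m)) + t m" .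
  have "\<bar>\<Sum>j. t (j + Suc m)\<bar> \<le> (\<Sum>j. (1/3)^Suc m * (1/3::real)^j)"
  proof -
    have le: "norm (t (j + Suc m)) \<le> (1/3)^Suc m * (1/3::real)^j" for j
      by (auto simp: t_def power_add of_bool_def)
    have "summable (\<lambda>j. (1/3)^Suc m * (1/3::real)^j)" by (intro summable_mult summable_geometric) auto
    from norm_suminf_le[OF le this] show ?thesis by simp
  qed
  also have "\<dots> = (1/3)^m / 2"
    by (subst suminf_mult) (auto simp: suminf_geometric)
  finally have "\<bar>\<Sum>j. t (j + Suc m)\<bar> \<le> (1/3)^m / 2" .
  moreover have "\<bar>t m\<bar> = (1/3)^m" using m by (auto simp: t_def of_bool_def)
  ultimately have "(1/3)^m / 2 \<le> \<bar>v a - v b\<bar>" unfolding eq by linarith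
  moreover have "(1/3::real)^N \<le> (1/3)^m" by (rule power_decreasing) (use mN in auto)
  ultimately show False using assms(2) by linarith
qed

text \<open>The code s is merely Borel, as membership in a ball jumps, but its inverse is continuous
  and extends to the closure of the image. This one-sided regularity suffices to transport weak
  limits: measures go to the line along s and return along \<phi>.\<close>

lemma compact_borel_code:
  fixes U :: "'a::polish_space set"
  assumes U: "compact U" "U \<noteq> {}"
  obtains s :: "'a \<Rightarrow> real" and \<phi> :: "real \<Rightarrow> 'a" where "s \<in> borel_measurable borel"
    and "\<And>u. 0 \<le> s u" and "\<And>u. s u \<le> 2" and "continuous_on (closure (s ` U)) \<phi>" and "\<And>u. u \<in> U \<Longrightarrow> \<phi> (s u) = u"
    and "\<And>t. t \<in> closure (s ` U) \<Longrightarrow> \<phi> t \<in> U"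
proof -
  obtain D :: "'a set" where D: "countable D" "\<And>X. open X \<Longrightarrow> X \<noteq> {} \<Longrightarrow> \<exists>d\<in>D. d \<in> X"
    using countable_dense_exists by metis
  then have "D \<noteq> {}" by fastforce
  define d where "d = from_nat_into D"
  have rd: "range d = D" unfolding d_def by (rule range_from_nat_into) fact+
  \<comment> \<open>Digit k stands for the ball of radius \<open>1 / real (Suc j)\<close> around
    \<open>d i\<close>, where k encodes the pair (i, j).\<close>
  define G where "G k = ball (d (fst (prod_decode k))) (1 / real (Suc (snd (prod_decode k))))" for k
  have oG: "open (G k)" for k by (simp add: G_def)
  define s where "s u = (\<Sum>k. of_bool (u \<in> G k) * (1/3::real)^k)" for u
  have sm: "summable (\<lambda>k. of_bool (u \<in> G k) * (1/3::real)^k)" for u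
    by (rule summable_comparison_test'[where g="\<lambda>k. (1/3::real)^k"]) auto
  have s_meas: "s \<in> borel_measurable borel"
  proof -
    have [measurable]: "G k \<in> sets borel" for k using oG by (rule borel_open)
    show ?thesis unfolding s_def of_bool_def by measurable
  qed
  have s0: "0 \<le> s u" for u unfolding s_def by (rule suminf_nonneg[OF sm]) auto
  have s2: "s u \<le> 2" for u
  proof -
    have "s u \<le> (\<Sum>k. (1/3::real)^k)"
      unfolding s_def by (rule suminf_le[OF _ sm]) (auto intro: summable_geometric)
    then show ?thesis by (simp add: suminf_geometric)
  qed
  have unif: "\<exists>\<delta>>0. \<forall>u\<in>U. \<forall>v\<in>U. \<bar>s u - s v\<bar> < \<delta> \<longrightarrow> dist u v < e" if "e > 0" for e
  proof -
    obtain j where j: "inverse (real (Suc j)) < e / 2"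
      using reals_Archimedean[OF half_gt_zero[OF \<open>e > 0\<close>]] by blast
    have "U \<subseteq> (\<Union>i\<in>UNIV. ball (d i) (1 / real (Suc j)))"
    proof
      fix u
      obtain x where x: "x \<in> D" "x \<in> ball u (1 / real (Suc j))"
        using D(2)[of "ball u (1 / real (Suc j))"] by fastforce
      obtain i where "x = d i" using x(1) rd by auto
      then show "u \<in> (\<Union>i\<in>UNIV. ball (d i) (1 / real (Suc j)))" using x(2) by (auto simp: dist_commute)
    qed
    then obtain I where I: "finite I" "U \<subseteq> (\<Union>i\<in>I. ball (d i) (1 / real (Suc j)))"
      using compactE_image[OF U(1), of UNIV "\<lambda>i. ball (d i) (1 / real (Suc j))"] by auto
    \<comment> \<open>Every ball of the finite cover has its digit at a position at most N, so codes
      closer than \<open>(1/3)^N / 2\<close> agree on membership in each of these balls.\<close>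
    define N where "N = (\<Sum>i\<in>I. prod_encode (i, j))"
    have N: "prod_encode (i, j) \<le> N" if "i \<in> I" for i
      unfolding N_def using I(1) that by (intro member_le_sum) auto
    show ?thesis
    proof (intro exI[of _ "(1/3)^N / 2"] conjI ballI impI)
      fix u v assume uv: "u \<in> U" "v \<in> U" and lt: "\<bar>s u - s v\<bar> < (1/3)^N / 2"
      obtain i where i: "i \<in> I" "u \<in> ball (d i) (1 / real (Suc j))" using I(2) uv by blast
      have "u \<in> G (prod_encode (i, j)) \<longleftrightarrow> v \<in> G (prod_encode (i, j))"
        using ternary_digits_close[of "\<lambda>k. u \<in> G k" "\<lambda>k. v \<in> G k", OF _ N[OF i(1)]] lt
        by (simp add: s_def)
      then have "v \<in> ball (d i) (1 / real (Suc j))" using i(2) by (simp add: G_def)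
      with i(2) have "dist u v < 1 / real (Suc j) + 1 / real (Suc j)"
        by (metis dist_commute dist_triangle_less_add mem_ball)
      then show "dist u v < e" using j by (simp add: inverse_eq_divide)
    qed auto
  qed
  have inj: "inj_on s U"
  proof (rule inj_onI)
    fix u v assume "u \<in> U" "v \<in> U" "s u = s v"
    show "u = v"
    proof (rule ccontr)
      assume "u \<noteq> v"
      then show False using unif[of "dist u v"] \<open>u \<in> U\<close> \<open>v \<in> U\<close> \<open>s u = s v\<close> by force
    qed
  qed
  have "uniformly_continuous_on (s ` U) (inv_into U s)"
    unfolding uniformly_continuous_on_def
  proof (intro allI impI)
    fix e :: real assume "0 < e"
    from unif[OF this] obtain \<delta> where \<delta>: "\<delta> > 0" "\<And>u v. u \<in> U \<Longrightarrow> v \<in> U \<Longrightarrow> \<bar>s u - s v\<bar> < \<delta> \<Longrightarrow> dist u v < e"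
      by blast
    show "\<exists>d>0. \<forall>x\<in>s ` U. \<forall>x'\<in>s ` U. dist x' x < d \<longrightarrow> dist (inv_into U s x') (inv_into U s x) < e"
      using \<delta> inj by (intro exI[of _ \<delta>]) (auto simp: dist_real_def)
  qed
  \<comment> \<open>Uniform continuity of the inverse on the image permits the extension to the
    closure; its values stay in U because U is closed.\<close>
  then obtain \<phi> where \<phi>: "uniformly_continuous_on (closure (s ` U)) \<phi>"
    "\<And>t. t \<in> s ` U \<Longrightarrow> inv_into U s t = \<phi> t"
    using uniformly_continuous_on_extension_on_closure by metis
  have c: "continuous_on (closure (s ` U)) \<phi>" by (rule uniformly_continuous_imp_continuous) fact
  have \<phi>s: "\<phi> (s u) = u" if "u \<in> U" for u using \<phi>(2)[of "s u"] that inj by auto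
  have "\<phi> ` closure (s ` U) \<subseteq> U"
    by (rule image_closure_subset[OF c]) (use \<phi>s U in \<open>auto intro: compact_imp_closed\<close>)
  then show thesis using that[of s \<phi>] s_meas s0 s2 c \<phi>s by auto
qed

section \<open>Saddle points\<close>

text \<open>
  For \<open>d > 0\<close> the payoff \<open>V a b + d * N a\<close> has a saddle point: let \<open>b\<close> maximize its infimum over
  \<open>a\<close>. Minimizers against \<open>(1 - t) b + t b'\<close> with \<open>t\<close> tending to 0 accumulate at a minimizer
  against \<open>b\<close>, which is essentially unique by strict convexity, hence does not depend on \<open>b'\<close>.
  Then \<open>d\<close> tends to 0.
\<close>

lemma saddle_point_exists:
  fixes V :: "'a \<Rightarrow> 'b \<Rightarrow> real" and N :: "'a \<Rightarrow> real"
  assumes ne: "A \<noteq> {}" "B \<noteq> {}"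
    and bd: "\<And>a b. a \<in> A \<Longrightarrow> b \<in> B \<Longrightarrow> \<bar>V a b\<bar> \<le> C"
    and N: "\<And>a. a \<in> A \<Longrightarrow> 0 \<le> N a" "\<And>a. a \<in> A \<Longrightarrow> N a \<le> 1"
    and mixB: "\<And>b b' t. b \<in> B \<Longrightarrow> b' \<in> B \<Longrightarrow> 0 \<le> t \<Longrightarrow> t \<le> 1 \<Longrightarrow>
      \<exists>c\<in>B. \<forall>a\<in>A. V a c = (1 - t) * V a b + t * V a b'"
    and midA: "\<And>a a'. a \<in> A \<Longrightarrow> a' \<in> A \<Longrightarrow> \<exists>c\<in>A. (\<forall>b\<in>B. V c b = (V a b + V a' b) / 2) \<and>
      (N a + N a' \<le> 2 * N c \<longrightarrow> N a = N a' \<and> (\<forall>b\<in>B. V a b = V a' b))"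
    and cA: "\<And>a. (\<And>n. a n \<in> A) \<Longrightarrow> \<exists>c\<in>A. \<forall>b\<in>B. \<forall>d\<ge>0. \<forall>r.
      (\<forall>\<^sub>F n in sequentially. V (a n) b + d * N (a n) \<le> r) \<longrightarrow> V c b + d * N c \<le> r"
    and cB: "\<And>b. (\<And>n. b n \<in> B) \<Longrightarrow> \<exists>c\<in>B. \<forall>a\<in>A. \<forall>r.
      (\<forall>\<^sub>F n in sequentially. r \<le> V a (b n)) \<longrightarrow> r \<le> V a c"
  shows "\<exists>a\<in>A. \<exists>b\<in>B. \<forall>a'\<in>A. \<forall>b'\<in>B. V a b' \<le> V a b \<and> V a b \<le> V a' b"
proof -
  have "\<exists>a\<in>A. \<exists>b\<in>B. \<exists>s. \<forall>a'\<in>A. \<forall>b'\<in>B. V a b' \<le> s \<and> s \<le> V a' b + d"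
    if d: "d > 0" for d
  proof -
    define W where "W a b = V a b + d * N a" for a b
    define I where "I b = (INF a\<in>A. W a b)" for b
    define s where "s = (SUP b\<in>B. I b)"
    have dN: "0 \<le> d * N a" "d * N a \<le> d" if "a \<in> A" for a
      using N[OF that] d by (auto simp: mult_left_le)
    have W_bd: "\<bar>W a b\<bar> \<le> C + d" if "a \<in> A" "b \<in> B" for a b
      using bd[OF that] dN[OF that(1)] unfolding W_def by linarith
    have bbW: "bdd_below ((\<lambda>a. W a b) ` A)" if "b \<in> B" for b
      by (rule bdd_belowI2[of _ "- (C + d)"]) (use W_bd[OF _ that] in \<open>auto simp: abs_le_iff\<close>, fastforce)
    have I_le: "I b \<le> W a b" if "a \<in> A" "b \<in> B" for a b
      unfolding I_def using bbW that by (intro cINF_lower)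
    have I_ge: "r \<le> I b" if "\<And>a. a \<in> A \<Longrightarrow> r \<le> W a b" for r b
      unfolding I_def using that ne by (intro cINF_greatest)
    have I_bd: "I b \<le> C + d" if "b \<in> B" for b
      using ne I_le[OF _ that] W_bd[OF _ that] by (metis abs_le_D1 ex_in_conv order_trans)
    have bbI: "bdd_above (I ` B)" using I_bd by (rule bdd_aboveI2)
    have I_s: "I b \<le> s" if "b \<in> B" for b
      unfolding s_def using bbI that by (intro cSUP_upper)
    have "\<exists>b\<in>B. s - 1 / real (Suc n) \<le> I b" for n
    proof -
      have "s - 1 / real (Suc n) < s" by simp
      then show ?thesis using less_cSUP_iff[OF ne(2) bbI] unfolding s_def by (meson less_imp_le)
    qed
    then obtain bn where bn: "\<And>n. bn n \<in> B" "\<And>n. s - 1 / real (Suc n) \<le> I (bn n)" by metis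
    obtain b where b: "b \<in> B" and bc: "\<And>a r. a \<in> A \<Longrightarrow>
        \<forall>\<^sub>F n in sequentially. r \<le> V a (bn n) \<Longrightarrow> r \<le> V a b"
      using cB[of bn, OF bn(1)] by blast
    have sW: "s \<le> W a b" if a: "a \<in> A" for a
    proof (rule field_le_epsilon)
      fix e :: real assume e: "0 < e"
      have "s - e - d * N a \<le> V a b"
      proof (rule bc[OF a])
        obtain n0 where n0: "inverse (real (Suc n0)) < e" using reals_Archimedean[OF e] by auto
        show "\<forall>\<^sub>F n in sequentially. s - e - d * N a \<le> V a (bn n)"
          using eventually_ge_at_top[of n0]
        proof eventually_elim
          fix n assume "n0 \<le> n"
          then have "1 / real (Suc n) \<le> inverse (real (Suc n0))" by (simp add: field_simps)
          then show "s - e - d * N a \<le> V a (bn n)"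
            using bn(2)[of n] I_le[OF a bn(1)[of n]] n0 unfolding W_def by linarith
        qed
      qed
      then show "s \<le> W a b + e" by (simp add: W_def)
    qed
    have near: "\<exists>a\<in>A. W a b \<le> s \<and> W a b' \<le> s" if b': "b' \<in> B" for b'
    proof -
      \<comment> \<open>Moving b slightly towards b' forces near-minimizers to be good against b',
        because the payoff against b is already bounded below by s. With t at most 1/2 the weight
        left on b stays away from 0.\<close>
      define t where "t n = 1 / real (n + 2)" for n
      have t: "0 < t n" "t n \<le> 1/2" for n by (auto simp: t_def field_simps)
      have t0: "t \<longlonglongrightarrow> 0" unfolding t_def by real_asymp
      have "\<exists>a\<in>A. (1 - t n) * W a b + t n * W a b' \<le> s + (t n)\<^sup>2" for n
      proof -
        obtain c where c: "c \<in> B" "\<And>a. a \<in> A \<Longrightarrow> V a c = (1 - t n) * V a b + t n * V a b'"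
          using mixB[OF b b', of "t n"] t[of n] by (auto simp: less_imp_le)
        \<comment> \<open>The slack \<open>(t n)\<^sup>2\<close> is of smaller order than
          \<open>t n\<close>, because the bound against b' is obtained on division by
          \<open>t n\<close>.\<close>
        have "I c < s + (t n)\<^sup>2" using I_s[OF c(1)] t(1)[of n] by (simp add: less_add_same_cancel1 add_strict_increasing2 pos_add_strict order_le_less_trans)
        then obtain a where a: "a \<in> A" "W a c < s + (t n)\<^sup>2"
          using cINF_less_iff[OF ne(1) bbW[OF c(1)]] unfolding I_def by auto
        have "W a c = (1 - t n) * W a b + t n * W a b'"
          using c(2)[OF a(1)] by (simp add: W_def algebra_simps)
        then show ?thesis using a by (intro bexI[of _ a]) auto
      qed
      then obtain an where an: "\<And>n. an n \<in> A"
        "\<And>n. (1 - t n) * W (an n) b + t n * W (an n) b' \<le> s + (t n)\<^sup>2" by metis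
      obtain a where a: "a \<in> A" and ac: "\<And>b r. b \<in> B \<Longrightarrow>
          \<forall>\<^sub>F n in sequentially. W (an n) b \<le> r \<Longrightarrow> W a b \<le> r"
        using cA[of an, OF an(1)] d unfolding W_def by (metis less_imp_le)
      have "W a b' \<le> s"
      proof (rule field_le_epsilon)
        fix e :: real assume e: "0 < e"
        show "W a b' \<le> s + e"
        proof (rule ac[OF b'])
          have "\<forall>\<^sub>F n in sequentially. t n < e" using order_tendstoD(2)[OF t0 e] .
          then show "\<forall>\<^sub>F n in sequentially. W (an n) b' \<le> s + e"
          proof eventually_elim
            fix n assume te: "t n < e"
            have "(1 - t n) * s \<le> (1 - t n) * W (an n) b"
              using sW[OF an(1)[of n]] t[of n] by (intro mult_left_mono) auto
            then have "t n * W (an n) b' \<le> t n * (s + t n)"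
              using an(2)[of n] by (simp add: algebra_simps power2_eq_square)
            then have "W (an n) b' \<le> s + t n" using t(1)[of n] by simp
            then show "W (an n) b' \<le> s + e" using te by simp
          qed
        qed
      qed
      moreover have "W a b \<le> s"
      proof (rule field_le_epsilon)
        fix e :: real assume e: "0 < e"
        show "W a b \<le> s + e"
        proof (rule ac[OF b])
          have "(\<lambda>n. (t n)\<^sup>2 + t n * (C + d) + t n * (\<bar>C\<bar> + d) + t n * \<bar>s\<bar>) \<longlonglongrightarrow> 0\<^sup>2 + 0 * (C + d) + 0 * (\<bar>C\<bar> + d) + 0 * \<bar>s\<bar>"
            by (intro tendsto_intros t0)
          then have "(\<lambda>n. 2 * ((t n)\<^sup>2 + t n * (C + d) + t n * \<bar>s\<bar>)) \<longlonglongrightarrow> 2 * (0\<^sup>2 + 0 * (C + d) + 0 * \<bar>s\<bar>)"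
            by (intro tendsto_intros t0)
          then have "\<forall>\<^sub>F n in sequentially. 2 * ((t n)\<^sup>2 + t n * (C + d) + t n * \<bar>s\<bar>) < e"
            using e by (intro order_tendstoD(2)) auto
          then show "\<forall>\<^sub>F n in sequentially. W (an n) b \<le> s + e"
          proof eventually_elim
            fix n assume te: "2 * ((t n)\<^sup>2 + t n * (C + d) + t n * \<bar>s\<bar>) < e"
            have "- (C + d) \<le> W (an n) b'" using W_bd[OF an(1)[of n] b'] by linarith
            then have "t n * - (C + d) \<le> t n * W (an n) b'"
              using t(1)[of n] by (intro mult_left_mono) auto
            then have "- (t n * (C + d)) \<le> t n * W (an n) b'" by (simp only: mult_minus_right)
            moreover have "t n * s \<le> t n * \<bar>s\<bar>" "- (t n * s) \<le> t n * \<bar>s\<bar>" using t(1)[of n] by (auto simp: abs_if)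
            ultimately have *: "(1 - t n) * (W (an n) b - s) \<le> (t n)\<^sup>2 + t n * (C + d) + t n * \<bar>s\<bar>"
              using an(2)[of n] by (simp add: algebra_simps)
            have "(1 / 2) * (W (an n) b - s) \<le> (1 - t n) * (W (an n) b - s)"
              using sW[OF an(1)[of n]] t[of n] by (intro mult_right_mono) auto
            with * te show "W (an n) b \<le> s + e" by simp
          qed
        qed
      qed
      ultimately show ?thesis using a by auto
    qed
    obtain a where a: "a \<in> A" "W a b \<le> s" using near[OF b] by auto
    \<comment> \<open>Each b' brings its own point a', which strict convexity identifies with a:
      their midpoint c is worth at least s against b, so the regularizer cannot drop strictly there,
      and a and a' have the same payoffs.\<close>
    have aW: "W a b' \<le> s" if b': "b' \<in> B" for b'
    proof -
      obtain a' where a': "a' \<in> A" "W a' b \<le> s" "W a' b' \<le> s" using near[OF b'] by auto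
      obtain c where c: "c \<in> A" "\<And>b. b \<in> B \<Longrightarrow> V c b = (V a b + V a' b) / 2"
          "N a + N a' \<le> 2 * N c \<Longrightarrow> N a = N a' \<and> (\<forall>b\<in>B. V a b = V a' b)"
        using midA[OF a(1) a'(1)] by blast
      have "W a b + W a' b \<le> 2 * W c b" using sW[OF c(1)] a(2) a'(2) by linarith
      moreover have "d * (N a + N a') = d * N a + d * N a'" "d * (2 * N c) = 2 * (d * N c)"
        by (simp_all add: algebra_simps)
      moreover have "2 * V c b = V a b + V a' b" using c(2)[OF b] by simp
      ultimately have "d * (N a + N a') \<le> d * (2 * N c)" unfolding W_def by argo
      then have "N a + N a' \<le> 2 * N c" using d by simp
      then have "W a b' = W a' b'" using c(3) b' by (simp add: W_def)
      then show ?thesis using a'(3) by simp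
    qed
    show ?thesis
    proof (intro bexI[of _ a] bexI[of _ b] exI[of _ s] ballI conjI)
      fix a' b' assume "a' \<in> A" "b' \<in> B"
      then show "V a b' \<le> s" "s \<le> V a' b + d"
        using aW[of b'] sW[of a'] dN[OF a(1)] dN[of a'] unfolding W_def by auto
    qed (use a b in auto)
  qed
  then have "\<exists>a b s. a \<in> A \<and> b \<in> B \<and> (\<forall>a'\<in>A. \<forall>b'\<in>B. V a b' \<le> s \<and> s \<le> V a' b + 1 / real (Suc n))" for n
    by (metis divide_pos_pos of_nat_0_less_iff zero_less_Suc zero_less_one)
  then obtain a b s where ab: "\<And>n. a n \<in> A" "\<And>n. b n \<in> B"
    and le: "\<And>n b'. b' \<in> B \<Longrightarrow> V (a n) b' \<le> s n"
    and ge: "\<And>n a'. a' \<in> A \<Longrightarrow> s n \<le> V a' (b n) + 1 / real (Suc n)"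
    using ne by metis
  \<comment> \<open>Playing \<open>b n\<close> against \<open>a m\<close> compares the values of
    different regularizations; each \<open>s n\<close> is therefore within its own error of the
    common infimum v.\<close>
  have ss: "s n \<le> s m + 1 / real (Suc n)" for n m
    using ge[OF ab(1)[of m], of n] le[OF ab(2)[of n], of m] by linarith
  define v where "v = Inf (range s)"
  have bs: "bdd_below (range s)" using ss[of 0] by (auto intro!: bdd_belowI2[of _ "s 0 - 1"] simp: diff_le_eq)
  have vs: "v \<le> s n" "s n - 1 / real (Suc n) \<le> v" for n
  proof -
    show "v \<le> s n" unfolding v_def using bs by (intro cInf_lower) auto
    show "s n - 1 / real (Suc n) \<le> v" unfolding v_def
    proof (rule cInf_greatest)
      fix x assume "x \<in> range s"
      then obtain m where "x = s m" by auto
      then show "s n - 1 / real (Suc n) \<le> x" using ss[of n m] by argo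
    qed auto
  qed
  have small: "\<forall>\<^sub>F n in sequentially. 1 / real (Suc n) < e" if "e > 0" for e :: real
    by (rule order_tendstoD(2)[OF _ that]) real_asymp
  obtain a' where a'A: "a' \<in> A" and lim: "\<forall>b\<in>B. \<forall>d\<ge>0. \<forall>r.
      (\<forall>\<^sub>F n in sequentially. V (a n) b + d * N (a n) \<le> r) \<longrightarrow> V a' b + d * N a' \<le> r"
    using cA[of a, OF ab(1)] by blast
  \<comment> \<open>With d = 0 the compactness of A speaks about V alone, without the
    regularizer.\<close>
  have a': "a' \<in> A" "\<And>b r. b \<in> B \<Longrightarrow> \<forall>\<^sub>F n in sequentially. V (a n) b \<le> r \<Longrightarrow> V a' b \<le> r"
    using a'A lim[rule_format, where d=0] by simp_all
  obtain b' where b': "b' \<in> B" "\<And>a r. a \<in> A \<Longrightarrow> \<forall>\<^sub>F n in sequentially. r \<le> V a (b n) \<Longrightarrow> r \<le> V a b'"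
    using cB[of b, OF ab(2)] by blast
  have up: "V a' b \<le> v" if "b \<in> B" for b
  proof (rule field_le_epsilon)
    fix e :: real assume "0 < e"
    from small[OF this] show "V a' b \<le> v + e"
    proof (intro a'(2)[OF that], eventually_elim)
      fix n assume "1 / real (Suc n) < e"
      then show "V (a n) b \<le> v + e" using le[OF that, of n] vs(2)[of n] by linarith
    qed
  qed
  have lo: "v \<le> V a b'" if "a \<in> A" for a
  proof (rule field_le_epsilon)
    fix e :: real assume "0 < e"
    from small[OF this] have "v - e \<le> V a b'"
    proof (intro b'(2)[OF that], eventually_elim)
      fix n assume "1 / real (Suc n) < e"
      then show "v - e \<le> V a (b n)" using ge[OF that, of n] vs(1)[of n] by linarith
    qed
    then show "v \<le> V a b' + e" by simp
  qed
  have "V a' b' = v" using up[OF b'(1)] lo[OF a'(1)] by simp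
  then show ?thesis using a'(1) b'(1) up lo by (intro bexI[of _ a'] bexI[of _ b']) auto
qed

section \<open>Compactness of kernels\<close>

text \<open>Closing a countable basis under finite intersections keeps it countable; intersection
  stability makes it a generator on which probability measures can be compared.\<close>

lemma countable_Int_stable_basis:
  obtains G :: "nat \<Rightarrow> 'a::second_countable_topology set"
  where "\<And>i. open (G i)" and "Int_stable (range G)" and "sets borel = sigma_sets UNIV (range G)"
proof -
  obtain B :: "'a set set" where B: "countable B" "topological_basis B"
    using ex_countable_basis by blast
  define C where "C = Inter ` {F. finite F \<and> F \<subseteq> B}"
  have cC: "countable C" unfolding C_def by (intro countable_image countable_Collect_finite_subset B)
  have BC: "B \<subseteq> C"
  proof
    fix b assume "b \<in> B"
    then show "b \<in> C" unfolding C_def by (intro image_eqI[of _ _ "{b}"]) auto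
  qed
  have oC: "open c" if "c \<in> C" for c
    using that topological_basis_open[OF B(2)] unfolding C_def by (auto intro!: open_Inter)
  have tC: "topological_basis C"
    using B(2) BC oC unfolding topological_basis_def by (metis order_trans)
  have ne: "C \<noteq> {}" by (auto simp: C_def)
  have st: "Int_stable C"
  proof (rule Int_stableI)
    fix a b assume "a \<in> C" "b \<in> C"
    then obtain F F' where F: "finite F" "F \<subseteq> B" "a = \<Inter>F" "finite F'" "F' \<subseteq> B" "b = \<Inter>F'"
      by (auto simp: C_def)
    then show "a \<inter> b \<in> C" unfolding C_def
      by (intro image_eqI[of _ _ "F \<union> F'"]) auto
  qed
  have r: "range (from_nat_into C) = C" by (rule range_from_nat_into[OF ne cC])
  have "sets (borel :: 'a measure) = sigma_sets UNIV C"
    by (subst borel_eq_countable_basis[OF cC tC]) (simp add: sets_measure_of)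
  then show thesis
    using that[of "from_nat_into C"] r st oC ne by (auto simp: from_nat_into)
qed

text \<open>Intersection stable open sets identify a probability measure, and continuous functions
  tending to their indicators reduce this to integrals that pass to weak limits. Countability lets
  all tests be handled off a single null set.\<close>

definition determining ::
    "(nat \<Rightarrow> 'a::topological_space set) \<Rightarrow> (nat \<Rightarrow> nat \<Rightarrow> 'a \<Rightarrow> real) \<Rightarrow> bool" where
  "determining G \<phi> \<longleftrightarrow> (\<forall>i. open (G i)) \<and> Int_stable (range G) \<and> sets borel = sigma_sets UNIV (range G) \<and>
    (\<forall>i j. continuous_on UNIV (\<phi> i j)) \<and> (\<forall>i j x. 0 \<le> \<phi> i j x \<and> \<phi> i j x \<le> 1) \<and>
    (\<forall>i x. (\<lambda>j. \<phi> i j x) \<longlonglongrightarrow> indicator (G i) x)"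

lemma determiningD:
  assumes "determining G \<phi>"
  shows "open (G i)" and "Int_stable (range G)" and "sets borel = sigma_sets UNIV (range G)"
    and "continuous_on UNIV (\<phi> i j)" and "0 \<le> \<phi> i j x" and "\<phi> i j x \<le> 1"
    and "(\<lambda>j. \<phi> i j x) \<longlonglongrightarrow> indicator (G i) x"
  using assms unfolding determining_def by auto

lemma determining_exists:
  "\<exists>G \<phi>. determining G (\<phi> :: nat \<Rightarrow> nat \<Rightarrow> 'a::{metric_space, second_countable_topology} \<Rightarrow> real)"
proof -
  obtain G :: "nat \<Rightarrow> 'a set" where G: "\<And>i. open (G i)" "Int_stable (range G)"
      "sets borel = sigma_sets UNIV (range G)"
    by (rule countable_Int_stable_basis) blast
  \<comment> \<open>The distance to an empty complement is 0 by convention, so the whole space needs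
    its own case.\<close>
  define \<phi> where "\<phi> i j x = (if G i = UNIV then 1 else min 1 (real j * infdist x (- G i)))" for i j x
  have "continuous_on UNIV (\<phi> i j)" for i j
    by (cases "G i = UNIV") (auto simp: \<phi>_def intro!: continuous_intros)
  moreover have "(\<lambda>j. \<phi> i j x) \<longlonglongrightarrow> indicator (G i) x" for i x
    proof (cases "G i = UNIV")
      case False
      show ?thesis
      proof (cases "x \<in> G i")
        case True
        have "infdist x (- G i) \<noteq> 0"
          using in_closed_iff_infdist_zero[of "- G i" x] False True G(1)[of i] by auto
        then have p: "0 < infdist x (- G i)" using infdist_nonneg[of x "- G i"] by linarith
        obtain n where n: "1 < real n * infdist x (- G i)" using reals_Archimedean3[OF p] by blast
        have "\<forall>\<^sub>F j in sequentially. \<phi> i j x = 1"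
          using eventually_ge_at_top[of n]
        proof eventually_elim
          fix j assume "n \<le> j"
          then have "real n * infdist x (- G i) \<le> real j * infdist x (- G i)"
            by (intro mult_right_mono infdist_nonneg) auto
          then show "\<phi> i j x = 1" using n False by (auto simp: \<phi>_def)
        qed
        then show ?thesis using True by (simp add: tendsto_eventually)
      next
        assume x: "x \<notin> G i"
        then have "infdist x (- G i) = 0" by (intro infdist_zero) auto
        then show ?thesis using x False by (simp add: \<phi>_def)
      qed
    qed (simp add: \<phi>_def)
  moreover have "0 \<le> \<phi> i j x \<and> \<phi> i j x \<le> 1" for i j x by (auto simp: \<phi>_def infdist_nonneg)
  ultimately have "determining G \<phi>" using G unfolding determining_def by blast
  then show ?thesis by blast
qed

section \<open>Weak limits of probability measures on a compact set\<close>

lemma prob_algebra_borel_onD: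
  assumes "P \<in> space (prob_algebra (borel_on U))"
  shows "prob_space P" and "sets P = sets (borel_on U)" and "space P = U"
  using assms sets_eq_imp_space_eq[of P "borel_on U"] by (auto simp: space_prob_algebra space_restrict_space)

lemma borel_measurable_on_prob_algebra:
  assumes P: "P \<in> space (prob_algebra N)" and "f \<in> N \<rightarrow>\<^sub>M L"
  shows "f \<in> P \<rightarrow>\<^sub>M L"
  using assms by (simp add: space_prob_algebra cong: measurable_cong_sets)

text \<open>Prokhorov's theorem for a compact set, reduced to the line: the coded measures live on a
  bounded interval, hence are tight and have a convergent subsequence. Decoding works although s
  need not be continuous, because a continuous test a turns into the continuous function
  \<open>a \<circ> \<psi>\<close> on the closed set K.\<close>

lemma compact_prob_subsequence:
  fixes U :: "'a::polish_space set"
  assumes U: "compact U" and P: "\<And>n. P n \<in> space (prob_algebra (borel_on U))"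
  obtains r L where "strict_mono (r :: nat \<Rightarrow> nat)" and "L \<in> space (prob_algebra (borel_on U))"
    and "\<And>a :: 'a \<Rightarrow> real. continuous_on U a \<Longrightarrow> (\<lambda>n. \<integral>u. a u \<partial>P (r n)) \<longlonglongrightarrow> (\<integral>u. a u \<partial>L)"
proof -
  note PD = prob_algebra_borel_onD[OF P]
  have ne: "U \<noteq> {}" using prob_space.not_empty[OF PD(1)[of 0]] PD(3) by auto
  obtain s :: "'a \<Rightarrow> real" and \<psi> where s: "s \<in> borel_measurable borel" "\<And>u. 0 \<le> s u" "\<And>u. s u \<le> 2"
    and \<psi>: "continuous_on (closure (s ` U)) \<psi>" "\<And>u. u \<in> U \<Longrightarrow> \<psi> (s u) = u"
      "\<And>t. t \<in> closure (s ` U) \<Longrightarrow> \<psi> t \<in> U"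
    by (rule compact_borel_code[OF U ne]) blast
  define K where "K = closure (s ` U)"
  have K: "closed K" "K \<noteq> {}" "\<And>u. u \<in> U \<Longrightarrow> s u \<in> K"
    using ne closure_subset[of "s ` U"] by (auto simp: K_def)
  have sP [measurable]: "s \<in> P n \<rightarrow>\<^sub>M borel" for n
    by (rule borel_measurable_on_prob_algebra[OF P measurable_restrict_space1[OF s(1)]])
  define Q where "Q n = distr (P n) borel s" for n
  have Q: "real_distribution (Q n)" for n
    unfolding Q_def by (rule prob_space.real_distribution_distr[OF PD(1) sP])
  have "tight Q"
    unfolding tight_def
  proof (intro conjI allI impI Q)
    fix e :: real assume "0 < e"
    \<comment> \<open>Codes lie between 0 and 2; the left end is -1 because tightness is stated with
      intervals open on the left, and 0 may be a code.\<close>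
    have "measure (Q n) {-1<..2} = 1" for n
    proof -
      interpret Pn: prob_space "P n" by (rule PD)
      have "measure (Q n) {-1<..2} = measure (P n) (s -` {-1<..2} \<inter> space (P n))"
        unfolding Q_def by (rule measure_distr) auto
      also have "s -` {-1<..2} \<inter> space (P n) = space (P n)"
        using s(3) less_le_trans[OF _ s(2), of "-1"] by auto
      finally show ?thesis by (simp add: Pn.prob_space)
    qed
    then show "\<exists>a b. a < b \<and> (\<forall>n. 1 - e < measure (Q n) {a<..b})"
      using \<open>0 < e\<close> by (intro exI[of _ "-1"] exI[of _ 2]) auto
  qed
  from tight_imp_convergent_subsubsequence[OF this strict_mono_id]
  obtain r M where r: "strict_mono (r :: nat \<Rightarrow> nat)" and M: "real_distribution M"
    and w: "weak_conv_m (Q \<circ> r) M" by (auto simp: o_def)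
  interpret M: real_distribution M by fact
  have conv: "(\<lambda>n. \<integral>x. g x \<partial>Q (r n)) \<longlonglongrightarrow> (\<integral>x. g x \<partial>M)"
    if "continuous_on UNIV g" "\<And>x. \<bar>g x\<bar> \<le> C" for g :: "real \<Rightarrow> real" and C
    using weak_conv_imp_integral_bdd_continuous_conv[OF _ M w, of g C] Q that
    by (auto simp: continuous_on_eq_continuous_at)
  have intQ: "(\<integral>x. g x \<partial>Q n) = (\<integral>u. g (s u) \<partial>P n)" if "continuous_on UNIV g" for g :: "real \<Rightarrow> real" and n
    unfolding Q_def using that by (intro integral_distr) (auto intro: borel_measurable_continuous_onI)
  have MK: "AE x in M. x \<in> K"
  proof -
    \<comment> \<open>The truncated distance to K is bounded, continuous and zero on all codes, so
      its integral stays 0 in the limit; M is therefore carried by K.\<close>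
    define h where "h x = min 1 (infdist x K)" for x
    have h1: "continuous_on UNIV h" unfolding h_def by (intro continuous_intros)
    have h2: "\<bar>h x\<bar> \<le> 1" for x using infdist_nonneg[of x K] by (auto simp: h_def abs_if min_def)
    note h = h1 h2
    have hm [measurable]: "h \<in> borel_measurable borel" using h(1) by (rule borel_measurable_continuous_onI)
    have "(\<integral>x. h x \<partial>Q n) = 0" for n
    proof -
      have "(\<integral>x. h x \<partial>Q n) = (\<integral>u. 0 \<partial>P n)"
        unfolding intQ[OF h(1)]
        by (intro Bochner_Integration.integral_cong) (use K(3) PD(3) in \<open>auto simp: h_def infdist_zero\<close>)
      then show ?thesis by simp
    qed
    then have "(\<integral>x. h x \<partial>M) = 0"
      using conv[OF h] by (simp add: LIMSEQ_const_iff)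
    moreover have "integrable M h" using h by (intro M.integrable_const_bound[where B=1]) auto
    ultimately have "AE x in M. h x = 0"
      by (subst (asm) integral_nonneg_eq_0_iff_AE) (auto simp: h_def infdist_nonneg)
    then show ?thesis
      by eventually_elim (use in_closed_iff_infdist_zero[OF K(1,2)] in \<open>auto simp: h_def min_def split: if_splits\<close>)
  qed
  obtain u0 where u0: "u0 \<in> U" using ne by auto
  \<comment> \<open>Off K, a null set of M, a fixed point of U makes the decoder total with values
    in U.\<close>
  define \<psi>' where "\<psi>' x = (if x \<in> K then \<psi> x else u0)" for x
  have "\<psi>' \<in> borel_measurable borel"
    unfolding \<psi>'_def using \<psi>(1) K(1) by (intro borel_measurable_continuous_on_if) (auto simp: K_def)
  then have m\<psi> [measurable]: "\<psi>' \<in> M \<rightarrow>\<^sub>M borel_on U"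
    using \<psi>(3) u0 by (intro measurable_restrict_space2) (auto simp: \<psi>'_def K_def)
  define L where "L = distr M (borel_on U) \<psi>'"
  have L: "L \<in> space (prob_algebra (borel_on U))"
    unfolding L_def space_prob_algebra using M.prob_space_distr[OF m\<psi>] by auto
  have "(\<lambda>n. \<integral>u. a u \<partial>P (r n)) \<longlonglongrightarrow> (\<integral>u. a u \<partial>L)" if a: "continuous_on U a" for a :: "'a \<Rightarrow> real"
  proof -
    have "bounded (a ` U)" by (intro compact_imp_bounded compact_continuous_image a U)
    then obtain C where C: "\<And>u. u \<in> U \<Longrightarrow> \<bar>a u\<bar> \<le> C" "0 \<le> C"
      unfolding bounded_iff by (metis abs_ge_zero imageI order_trans real_norm_def u0)
    have "continuous_on K (a \<circ> \<psi>)" unfolding K_def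
      by (rule continuous_on_compose[OF \<psi>(1)]) (use \<psi>(3) in \<open>auto intro: continuous_on_subset[OF a]\<close>)
    \<comment> \<open>Tietze's theorem extends the test from K to the line with the same bound, as
      weak convergence on the line asks for a bounded continuous function there.\<close>
    then obtain g where g: "continuous_on UNIV g" "\<And>x. x \<in> K \<Longrightarrow> g x = a (\<psi> x)" "\<And>x. \<bar>g x\<bar> \<le> C"
      by (rule Tietze[of K "a \<circ> \<psi>" UNIV C]) (use K C \<psi>(3) in \<open>auto simp: K_def\<close>)
    have "(\<integral>u. a u \<partial>P n) = (\<integral>x. g x \<partial>Q n)" for n
      unfolding intQ[OF g(1)]
      by (intro Bochner_Integration.integral_cong) (use PD(3) K(3) g(2) \<psi>(2) in auto)
    moreover have "(\<integral>u. a u \<partial>L) = (\<integral>x. g x \<partial>M)"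
    proof -
      have am: "a \<in> borel_measurable (borel_on U)" by (rule borel_measurable_continuous_on_restrict[OF a])
      have [measurable]: "g \<in> borel_measurable borel" using g(1) by (rule borel_measurable_continuous_onI)
      have "(\<integral>u. a u \<partial>L) = (\<integral>x. a (\<psi>' x) \<partial>M)"
        unfolding L_def by (rule integral_distr[OF m\<psi> am])
      also have "\<dots> = (\<integral>x. g x \<partial>M)"
      proof (rule integral_cong_AE)
        show "(\<lambda>x. a (\<psi>' x)) \<in> borel_measurable M" by (rule measurable_compose[OF m\<psi> am])
        show "AE x in M. a (\<psi>' x) = g x" using MK by eventually_elim (auto simp: g(2) \<psi>'_def)
      qed simp
      finally show ?thesis .
    qed
    ultimately show ?thesis using conv[OF g(1,3)] by simp
  qed
  then show thesis using that[OF r L] by blast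
qed

lemma measure_open_limit:
  assumes P: "P \<in> space (prob_algebra (borel_on U))" and G: "open G"
    and m: "\<And>j. continuous_on UNIV (\<phi> j :: 'a::topological_space \<Rightarrow> real)"
    and b: "\<And>j x. 0 \<le> \<phi> j x" "\<And>j x. \<phi> j x \<le> 1" and lim: "\<And>x. (\<lambda>j. \<phi> j x) \<longlonglongrightarrow> indicator G x"
  shows "(\<lambda>j. \<integral>u. \<phi> j u \<partial>P) \<longlonglongrightarrow> measure P (U \<inter> G)"
proof -
  note PD = prob_algebra_borel_onD[OF P]
  interpret prob_space P by (rule PD)
  have [measurable]: "\<phi> j \<in> borel_measurable P" for j
    by (intro borel_measurable_on_prob_algebra[OF P] measurable_restrict_space1 borel_measurable_continuous_onI m)
  have S: "U \<inter> G \<in> sets P" unfolding PD(2) sets_restrict_space using G by auto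
  have [measurable]: "indicator G \<in> borel_measurable P"
    using G by (intro borel_measurable_on_prob_algebra[OF P] measurable_restrict_space1) auto
  have "(\<lambda>j. \<integral>u. \<phi> j u \<partial>P) \<longlonglongrightarrow> (\<integral>u. indicator G u \<partial>P)"
    by (rule integral_dominated_convergence[where w="\<lambda>_. 1"]) (use b lim in \<open>auto simp: abs_of_nonneg\<close>)
  also have "(\<integral>u. indicator G u \<partial>P) = (\<integral>u. indicator (U \<inter> G) u \<partial>P)"
    by (intro Bochner_Integration.integral_cong) (auto simp: indicator_def PD(3))
  also have "\<dots> = measure P (U \<inter> G)" using S by simp
  finally show ?thesis .
qed

lemma sets_borel_on_generated:
  assumes U: "U \<in> sets borel" and "Int_stable (range G)" "sets borel = sigma_sets UNIV (range G)"
  shows "sets (borel_on U) = sigma_sets U ((\<inter>) U ` range G)" and "Int_stable ((\<inter>) U ` range G)"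
    and "(\<inter>) U ` range G \<subseteq> Pow U"
proof -
  show "sets (borel_on U) = sigma_sets U ((\<inter>) U ` range G)"
    unfolding sets_restrict_space assms(3)
    by (rule sigma_sets_Int) (use U assms(3) in auto)
  show "Int_stable ((\<inter>) U ` range G)"
  proof (rule Int_stableI)
    fix a b assume "a \<in> (\<inter>) U ` range G" "b \<in> (\<inter>) U ` range G"
    then obtain i j where "a = U \<inter> G i" "b = U \<inter> G j" by auto
    moreover obtain k where "G i \<inter> G j = G k" using assms(2) unfolding Int_stable_def by blast
    ultimately have "a \<inter> b = U \<inter> G k" by auto
    then show "a \<inter> b \<in> (\<inter>) U ` range G" by auto
  qed
qed auto

lemma prob_eq_if_open_eq:
  assumes P: "P \<in> space (prob_algebra (borel_on U))" and Q: "Q \<in> space (prob_algebra (borel_on U))"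
    and U: "U \<in> sets borel" and G: "Int_stable (range G)" "sets borel = sigma_sets UNIV (range G)"
    and eq: "\<And>i::nat. measure P (U \<inter> G i) = measure Q (U \<inter> G i)"
  shows "P = Q"
proof -
  note PD = prob_algebra_borel_onD[OF P] and QD = prob_algebra_borel_onD[OF Q]
  interpret P: prob_space P by (rule PD)
  interpret Q: prob_space Q by (rule QD)
  note gen = sets_borel_on_generated[OF U G]
  show ?thesis
  proof (rule measure_eqI_generator_eq_countable)
    \<comment> \<open>The whole set U joins the generator because the uniqueness theorem asks for a
      countable cover by generators of finite measure.\<close>
    show "Int_stable (insert U ((\<inter>) U ` range G))"
      using gen(2,3) unfolding Int_stable_def by (auto simp: Int_absorb1 Int_absorb2)
    show "insert U ((\<inter>) U ` range G) \<subseteq> Pow U" by auto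
    show "emeasure P X = emeasure Q X" if "X \<in> insert U ((\<inter>) U ` range G)" for X
      using that eq P.emeasure_space_1 Q.emeasure_space_1 PD(3) QD(3)
      by (auto simp: P.emeasure_eq_measure Q.emeasure_eq_measure)
    have "sigma_sets U (insert U ((\<inter>) U ` range G)) = sigma_sets U ((\<inter>) U ` range G)"
      by (rule sigma_sets_eqI) (auto intro: sigma_sets_top)
    then show "sets P = sigma_sets U (insert U ((\<inter>) U ` range G))"
      and "sets Q = sigma_sets U (insert U ((\<inter>) U ` range G))"
      using PD(2) QD(2) gen(1) by auto
    show "{U} \<subseteq> insert U ((\<inter>) U ` range G)" "\<Union>{U} = U" by auto
    show "\<And>a. a \<in> {U} \<Longrightarrow> emeasure P a \<noteq> \<infinity>" by (simp add: P.emeasure_eq_measure)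
  qed auto
qed

section \<open>Mixtures of kernels and their almost sure weak limits\<close>

definition kernel_mixture :: "nat pmf \<Rightarrow> (nat \<Rightarrow> 'y \<Rightarrow> 'u measure) \<Rightarrow> 'y \<Rightarrow> 'u measure" where
  "kernel_mixture p \<gamma> y = measure_pmf p \<bind> (\<lambda>m. \<gamma> m y)"

lemma kernel_mixture_measurable:
  assumes [measurable]: "\<And>m. \<gamma> m \<in> M \<rightarrow>\<^sub>M prob_algebra N"
  shows "kernel_mixture p \<gamma> \<in> M \<rightarrow>\<^sub>M prob_algebra N"
proof -
  have p: "(\<lambda>_. measure_pmf p) \<in> M \<rightarrow>\<^sub>M prob_algebra (count_space UNIV)"
    by (rule measurable_const) (simp add: space_prob_algebra measure_pmf.prob_space_axioms)
  have "(\<lambda>(y, m). \<gamma> m y) \<in> M \<Otimes>\<^sub>M count_space UNIV \<rightarrow>\<^sub>M prob_algebra N" by measurable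
  from measurable_bind_prob_space2[OF p this] show ?thesis
    by (simp add: kernel_mixture_def[abs_def])
qed

lemma integral_kernel_mixture:
  fixes a :: "'u \<Rightarrow> real"
  assumes \<gamma>: "\<And>m. \<gamma> m \<in> M \<rightarrow>\<^sub>M prob_algebra N" and y: "y \<in> space M"
    and a: "a \<in> borel_measurable N" "\<And>u. u \<in> space N \<Longrightarrow> \<bar>a u\<bar> \<le> B"
  shows "(\<integral>u. a u \<partial>kernel_mixture p \<gamma> y) = pmf_mean p (\<lambda>m. \<integral>u. a u \<partial>\<gamma> m y)"
proof -
  have P: "\<gamma> m y \<in> space (prob_algebra N)" for m using measurable_space[OF \<gamma> y] .
  then have P': "prob_space (\<gamma> m y)" "sets (\<gamma> m y) = sets N" for m
    by (auto simp: space_prob_algebra)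
  show ?thesis unfolding kernel_mixture_def
  proof (rule integral_bind[where K=N and B=B and B'=1, OF a])
    show "(\<lambda>m. \<gamma> m y) \<in> measure_pmf p \<rightarrow>\<^sub>M subprob_algebra N"
      using P' by (auto simp: space_subprob_algebra prob_space_imp_subprob_space)
    show "AE m in measure_pmf p. emeasure (\<gamma> m y) (space (\<gamma> m y)) \<le> ennreal 1"
      using P'(1) by (simp add: prob_space.emeasure_space_1)
  qed (auto intro: measure_pmf.finite_measure_axioms)
qed

lemma integral_prob_bound:
  fixes a :: "'u \<Rightarrow> real"
  assumes P: "P \<in> space (prob_algebra N)" and a: "a \<in> borel_measurable N" "\<And>u. u \<in> space N \<Longrightarrow> \<bar>a u\<bar> \<le> B"
  shows "integrable P a" and "\<bar>\<integral>u. a u \<partial>P\<bar> \<le> B"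
proof -
  interpret prob_space P using P by (simp add: space_prob_algebra)
  have "sets P = sets N" using P by (simp add: space_prob_algebra)
  then have sp: "space P = space N" by (rule sets_eq_imp_space_eq)
  show i: "integrable P a"
    using a sp borel_measurable_on_prob_algebra[OF P a(1)] by (intro integrable_const_bound[where B=B]) auto
  have "\<bar>\<integral>u. a u \<partial>P\<bar> \<le> (\<integral>u. \<bar>a u\<bar> \<partial>P)" by (rule integral_abs_bound)
  also have "\<dots> \<le> (\<integral>u. B \<partial>P)" using a sp i by (intro integral_mono) auto
  finally show "\<bar>\<integral>u. a u \<partial>P\<bar> \<le> B" by (simp add: prob_space)
qed

lemma measurable_integral_kernel:
  fixes a :: "'u \<Rightarrow> real"
  assumes \<gamma>: "\<gamma> \<in> M \<rightarrow>\<^sub>M prob_algebra N" and a: "a \<in> borel_measurable N"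
  shows "(\<lambda>y. \<integral>u. a u \<partial>\<gamma> y) \<in> borel_measurable M"
  using measurable_compose[OF measurable_prob_algebraD[OF \<gamma>] integral_measurable_subprob_algebra[OF a]] .

lemma LIMSEQ_if_subseq_limit:
  fixes x :: "nat \<Rightarrow> 'a::metric_space"
  assumes "\<And>r :: nat \<Rightarrow> nat. strict_mono r \<Longrightarrow> \<exists>r' :: nat \<Rightarrow> nat. strict_mono r' \<and> (\<lambda>n. x (r (r' n))) \<longlonglongrightarrow> l"
  shows "x \<longlonglongrightarrow> l"
proof (rule ccontr)
  assume "\<not> x \<longlonglongrightarrow> l"
  then obtain e where e: "e > 0" "\<not> (\<forall>\<^sub>F n in sequentially. dist (x n) l < e)"
    unfolding tendsto_iff by auto
  then have inf: "infinite {n. \<not> dist (x n) l < e}"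
    using e(2) unfolding cofinite_eq_sequentially[symmetric] eventually_cofinite by simp
  define r where "r = enumerate {n. \<not> dist (x n) l < e}"
  have r: "strict_mono r" unfolding r_def using inf by (rule strict_mono_enumerate)
  have re: "\<not> dist (x (r n)) l < e" for n
    using enumerate_in_set[OF inf, of n] by (simp add: r_def)
  from assms[OF r] obtain r' where "(\<lambda>n. x (r (r' n))) \<longlonglongrightarrow> l" by blast
  then have "\<forall>\<^sub>F n in sequentially. dist (x (r (r' n))) l < e" using e(1) by (rule tendstoD)
  then have "\<forall>\<^sub>F n in sequentially. False" by eventually_elim (use re in auto)
  then show False by simp
qed

text \<open>Compactness gives every subsequence a further weakly convergent one. All these limits
  have the same integrals of the tests, hence coincide as measures, so the full sequence
  converges.\<close>

lemma compact_prob_converges_if_tests_do: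
  fixes U :: "'a::polish_space set"
  assumes U: "compact U" and P: "\<And>n. P n \<in> space (prob_algebra (borel_on U))"
    and G\<phi>: "determining G \<phi>"
    and conv: "\<And>i j. convergent (\<lambda>n. \<integral>u. \<phi> i j u \<partial>P n)"
  shows "\<exists>L\<in>space (prob_algebra (borel_on U)). \<forall>a :: 'a \<Rightarrow> real. continuous_on U a \<longrightarrow>
    (\<lambda>n. \<integral>u. a u \<partial>P n) \<longlonglongrightarrow> (\<integral>u. a u \<partial>L)"
proof -
  note G = determiningD(1-3)[OF G\<phi>] and \<phi> = determiningD(4-7)[OF G\<phi>]
  have Ub: "U \<in> sets borel" using U by (intro borel_closed compact_imp_closed)
  have c\<phi>: "continuous_on U (\<phi> i j)" for i j using \<phi>(1) by (rule continuous_on_subset) auto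
  have sub: "\<exists>(r' :: nat \<Rightarrow> nat) L. strict_mono r' \<and> L \<in> space (prob_algebra (borel_on U)) \<and>
      (\<forall>a :: 'a \<Rightarrow> real. continuous_on U a \<longrightarrow> (\<lambda>n. \<integral>u. a u \<partial>P (r (r' n))) \<longlonglongrightarrow> (\<integral>u. a u \<partial>L))" for r
    by (rule compact_prob_subsequence[OF U, of "\<lambda>n. P (r n)", OF P]) (intro exI conjI allI impI; assumption?)
  have lim: "(\<integral>u. \<phi> i j u \<partial>L) = lim (\<lambda>n. \<integral>u. \<phi> i j u \<partial>P n)"
    if r: "strict_mono r" and L: "(\<lambda>n. \<integral>u. \<phi> i j u \<partial>P (r n)) \<longlonglongrightarrow> (\<integral>u. \<phi> i j u \<partial>L)" for r L i j
  proof -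
    have "(\<lambda>n. \<integral>u. \<phi> i j u \<partial>P n) \<longlonglongrightarrow> lim (\<lambda>n. \<integral>u. \<phi> i j u \<partial>P n)"
      using conv by (simp add: convergent_LIMSEQ_iff)
    from LIMSEQ_unique[OF L LIMSEQ_subseq_LIMSEQ[OF this r, unfolded o_def]] show ?thesis .
  qed
  from sub[of id] obtain r L where r: "strict_mono r" and L: "L \<in> space (prob_algebra (borel_on U))"
    and rL: "\<And>a :: 'a \<Rightarrow> real. continuous_on U a \<Longrightarrow> (\<lambda>n. \<integral>u. a u \<partial>P (r n)) \<longlonglongrightarrow> (\<integral>u. a u \<partial>L)"
    by auto
  show ?thesis
  proof (intro bexI[of _ L] allI impI LIMSEQ_if_subseq_limit L)
    fix a :: "'a \<Rightarrow> real" and q :: "nat \<Rightarrow> nat" assume a: "continuous_on U a" and q: "strict_mono q"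
    from sub[of q] obtain q' L' where q': "strict_mono q'" and L': "L' \<in> space (prob_algebra (borel_on U))"
      and qL: "\<And>a :: 'a \<Rightarrow> real. continuous_on U a \<Longrightarrow> (\<lambda>n. \<integral>u. a u \<partial>P (q (q' n))) \<longlonglongrightarrow> (\<integral>u. a u \<partial>L')"
      by auto
    have qq: "strict_mono (\<lambda>n. q (q' n))" using strict_mono_o[OF q q'] by (simp add: o_def)
    have "L' = L"
    proof (rule prob_eq_if_open_eq[OF L' L Ub G(2,3)])
      fix i
      have "(\<lambda>j. \<integral>u. \<phi> i j u \<partial>L') \<longlonglongrightarrow> measure L' (U \<inter> G i)"
        by (rule measure_open_limit[OF L' G(1) \<phi>])
      moreover have "(\<lambda>j. \<integral>u. \<phi> i j u \<partial>L) \<longlonglongrightarrow> measure L (U \<inter> G i)"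
        by (rule measure_open_limit[OF L G(1) \<phi>])
      moreover have "(\<integral>u. \<phi> i j u \<partial>L') = (\<integral>u. \<phi> i j u \<partial>L)" for j
        using lim[OF qq qL[OF c\<phi>]] lim[OF r rL[OF c\<phi>]] by simp
      ultimately show "measure L' (U \<inter> G i) = measure L (U \<inter> G i)" by (simp add: LIMSEQ_unique)
    qed
    then show "\<exists>q' :: nat \<Rightarrow> nat. strict_mono q' \<and> (\<lambda>n. \<integral>u. a u \<partial>P (q (q' n))) \<longlonglongrightarrow> (\<integral>u. a u \<partial>L)"
      using q' qL[OF a] by blast
  qed
qed

text \<open>The integrals of all tests are collected into one sequence of functions on the product
  of M with a geometric distribution. A single choice of weights makes them all converge at almost
  every observation, and the pointwise weak limits form the limit kernel.\<close>

lemma kernels_compact: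
  fixes U :: "'u::polish_space set"
  assumes M: "prob_space M" and U: "compact U" "U \<noteq> {}"
    and \<gamma>: "\<And>m. \<gamma> m \<in> M \<rightarrow>\<^sub>M prob_algebra (borel_on U)"
  obtains p :: "nat \<Rightarrow> nat pmf" and \<gamma>' where "\<And>n. set_pmf (p n) \<subseteq> {n..}"
    and "\<gamma>' \<in> M \<rightarrow>\<^sub>M prob_algebra (borel_on U)"
    and "AE y in M. \<forall>a :: 'u \<Rightarrow> real. continuous_on U a \<longrightarrow>
      (\<lambda>n. \<integral>u. a u \<partial>kernel_mixture (p n) \<gamma> y) \<longlonglongrightarrow> (\<integral>u. a u \<partial>\<gamma>' y)"
proof -
  interpret M: prob_space M by (rule M)
  obtain G :: "nat \<Rightarrow> 'u set" and \<phi> where G\<phi>: "determining G \<phi>"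
    using determining_exists by blast
  note G = determiningD(1-3)[OF G\<phi>] and \<phi> = determiningD(4-7)[OF G\<phi>]
  have Ub: "U \<in> sets borel" using U(1) by (intro borel_closed compact_imp_closed)
  have m\<phi>: "\<phi> i j \<in> borel_measurable (borel_on U)" for i j
    by (intro measurable_restrict_space1 borel_measurable_continuous_onI \<phi>)
  have b\<phi>: "\<bar>\<phi> i j u\<bar> \<le> 1" for i j u using \<phi>(2,3)[where i=i and j=j and x=u] by simp
  define f where "f m = (\<lambda>(y, k). \<integral>u. \<phi> (fst (prod_decode k)) (snd (prod_decode k)) u \<partial>\<gamma> m y)" for m
  let ?g = "measure_pmf (geometric_pmf (1/2))"
  interpret pp: pair_prob_space M ?g ..
  have P: "\<gamma> m y \<in> space (prob_algebra (borel_on U))" if "y \<in> space M" for m y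
    using measurable_space[OF \<gamma> that] .
  have [measurable]: "f m \<in> borel_measurable (M \<Otimes>\<^sub>M ?g)" for m
  proof -
    define F where "F k y = (\<integral>u. \<phi> (fst (prod_decode k)) (snd (prod_decode k)) u \<partial>\<gamma> m y)" for k y
    have [measurable]: "F k \<in> borel_measurable M" for k
      unfolding F_def by (rule measurable_integral_kernel[OF \<gamma> m\<phi>])
    have "(\<lambda>(y, k). F k y) \<in> borel_measurable (M \<Otimes>\<^sub>M count_space UNIV)" by measurable
    then have "f m \<in> borel_measurable (M \<Otimes>\<^sub>M count_space UNIV)" by (simp add: f_def F_def)
    then show ?thesis by (simp cong: measurable_cong_sets sets_pair_measure_cong)
  qed
  obtain p :: "nat \<Rightarrow> nat pmf" where p: "\<And>n. set_pmf (p n) \<subseteq> {n..}"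
    and ae: "AE z in M \<Otimes>\<^sub>M ?g. convergent (\<lambda>n. pmf_mean (p n) (\<lambda>m. f m z))"
  proof (rule tail_averages_converge[of "M \<Otimes>\<^sub>M ?g" f 1])
    show "\<bar>f n x\<bar> \<le> 1" if "x \<in> space (M \<Otimes>\<^sub>M ?g)" for n x
      using that integral_prob_bound(2)[OF P m\<phi> b\<phi>] by (auto simp: f_def space_pair_measure)
  qed (auto intro: pp.prob_space_axioms)
  \<comment> \<open>The geometric distribution charges every k, so almost every k means every
    k.\<close>
  from pp.AE_pair[OF ae]
  have "AE y in M. \<forall>k. convergent (\<lambda>n. pmf_mean (p n) (\<lambda>m. f m (y, k)))"
    by (simp add: AE_measure_pmf_iff set_pmf_geometric)
  moreover have mix: "kernel_mixture (p n) \<gamma> \<in> M \<rightarrow>\<^sub>M prob_algebra (borel_on U)" for n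
    by (rule kernel_mixture_measurable[OF \<gamma>])
  have int: "(\<integral>u. \<phi> i j u \<partial>kernel_mixture (p n) \<gamma> y)
      = pmf_mean (p n) (\<lambda>m. f m (y, prod_encode (i, j)))" if "y \<in> space M" for y i j n
    by (subst integral_kernel_mixture[OF \<gamma> that m\<phi> b\<phi>]) (simp add: f_def)
  ultimately have "AE y in M. \<forall>i j. convergent (\<lambda>n. \<integral>u. \<phi> i j u \<partial>kernel_mixture (p n) \<gamma> y)"
    by (auto elim!: eventually_mono simp: AE_conj_iff int)
  then obtain Z where Z: "Z \<in> null_sets M" and conv: "\<And>y i j. y \<in> space M \<Longrightarrow> y \<notin> Z \<Longrightarrow>
      convergent (\<lambda>n. \<integral>u. \<phi> i j u \<partial>kernel_mixture (p n) \<gamma> y)"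
    unfolding eventually_ae_filter by blast
  \<comment> \<open>The limit is chosen separately at each observation; measurability is recovered
    below by writing the measure of each generator as an iterated limit of measurable
    functions.\<close>
  have "\<exists>L. y \<in> space M - Z \<longrightarrow> L \<in> space (prob_algebra (borel_on U)) \<and> (\<forall>a :: 'u \<Rightarrow> real. continuous_on U a \<longrightarrow>
      (\<lambda>n. \<integral>u. a u \<partial>kernel_mixture (p n) \<gamma> y) \<longlonglongrightarrow> (\<integral>u. a u \<partial>L))" for y
    using compact_prob_converges_if_tests_do[OF U(1) measurable_space[OF mix] G\<phi> conv, of y] by blast
  then obtain L where LP: "\<And>y. y \<in> space M - Z \<Longrightarrow> L y \<in> space (prob_algebra (borel_on U))"
    and LL: "\<And>y a. y \<in> space M - Z \<Longrightarrow> continuous_on U (a :: 'u \<Rightarrow> real) \<Longrightarrow>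
      (\<lambda>n. \<integral>u. a u \<partial>kernel_mixture (p n) \<gamma> y) \<longlonglongrightarrow> (\<integral>u. a u \<partial>L y)" by metis
  obtain u0 where u0: "u0 \<in> U" using U by auto
  have R: "return (borel_on U) u0 \<in> space (prob_algebra (borel_on U))"
    using u0 by (auto simp: space_prob_algebra space_restrict_space intro!: prob_space_return)
  \<comment> \<open>On the null set Z a fixed point mass keeps \<gamma>' a kernel
    everywhere.\<close>
  define \<gamma>' where "\<gamma>' y = (if y \<in> Z then return (borel_on U) u0 else L y)" for y
  have \<gamma>P: "\<gamma>' y \<in> space (prob_algebra (borel_on U))" if "y \<in> space M" for y
    using LP[of y] R that by (auto simp: \<gamma>'_def)
  note gen = sets_borel_on_generated[OF Ub G(2,3)]
  have Zs [measurable]: "Z \<in> sets M" using Z by auto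
  have "\<gamma>' \<in> M \<rightarrow>\<^sub>M prob_algebra (borel_on U)"
  proof (rule measurable_prob_algebra_generated[OF gen])
    fix y assume y: "y \<in> space M"
    show "prob_space (\<gamma>' y)" "sets (\<gamma>' y) = sets (borel_on U)"
      using \<gamma>P[OF y] by (auto simp: space_prob_algebra)
  next
    fix A assume "A \<in> (\<inter>) U ` range G"
    then obtain i where A: "A = U \<inter> G i" by auto
    define h where "h y = lim (\<lambda>j. lim (\<lambda>n. \<integral>u. \<phi> i j u \<partial>kernel_mixture (p n) \<gamma> y))" for y
    have [measurable]: "(\<lambda>y. \<integral>u. \<phi> i j u \<partial>kernel_mixture (p n) \<gamma> y) \<in> borel_measurable M" for j n
      by (rule measurable_integral_kernel[OF mix m\<phi>])
    have [measurable]: "h \<in> borel_measurable M" unfolding h_def by measurable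
    have "(\<lambda>y. ennreal (if y \<in> Z then measure (return (borel_on U) u0) A else h y)) \<in> borel_measurable M"
      by measurable
    then show "(\<lambda>y. emeasure (\<gamma>' y) A) \<in> borel_measurable M"
    proof (rule measurable_cong[THEN iffD2, rotated])
      fix y assume y: "y \<in> space M"
      interpret \<gamma>': prob_space "\<gamma>' y" using \<gamma>P[OF y] by (simp add: space_prob_algebra)
      have "h y = measure (L y) A" if "y \<notin> Z"
      proof -
        have "lim (\<lambda>n. \<integral>u. \<phi> i j u \<partial>kernel_mixture (p n) \<gamma> y) = (\<integral>u. \<phi> i j u \<partial>L y)" for j
          using y that by (intro limI LL) (auto intro: continuous_on_subset[OF \<phi>(1)])
        then have "h y = lim (\<lambda>j. \<integral>u. \<phi> i j u \<partial>L y)" by (simp add: h_def)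
        also have "\<dots> = measure (L y) A" unfolding A
          by (rule limI, rule measure_open_limit[OF LP G(1) \<phi>]) (use y that in auto)
        finally show ?thesis .
      qed
      then show "emeasure (\<gamma>' y) A = ennreal (if y \<in> Z then measure (return (borel_on U) u0) A else h y)"
        by (auto simp: \<gamma>'.emeasure_eq_measure) (auto simp: \<gamma>'_def)
    qed
  qed
  moreover have "AE y in M. y \<notin> Z" using Z by (rule AE_not_in)
  then have "AE y in M. \<forall>a :: 'u \<Rightarrow> real. continuous_on U a \<longrightarrow>
      (\<lambda>n. \<integral>u. a u \<partial>kernel_mixture (p n) \<gamma> y) \<longlonglongrightarrow> (\<integral>u. a u \<partial>\<gamma>' y)"
    using AE_space by eventually_elim (auto simp: \<gamma>'_def LL)
  ultimately show thesis using that[of p \<gamma>'] p by blast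
qed

section \<open>Decision problems and Bayesian games\<close>

lemma integral_pmf_average:
  fixes h :: "nat \<Rightarrow> 'a \<Rightarrow> real"
  assumes M: "prob_space M" and [measurable]: "\<And>m. h m \<in> borel_measurable M"
    and b: "\<And>m x. x \<in> space M \<Longrightarrow> \<bar>h m x\<bar> \<le> B"
  shows "(\<integral>x. pmf_mean p (\<lambda>m. h m x) \<partial>M)
    = pmf_mean p (\<lambda>m. \<integral>x. h m x \<partial>M)"
proof -
  interpret M: prob_space M by (rule M)
  interpret pair_prob_space M "measure_pmf p" ..
  have "(\<lambda>(x, m). h m x) \<in> borel_measurable (M \<Otimes>\<^sub>M count_space UNIV)" by measurable
  then have "(\<lambda>(x, m). h m x) \<in> borel_measurable (M \<Otimes>\<^sub>M measure_pmf p)"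
    by (simp cong: measurable_cong_sets sets_pair_measure_cong)
  then have "integrable (M \<Otimes>\<^sub>M measure_pmf p) (\<lambda>(x, m). h m x)"
    by (intro integrable_const_bound[where B=B]) (auto simp: b space_pair_measure intro!: AE_I2)
  from Fubini_integral[OF this] show ?thesis by simp
qed

text \<open>The difference of the two sides is a variance.\<close>

lemma square_pmf_average_le:
  fixes h :: "nat \<Rightarrow> real"
  assumes b: "\<And>m. \<bar>h m\<bar> \<le> B"
  shows "(pmf_mean p h)\<^sup>2 \<le> pmf_mean p (\<lambda>m. (h m)\<^sup>2)"
proof -
  have "(h m)\<^sup>2 \<le> B\<^sup>2" for m using b[of m] by (metis abs_ge_zero abs_le_square_iff abs_of_nonneg order_trans)
  then have "integrable (measure_pmf p) (\<lambda>m. (h m)\<^sup>2)" by (intro pmf_expectation_bounded(1)[where B="B\<^sup>2"]) auto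
  moreover have "integrable (measure_pmf p) h" using b by (rule pmf_expectation_bounded(1))
  ultimately have "measure_pmf.variance p h = pmf_mean p (\<lambda>m. (h m)\<^sup>2) - (pmf_mean p h)\<^sup>2"
    by (rule measure_pmf.variance_eq[rotated])
  moreover have "0 \<le> measure_pmf.variance p h" by simp
  ultimately show ?thesis by simp
qed

text \<open>For large n the weights see only indices where the bound already holds. This is the
  property by which forward averages can stand in for subsequences.\<close>

lemma tail_average_le:
  fixes x :: "nat \<Rightarrow> real"
  assumes p: "\<And>n. set_pmf (p n) \<subseteq> {n..}" and b: "\<And>n. \<bar>x n\<bar> \<le> B"
    and r: "\<forall>\<^sub>F n in sequentially. x n \<le> r"
  shows "\<forall>\<^sub>F n in sequentially. pmf_mean (p n) x \<le> r"
proof -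
  obtain n0 where n0: "\<And>n. n \<ge> n0 \<Longrightarrow> x n \<le> r" using r unfolding eventually_sequentially by auto
  show ?thesis using eventually_ge_at_top[of n0]
  proof eventually_elim
    fix n assume n: "n0 \<le> n"
    have "pmf_mean (p n) x \<le> pmf_mean (p n) (\<lambda>_. r)"
      using p[of n] n n0 pmf_expectation_bounded(1)[OF b]
      by (intro integral_mono_AE) (auto simp: AE_measure_pmf_iff)
    then show "pmf_mean (p n) x \<le> r" by simp
  qed
qed

text \<open>A limit already attained survives further averaging, which matters when the policies of
  a second player are averaged after those of the other.\<close>

lemma tail_average_tendsto:
  fixes x :: "nat \<Rightarrow> real"
  assumes p: "\<And>n. set_pmf (p n) \<subseteq> {n..}" and b: "\<And>n. \<bar>x n\<bar> \<le> B" and x: "x \<longlonglongrightarrow> l"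
  shows "(\<lambda>n. pmf_mean (p n) x) \<longlonglongrightarrow> l"
proof (rule order_tendstoI)
  fix a assume "a < l"
  then obtain a' where a': "a < a'" "a' < l" using dense by blast
  have "\<forall>\<^sub>F n in sequentially. - x n \<le> - a'"
    using order_tendstoD(1)[OF x a'(2)] by eventually_elim auto
  from tail_average_le[OF p _ this, of B] b
  show "\<forall>\<^sub>F n in sequentially. a < pmf_mean (p n) x"
    by (auto elim!: eventually_mono intro: less_le_trans[OF a'(1)])
next
  fix a assume "l < a"
  then obtain a' where a': "a' < a" "l < a'" using dense by blast
  have "\<forall>\<^sub>F n in sequentially. x n \<le> a'"
    using order_tendstoD(2)[OF x a'(2)] by eventually_elim auto
  from tail_average_le[OF p b this]
  show "\<forall>\<^sub>F n in sequentially. pmf_mean (p n) x < a"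
    by eventually_elim (use a'(1) in auto)
qed

text \<open>Pushing \<open>K x\<close> forward along \<open>h x\<close> moves the dependence of the
  integrand on x into the kernel and leaves the identity on the line as a fixed integrand.\<close>

lemma measurable_integral_kernel2:
  fixes h :: "'a \<Rightarrow> 'b \<Rightarrow> real"
  assumes K: "K \<in> M \<rightarrow>\<^sub>M prob_algebra N" and h: "(\<lambda>(x, y). h x y) \<in> borel_measurable (M \<Otimes>\<^sub>M N)"
  shows "(\<lambda>x. \<integral>y. h x y \<partial>K x) \<in> borel_measurable M"
proof -
  have "(\<lambda>x. distr (K x) borel (h x)) \<in> M \<rightarrow>\<^sub>M prob_algebra borel"
    by (rule measurable_distr_prob_space2[OF K h])
  then have "(\<lambda>x. \<integral>t. t \<partial>distr (K x) borel (h x)) \<in> borel_measurable M"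
    by (rule measurable_integral_kernel) simp
  then show ?thesis
  proof (rule measurable_cong[THEN iffD1, rotated])
    fix x assume x: "x \<in> space M"
    have "h x \<in> borel_measurable N" using measurable_Pair2[OF h x] by simp
    then have "h x \<in> borel_measurable (K x)"
      by (rule borel_measurable_on_prob_algebra[OF measurable_space[OF K x]])
    then show "(\<integral>t. t \<partial>distr (K x) borel (h x)) = (\<integral>y. h x y \<partial>K x)"
      by (rule integral_distr) simp
  qed
qed

text \<open>The weight t belongs to \<gamma>'. Writing it over the indices 0 and 1 lets two-point
  mixtures inherit what is known about \<open>kernel_mixture\<close>.\<close>

definition pair_mixture :: "real \<Rightarrow> ('y \<Rightarrow> 'u measure) \<Rightarrow> ('y \<Rightarrow> 'u measure) \<Rightarrow> 'y \<Rightarrow> 'u measure" where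
  "pair_mixture t \<gamma> \<gamma>' =
     kernel_mixture (map_pmf (\<lambda>x. if x then 1 else 0) (bernoulli_pmf t)) (\<lambda>m. if m = 0 then \<gamma> else \<gamma>')"

lemma pair_mixture_measurable:
  assumes "\<gamma> \<in> M \<rightarrow>\<^sub>M prob_algebra N" and "\<gamma>' \<in> M \<rightarrow>\<^sub>M prob_algebra N"
  shows "pair_mixture t \<gamma> \<gamma>' \<in> M \<rightarrow>\<^sub>M prob_algebra N"
  unfolding pair_mixture_def using assms by (intro kernel_mixture_measurable) auto

lemma expectation_two_points:
  fixes h :: "nat \<Rightarrow> real"
  assumes "0 \<le> t" "t \<le> 1"
  shows "pmf_mean (map_pmf (\<lambda>x. if x then 1 else 0) (bernoulli_pmf t)) h
    = (1 - t) * h 0 + t * h 1"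
  using assms by (simp add: integral_map_pmf mult.commute)

text \<open>Caratheodory integrands with a uniform bound: continuity in the action admits weak
  limits of policies, and the bound admits dominated convergence over w.\<close>

definition carath_bounded :: "'w measure \<Rightarrow> 'u::topological_space set \<Rightarrow> ('w \<Rightarrow> 'u \<Rightarrow> real) \<Rightarrow> real \<Rightarrow> bool" where
  "carath_bounded M U h b \<longleftrightarrow> (\<lambda>(w, u). h w u) \<in> borel_measurable (M \<Otimes>\<^sub>M borel_on U) \<and>
     (\<forall>w\<in>space M. (\<forall>u\<in>U. \<bar>h w u\<bar> \<le> b) \<and> continuous_on U (h w))"

text \<open>The decision maker observes \<open>f\<close> and then chooses an action in \<open>U\<close>.\<close>

locale observed_decision = prob_space M
  for M :: "'w measure" and S :: "'s measure" and f :: "'w \<Rightarrow> 's" and U :: "'u::polish_space set" +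
  assumes f [measurable]: "f \<in> M \<rightarrow>\<^sub>M S" and U: "compact U" "U \<noteq> {}"
begin

definition policies :: "('s \<Rightarrow> 'u measure) set" where
  "policies = S \<rightarrow>\<^sub>M prob_algebra (borel_on U)"

definition payoff :: "('w \<Rightarrow> 'u \<Rightarrow> real) \<Rightarrow> ('s \<Rightarrow> 'u measure) \<Rightarrow> real" where
  "payoff h \<gamma> = (\<integral>w. (\<integral>u. h w u \<partial>\<gamma> (f w)) \<partial>M)"

lemma policy_comp: "\<gamma> \<in> policies \<Longrightarrow> (\<lambda>w. \<gamma> (f w)) \<in> M \<rightarrow>\<^sub>M prob_algebra (borel_on U)"
  unfolding policies_def using measurable_compose[OF f] by auto

lemma policy_space: "\<gamma> \<in> policies \<Longrightarrow> w \<in> space M \<Longrightarrow> \<gamma> (f w) \<in> space (prob_algebra (borel_on U))"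
  using measurable_space[OF policy_comp] .

lemma kernel_mixture_policy: "(\<And>m. \<gamma> m \<in> policies) \<Longrightarrow> kernel_mixture p \<gamma> \<in> policies"
  unfolding policies_def by (rule kernel_mixture_measurable)

lemma pair_mixture_policy: "\<gamma> \<in> policies \<Longrightarrow> \<gamma>' \<in> policies \<Longrightarrow> pair_mixture t \<gamma> \<gamma>' \<in> policies"
  unfolding policies_def by (rule pair_mixture_measurable)

lemma policies_nonempty: "policies \<noteq> {}"
proof -
  obtain u where "u \<in> U" using U by auto
  then have "(\<lambda>_. return (borel_on U) u) \<in> policies" unfolding policies_def
    by (intro measurable_const) (auto simp: space_prob_algebra space_restrict_space intro!: prob_space_return)
  then show ?thesis by auto
qed

lemma carath_boundedD:
  assumes "carath_bounded M U h b"
  shows "(\<lambda>(w, u). h w u) \<in> borel_measurable (M \<Otimes>\<^sub>M borel_on U)"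
    and "w \<in> space M \<Longrightarrow> u \<in> space (borel_on U) \<Longrightarrow> \<bar>h w u\<bar> \<le> b"
    and "w \<in> space M \<Longrightarrow> continuous_on U (h w)"
    and "w \<in> space M \<Longrightarrow> h w \<in> borel_measurable (borel_on U)"
proof -
  show 1: "(\<lambda>(w, u). h w u) \<in> borel_measurable (M \<Otimes>\<^sub>M borel_on U)"
    using assms by (simp add: carath_bounded_def)
  show "w \<in> space M \<Longrightarrow> u \<in> space (borel_on U) \<Longrightarrow> \<bar>h w u\<bar> \<le> b" "w \<in> space M \<Longrightarrow> continuous_on U (h w)"
    using assms by (auto simp: carath_bounded_def space_restrict_space)
  show "w \<in> space M \<Longrightarrow> h w \<in> borel_measurable (borel_on U)"
    using measurable_Pair2[OF 1] by simp
qed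

lemma conditional_payoff:
  assumes h: "carath_bounded M U h b" and \<gamma>: "\<gamma> \<in> policies"
  shows "(\<lambda>w. \<integral>u. h w u \<partial>\<gamma> (f w)) \<in> borel_measurable M"
    and "w \<in> space M \<Longrightarrow> \<bar>\<integral>u. h w u \<partial>\<gamma> (f w)\<bar> \<le> b"
  using measurable_integral_kernel2[OF policy_comp[OF \<gamma>] carath_boundedD(1)[OF h]]
    integral_prob_bound(2)[OF policy_space[OF \<gamma>] carath_boundedD(4,2)[OF h]] by auto

lemma payoff_bound:
  assumes h: "carath_bounded M U h b" and \<gamma>: "\<gamma> \<in> policies"
  shows "\<bar>payoff h \<gamma>\<bar> \<le> b"
  unfolding payoff_def using conditional_payoff[OF assms] prob_space_axioms
  by (intro integral_prob_bound(2)[where N=M]) (auto simp: space_prob_algebra)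

lemma payoff_kernel_mixture:
  assumes h: "carath_bounded M U h b" and \<gamma>: "\<And>m. \<gamma> m \<in> policies"
  shows "payoff h (kernel_mixture p \<gamma>) = pmf_mean p (\<lambda>m. payoff h (\<gamma> m))"
proof -
  have "payoff h (kernel_mixture p \<gamma>)
      = (\<integral>w. pmf_mean p (\<lambda>m. \<integral>u. h w u \<partial>\<gamma> m (f w)) \<partial>M)"
    unfolding payoff_def
  proof (rule Bochner_Integration.integral_cong)
    fix w assume w: "w \<in> space M"
    show "(\<integral>u. h w u \<partial>kernel_mixture p \<gamma> (f w)) = pmf_mean p (\<lambda>m. \<integral>u. h w u \<partial>\<gamma> m (f w))"
      using \<gamma> measurable_space[OF f w] carath_boundedD(4,2)[OF h w] unfolding policies_def
      by (intro integral_kernel_mixture[where M=S and N="borel_on U" and B=b])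
  qed simp
  also have "\<dots> = pmf_mean p (\<lambda>m. payoff h (\<gamma> m))"
    unfolding payoff_def
    by (rule integral_pmf_average[OF prob_space_axioms conditional_payoff[OF h \<gamma>]])
  finally show ?thesis .
qed

lemma payoff_pair_mixture:
  assumes h: "carath_bounded M U h b" and "\<gamma> \<in> policies" "\<gamma>' \<in> policies" and t: "0 \<le> t" "t \<le> 1"
  shows "payoff h (pair_mixture t \<gamma> \<gamma>') = (1 - t) * payoff h \<gamma> + t * payoff h \<gamma>'"
proof -
  have "payoff h (pair_mixture t \<gamma> \<gamma>') = pmf_mean (map_pmf (\<lambda>x. if x then 1 else 0) (bernoulli_pmf t))
      (\<lambda>m::nat. payoff h (if m = 0 then \<gamma> else \<gamma>'))"
    unfolding pair_mixture_def by (rule payoff_kernel_mixture[OF h]) (use assms in auto)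
  then show ?thesis by (simp only: expectation_two_points[OF t]) simp
qed

text \<open>Compactness of kernels is applied to the law of the observation, and dominated
  convergence turns weak convergence at almost every w into convergence of payoffs. The pointwise
  convergence is recorded as well because the regularizer, being quadratic, is not a payoff.\<close>

lemma policies_compact:
  assumes \<gamma>: "\<And>n. \<gamma> n \<in> policies"
  obtains p \<gamma>' where "\<And>n. set_pmf (p n) \<subseteq> {n..}" and "\<gamma>' \<in> policies"
    and "AE w in M. \<forall>a :: 'u \<Rightarrow> real. continuous_on U a \<longrightarrow>
      (\<lambda>n. \<integral>u. a u \<partial>kernel_mixture (p n) \<gamma> (f w)) \<longlonglongrightarrow> (\<integral>u. a u \<partial>\<gamma>' (f w))"
    and "\<And>h b. carath_bounded M U h b \<Longrightarrow> (\<lambda>n. payoff h (kernel_mixture (p n) \<gamma>)) \<longlonglongrightarrow> payoff h \<gamma>'"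
proof -
  have D: "prob_space (distr M S f)" by (rule prob_space_distr) (rule f)
  have "\<gamma> n \<in> distr M S f \<rightarrow>\<^sub>M prob_algebra (borel_on U)" for n
    using \<gamma>[of n] by (simp add: policies_def)
  from kernels_compact[of "distr M S f" U \<gamma>, OF D U this]
  obtain p \<gamma>' where p: "\<And>n. set_pmf (p n) \<subseteq> {n..}" and \<gamma>': "\<gamma>' \<in> distr M S f \<rightarrow>\<^sub>M prob_algebra (borel_on U)"
    and ae: "AE y in distr M S f. \<forall>a :: 'u \<Rightarrow> real. continuous_on U a \<longrightarrow>
      (\<lambda>n. \<integral>u. a u \<partial>kernel_mixture (p n) \<gamma> y) \<longlonglongrightarrow> (\<integral>u. a u \<partial>\<gamma>' y)" by blast
  have g': "\<gamma>' \<in> policies" using \<gamma>' by (simp add: policies_def)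
  have ae': "AE w in M. \<forall>a :: 'u \<Rightarrow> real. continuous_on U a \<longrightarrow>
      (\<lambda>n. \<integral>u. a u \<partial>kernel_mixture (p n) \<gamma> (f w)) \<longlonglongrightarrow> (\<integral>u. a u \<partial>\<gamma>' (f w))"
    by (rule AE_distrD[OF f ae])
  have "(\<lambda>n. payoff h (kernel_mixture (p n) \<gamma>)) \<longlonglongrightarrow> payoff h \<gamma>'" if h: "carath_bounded M U h b" for h b
    unfolding payoff_def
  proof (rule integral_dominated_convergence[where w="\<lambda>_. b"])
    note mix = kernel_mixture_policy[of \<gamma>, OF \<gamma>]
    show "(\<lambda>w. \<integral>u. h w u \<partial>\<gamma>' (f w)) \<in> borel_measurable M"
      by (rule conditional_payoff[OF h g'])
    show "(\<lambda>w. \<integral>u. h w u \<partial>kernel_mixture (p n) \<gamma> (f w)) \<in> borel_measurable M" for n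
      by (rule conditional_payoff[OF h mix])
    show "AE w in M. (\<lambda>n. \<integral>u. h w u \<partial>kernel_mixture (p n) \<gamma> (f w)) \<longlonglongrightarrow> (\<integral>u. h w u \<partial>\<gamma>' (f w))"
      using ae' AE_space by eventually_elim (use carath_boundedD(3)[OF h] in auto)
    show "AE w in M. norm (\<integral>u. h w u \<partial>kernel_mixture (p n) \<gamma> (f w)) \<le> b" for n
      using conditional_payoff(2)[OF h mix] by (intro AE_I2) auto
  qed simp
  then show thesis using that[of p \<gamma>'] p g' ae' by blast
qed

end

section \<open>Strictly convex regularizers on policies\<close>

context observed_decision
begin

text \<open>Strict convexity is asked for only up to equal payoffs, as a policy can be altered on a
  null set of observations. Jensen's inequality is asked for arbitrary mixtures because forward
  averages may use infinitely many weights.\<close>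

definition regularizer :: "(('s \<Rightarrow> 'u measure) \<Rightarrow> real) \<Rightarrow> bool" where
  "regularizer N \<longleftrightarrow> (\<forall>\<gamma>\<in>policies. 0 \<le> N \<gamma> \<and> N \<gamma> \<le> 1) \<and>
    (\<forall>\<gamma>\<in>policies. \<forall>\<gamma>'\<in>policies. N \<gamma> + N \<gamma>' \<le> 2 * N (pair_mixture (1/2) \<gamma> \<gamma>') \<longrightarrow>
      N \<gamma> = N \<gamma>' \<and> (\<forall>h b. carath_bounded M U h b \<longrightarrow> payoff h \<gamma> = payoff h \<gamma>')) \<and>
    (\<forall>p \<gamma>. (\<forall>m. \<gamma> m \<in> policies) \<longrightarrow>
      N (kernel_mixture p \<gamma>) \<le> pmf_mean p (\<lambda>m. N (\<gamma> m))) \<and>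
    (\<forall>\<delta> \<gamma>'. (\<forall>n. \<delta> n \<in> policies) \<longrightarrow> \<gamma>' \<in> policies \<longrightarrow>
      (AE w in M. \<forall>a :: 'u \<Rightarrow> real. continuous_on U a \<longrightarrow>
        (\<lambda>n. \<integral>u. a u \<partial>\<delta> n (f w)) \<longlonglongrightarrow> (\<integral>u. a u \<partial>\<gamma>' (f w))) \<longrightarrow>
      (\<lambda>n. N (\<delta> n)) \<longlonglongrightarrow> N \<gamma>')"

lemma regularizerD:
  assumes "regularizer N"
  shows "\<gamma> \<in> policies \<Longrightarrow> 0 \<le> N \<gamma>" and "\<gamma> \<in> policies \<Longrightarrow> N \<gamma> \<le> 1"
    and "\<gamma> \<in> policies \<Longrightarrow> \<gamma>' \<in> policies \<Longrightarrow> N \<gamma> + N \<gamma>' \<le> 2 * N (pair_mixture (1/2) \<gamma> \<gamma>') \<Longrightarrow>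
      N \<gamma> = N \<gamma>' \<and> (carath_bounded M U h b \<longrightarrow> payoff h \<gamma> = payoff h \<gamma>')"
    and "(\<And>m. \<delta> m \<in> policies) \<Longrightarrow>
      N (kernel_mixture p \<delta>) \<le> pmf_mean p (\<lambda>m. N (\<delta> m))"
    and "(\<And>n. \<delta> n \<in> policies) \<Longrightarrow> \<gamma>' \<in> policies \<Longrightarrow>
      AE w in M. \<forall>a :: 'u \<Rightarrow> real. continuous_on U a \<longrightarrow>
        (\<lambda>n. \<integral>u. a u \<partial>\<delta> n (f w)) \<longlonglongrightarrow> (\<integral>u. a u \<partial>\<gamma>' (f w)) \<Longrightarrow>
      (\<lambda>n. N (\<delta> n)) \<longlonglongrightarrow> N \<gamma>'"
  using assms unfolding regularizer_def by simp_all blast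

text \<open>A regularizer is the mean square of countably many integrals that determine the policy.\<close>

lemma regularizer_exists: "\<exists>N. regularizer N"
proof -
  obtain G :: "nat \<Rightarrow> 'u set" and \<phi> where G\<phi>: "determining G \<phi>"
    using determining_exists by blast
  note G = determiningD(1-3)[OF G\<phi>] and \<phi> = determiningD(4-7)[OF G\<phi>]
  have Ub: "U \<in> sets borel" using U(1) by (intro borel_closed compact_imp_closed)
  define \<psi> where "\<psi> k = \<phi> (fst (prod_decode k)) (snd (prod_decode k))" for k
  have m\<psi>: "\<psi> k \<in> borel_measurable (borel_on U)" for k
    unfolding \<psi>_def by (intro measurable_restrict_space1 borel_measurable_continuous_onI \<phi>)
  have b\<psi>: "\<bar>\<psi> k u\<bar> \<le> 1" for k u
    using \<phi>(2,3)[where i="fst (prod_decode k)" and j="snd (prod_decode k)" and x=u] by (simp add: \<psi>_def)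
  have c\<psi>: "continuous_on U (\<psi> k)" for k
    unfolding \<psi>_def by (rule continuous_on_subset[OF \<phi>(1)]) auto
  let ?g = "measure_pmf (geometric_pmf (1/2))"
  interpret pp: pair_prob_space M ?g ..
  \<comment> \<open>The square is integrated over w and the index of the test together, so it sees
    all tests at almost every w at once.\<close>
  define Q where "Q = M \<Otimes>\<^sub>M ?g"
  interpret Q: prob_space Q unfolding Q_def by (rule pp.prob_space_axioms)
  define g where "g \<gamma> = (\<lambda>(w, k). \<integral>u. \<psi> k u \<partial>\<gamma> (f w))" for \<gamma>
  have m [measurable]: "g \<gamma> \<in> borel_measurable Q" if \<gamma>: "\<gamma> \<in> policies" for \<gamma>
  proof -
    define F where "F k w = (\<integral>u. \<psi> k u \<partial>\<gamma> (f w))" for k w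
    have [measurable]: "F k \<in> borel_measurable M" for k
      unfolding F_def by (rule measurable_integral_kernel[OF policy_comp[OF \<gamma>] m\<psi>])
    have "(\<lambda>(w, k). F k w) \<in> borel_measurable (M \<Otimes>\<^sub>M count_space UNIV)" by measurable
    then have "g \<gamma> \<in> borel_measurable (M \<Otimes>\<^sub>M count_space UNIV)" by (simp add: g_def F_def)
    then show ?thesis unfolding Q_def by (simp cong: measurable_cong_sets sets_pair_measure_cong)
  qed
  have sQ: "fst z \<in> space M" if "z \<in> space Q" for z using that by (auto simp: Q_def space_pair_measure)
  have gb: "\<bar>g \<gamma> z\<bar> \<le> 1" if "\<gamma> \<in> policies" "z \<in> space Q" for \<gamma> z
    using integral_prob_bound(2)[OF policy_space[OF that(1) sQ[OF that(2)]] m\<psi> b\<psi>]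
    by (simp add: g_def split_beta)
  have gb2: "(g \<gamma> z)\<^sup>2 \<le> 1" if "\<gamma> \<in> policies" "z \<in> space Q" for \<gamma> z
    using gb[OF that] by (simp add: abs_square_le_1)
  have int2: "integrable Q (\<lambda>z. (g \<gamma> z)\<^sup>2)" if "\<gamma> \<in> policies" for \<gamma>
    using that gb2[OF that] by (intro Q.integrable_const_bound[where B=1]) auto
  define N where "N \<gamma> = (\<integral>z. (g \<gamma> z)\<^sup>2 \<partial>Q)" for \<gamma>
  have N0: "0 \<le> N \<gamma>" for \<gamma> by (simp add: N_def)
  have N1: "N \<gamma> \<le> 1" if "\<gamma> \<in> policies" for \<gamma>
  proof -
    have "N \<gamma> \<le> (\<integral>z. 1 \<partial>Q)" unfolding N_def
      by (rule integral_mono) (use int2[OF that] gb2[OF that] in auto)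
    then show ?thesis by (simp add: Q.prob_space)
  qed
  have gmix: "g (kernel_mixture p \<gamma>) z = pmf_mean p (\<lambda>m. g (\<gamma> m) z)"
    if "\<And>m. \<gamma> m \<in> policies" "z \<in> space Q" for p \<gamma> z
    using integral_kernel_mixture[of \<gamma> S "borel_on U" "f (fst z)" "\<psi> (snd z)" 1 p] m\<psi> b\<psi>
      that(1) measurable_space[OF f sQ[OF that(2)]]
    by (simp add: g_def split_beta policies_def)
  have strict: "N \<gamma> = N \<gamma>' \<and> (carath_bounded M U h b \<longrightarrow> payoff h \<gamma> = payoff h \<gamma>')"
    if \<gamma>: "\<gamma> \<in> policies" and \<gamma>': "\<gamma>' \<in> policies"
      and le: "N \<gamma> + N \<gamma>' \<le> 2 * N (pair_mixture (1/2) \<gamma> \<gamma>')" for \<gamma> \<gamma>' h b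
  proof -
    note [measurable] = m[OF \<gamma>] m[OF \<gamma>']
    have mid: "g (pair_mixture (1/2) \<gamma> \<gamma>') z = (g \<gamma> z + g \<gamma>' z) / 2" if "z \<in> space Q" for z
    proof -
      have "g (pair_mixture (1/2) \<gamma> \<gamma>') z = pmf_mean
          (map_pmf (\<lambda>x. if x then 1 else 0) (bernoulli_pmf (1/2))) (\<lambda>m::nat. g (if m = 0 then \<gamma> else \<gamma>') z)"
        unfolding pair_mixture_def by (rule gmix) (use \<gamma> \<gamma>' that in auto)
      also have "\<dots> = (g \<gamma> z + g \<gamma>' z) / 2" by (subst expectation_two_points) auto
      finally show ?thesis .
    qed
    have i: "integrable Q (\<lambda>z. (g \<gamma> z - g \<gamma>' z)\<^sup>2)"
    proof (rule Q.integrable_const_bound[where B=4])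
      show "AE z in Q. norm ((g \<gamma> z - g \<gamma>' z)\<^sup>2) \<le> 4"
      proof (rule AE_I2)
        fix z assume "z \<in> space Q"
        then have "\<bar>g \<gamma> z - g \<gamma>' z\<bar> \<le> 2" using gb[OF \<gamma>] gb[OF \<gamma>'] by (smt (verit))
        from power_mono[OF this, of 2] show "norm ((g \<gamma> z - g \<gamma>' z)\<^sup>2) \<le> 4" by simp
      qed
    qed measurable
    \<comment> \<open>The parallelogram identity: the gap in midpoint convexity is half the squared
      distance. Without a gap all tests agree almost everywhere, and the tests identify the
      policy.\<close>
    have "2 * N (pair_mixture (1/2) \<gamma> \<gamma>') = (\<integral>z. (g \<gamma> z)\<^sup>2 + (g \<gamma>' z)\<^sup>2 - (g \<gamma> z - g \<gamma>' z)\<^sup>2 / 2 \<partial>Q)"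
      unfolding N_def integral_mult_right_zero[symmetric]
      by (intro Bochner_Integration.integral_cong) (auto simp: mid power2_eq_square field_simps)
    also have "\<dots> = N \<gamma> + N \<gamma>' - (\<integral>z. (g \<gamma> z - g \<gamma>' z)\<^sup>2 \<partial>Q) / 2"
      using i int2[OF \<gamma>] int2[OF \<gamma>'] by (simp add: N_def)
    finally have "(\<integral>z. (g \<gamma> z - g \<gamma>' z)\<^sup>2 \<partial>Q) \<le> 0" using le by simp
    then have "(\<integral>z. (g \<gamma> z - g \<gamma>' z)\<^sup>2 \<partial>Q) = 0" by (intro antisym) auto
    then have "AE z in Q. (g \<gamma> z - g \<gamma>' z)\<^sup>2 = 0"
      by (subst (asm) integral_nonneg_eq_0_iff_AE[OF i]) auto
    then have ae: "AE z in Q. g \<gamma> z = g \<gamma>' z" by eventually_elim simp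
    have "N \<gamma> = N \<gamma>'" unfolding N_def
      by (rule integral_cong_AE) (use ae in \<open>auto elim: eventually_mono\<close>)
    moreover have "payoff h \<gamma> = payoff h \<gamma>'" if h: "carath_bounded M U h b"
    proof -
      have "AE w in M. \<forall>k. g \<gamma> (w, k) = g \<gamma>' (w, k)"
        using pp.AE_pair[OF ae[unfolded Q_def]] by (simp add: AE_measure_pmf_iff set_pmf_geometric)
      then have "AE w in M. \<gamma> (f w) = \<gamma>' (f w)"
        using AE_space
      proof eventually_elim
        fix w assume eq: "\<forall>k. g \<gamma> (w, k) = g \<gamma>' (w, k)" and w: "w \<in> space M"
        show "\<gamma> (f w) = \<gamma>' (f w)"
        proof (rule prob_eq_if_open_eq[OF policy_space[OF \<gamma> w] policy_space[OF \<gamma>' w] Ub G(2,3)])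
          fix i
          have "(\<integral>u. \<phi> i j u \<partial>\<gamma> (f w)) = (\<integral>u. \<phi> i j u \<partial>\<gamma>' (f w))" for j
            using eq[rule_format, of "prod_encode (i, j)"] by (simp add: g_def \<psi>_def)
          then show "measure (\<gamma> (f w)) (U \<inter> G i) = measure (\<gamma>' (f w)) (U \<inter> G i)"
            using measure_open_limit[OF policy_space[OF \<gamma> w] G(1)[of i] \<phi>]
              measure_open_limit[OF policy_space[OF \<gamma>' w] G(1)[of i] \<phi>]
            by (simp add: LIMSEQ_unique)
        qed
      qed
      then show ?thesis unfolding payoff_def
        by (intro integral_cong_AE conditional_payoff[OF h] \<gamma> \<gamma>') (auto elim: eventually_mono)
    qed
    ultimately show ?thesis by blast
  qed
  have convex: "N (kernel_mixture p \<gamma>) \<le> pmf_mean p (\<lambda>m. N (\<gamma> m))"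
    if \<gamma>: "\<And>m. \<gamma> m \<in> policies" for p \<gamma>
  proof -
    have gm2: "(\<lambda>z. (g (\<gamma> m) z)\<^sup>2) \<in> borel_measurable Q" for m using m[OF \<gamma>[of m]] by measurable
    have i: "integrable Q (\<lambda>z. pmf_mean p (\<lambda>m. (g (\<gamma> m) z)\<^sup>2))"
    proof (intro Q.integrable_const_bound[where B=1] measurable_pmf_average gm2 AE_I2)
      fix z assume "z \<in> space Q"
      from gb2[OF \<gamma> this]
      show "norm (pmf_mean p (\<lambda>m. (g (\<gamma> m) z)\<^sup>2)) \<le> 1"
        unfolding real_norm_def by (intro pmf_expectation_bounded(2)) simp
    qed
    have "N (kernel_mixture p \<gamma>) \<le> (\<integral>z. pmf_mean p (\<lambda>m. (g (\<gamma> m) z)\<^sup>2) \<partial>Q)"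
      unfolding N_def
    proof (rule integral_mono[OF int2[OF kernel_mixture_policy[OF \<gamma>]] i])
      fix z assume z: "z \<in> space Q"
      show "(g (kernel_mixture p \<gamma>) z)\<^sup>2 \<le> pmf_mean p (\<lambda>m. (g (\<gamma> m) z)\<^sup>2)"
        unfolding gmix[of \<gamma>, OF \<gamma> z] by (rule square_pmf_average_le[where B=1]) (rule gb[OF \<gamma> z])
    qed
    also have "\<dots> = pmf_mean p (\<lambda>m. N (\<gamma> m))"
      unfolding N_def by (rule integral_pmf_average[OF Q.prob_space_axioms gm2, where B=1])
        (use gb2[OF \<gamma>] in auto)
    finally show ?thesis .
  qed
  have cont: "(\<lambda>n. N (\<delta> n)) \<longlonglongrightarrow> N \<gamma>'"
    if \<delta>: "\<And>n. \<delta> n \<in> policies" and \<gamma>': "\<gamma>' \<in> policies"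
      and ae: "AE w in M. \<forall>a :: 'u \<Rightarrow> real. continuous_on U a \<longrightarrow>
        (\<lambda>n. \<integral>u. a u \<partial>\<delta> n (f w)) \<longlonglongrightarrow> (\<integral>u. a u \<partial>\<gamma>' (f w))" for \<delta> \<gamma>'
    unfolding N_def
  proof (rule integral_dominated_convergence[where w="\<lambda>_. 1"])
    \<comment> \<open>Convergence at almost every w is lifted to the product through its marginal
      M.\<close>
    have fq: "fst \<in> Q \<rightarrow>\<^sub>M M" and dq: "distr Q M fst = M"
      unfolding Q_def by (auto simp: prob_space.distr_pair_fst prob_space_axioms measure_pmf.prob_space_axioms)
    have "AE z in Q. \<forall>a :: 'u \<Rightarrow> real. continuous_on U a \<longrightarrow>
        (\<lambda>n. \<integral>u. a u \<partial>\<delta> n (f (fst z))) \<longlonglongrightarrow> (\<integral>u. a u \<partial>\<gamma>' (f (fst z)))"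
      by (rule AE_distrD[OF fq, unfolded dq, OF ae])
    then show "AE z in Q. (\<lambda>n. (g (\<delta> n) z)\<^sup>2) \<longlonglongrightarrow> (g \<gamma>' z)\<^sup>2"
      by eventually_elim (use c\<psi> in \<open>auto simp: g_def split_beta intro!: tendsto_power\<close>)
    show "AE z in Q. norm ((g (\<delta> n) z)\<^sup>2) \<le> 1" for n
      using gb2[OF \<delta>] by (intro AE_I2) auto
    show "(\<lambda>z. (g \<gamma>' z)\<^sup>2) \<in> borel_measurable Q" using m[OF \<gamma>'] by measurable
    show "(\<lambda>z. (g (\<delta> n) z)\<^sup>2) \<in> borel_measurable Q" for n using m[OF \<delta>[of n]] by measurable
  qed simp
  have "regularizer N"
    unfolding regularizer_def using N0 N1 strict by (intro conjI allI impI ballI; simp add: convex cont)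
  then show ?thesis by blast
qed

end

section \<open>Zero-sum games with private observations\<close>

lemma continuous_integral:
  fixes h :: "'a::metric_space \<Rightarrow> 'v \<Rightarrow> real"
  assumes P: "P \<in> space (prob_algebra N)" and m: "\<And>u. u \<in> U \<Longrightarrow> h u \<in> borel_measurable N"
    and bd: "\<And>u v. u \<in> U \<Longrightarrow> v \<in> space N \<Longrightarrow> \<bar>h u v\<bar> \<le> B"
    and cont: "\<And>v. v \<in> space N \<Longrightarrow> continuous_on U (\<lambda>u. h u v)"
  shows "continuous_on U (\<lambda>u. \<integral>v. h u v \<partial>P)"
  unfolding continuous_on_sequentially o_def
proof (intro allI ballI impI, elim conjE)
  fix x a assume a: "a \<in> U" and x: "\<forall>n. x n \<in> U" "x \<longlonglongrightarrow> a"
  interpret P: prob_space P using P by (simp add: space_prob_algebra)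
  have sp: "space P = space N" using P sets_eq_imp_space_eq[of P N] by (simp add: space_prob_algebra)
  show "(\<lambda>n. \<integral>v. h (x n) v \<partial>P) \<longlonglongrightarrow> (\<integral>v. h a v \<partial>P)"
  proof (rule integral_dominated_convergence[where w="\<lambda>_. B"])
    show "AE v in P. (\<lambda>n. h (x n) v) \<longlonglongrightarrow> h a v"
      using cont a x sp unfolding continuous_on_sequentially o_def by (intro AE_I2) auto
    show "h a \<in> borel_measurable P" "\<And>n. h (x n) \<in> borel_measurable P"
      using m a x by (auto intro: borel_measurable_on_prob_algebra[OF P])
    show "\<And>n. AE v in P. norm (h (x n) v) \<le> B"
      using bd x sp by (intro AE_I2) auto
  qed simp
qed

text \<open>Of the sample point w each player sees one function. Continuity is asked for in each
  action separately, matching its use: one player's policy varies while the other's is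
  fixed.\<close>

locale bayesian_game = prob_space M
  for M :: "'w measure" and S1 :: "'s1 measure" and S2 :: "'s2 measure"
    and f1 :: "'w \<Rightarrow> 's1" and f2 :: "'w \<Rightarrow> 's2"
    and U1 :: "'u1::polish_space set" and U2 :: "'u2::polish_space set"
    and c :: "'w \<Rightarrow> 'u1 \<Rightarrow> 'u2 \<Rightarrow> real" and b :: real +
  assumes f1: "f1 \<in> M \<rightarrow>\<^sub>M S1" and f2: "f2 \<in> M \<rightarrow>\<^sub>M S2"
    and U1: "compact U1" "U1 \<noteq> {}" and U2: "compact U2" "U2 \<noteq> {}"
    and c_meas: "(\<lambda>(w, u, v). c w u v) \<in> borel_measurable (M \<Otimes>\<^sub>M borel_on U1 \<Otimes>\<^sub>M borel_on U2)"
    and c_bd: "\<And>w u v. w \<in> space M \<Longrightarrow> u \<in> U1 \<Longrightarrow> v \<in> U2 \<Longrightarrow> \<bar>c w u v\<bar> \<le> b"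
    and c_cont1: "\<And>w v. w \<in> space M \<Longrightarrow> v \<in> U2 \<Longrightarrow> continuous_on U1 (\<lambda>u. c w u v)"
    and c_cont2: "\<And>w u. w \<in> space M \<Longrightarrow> u \<in> U1 \<Longrightarrow> continuous_on U2 (c w u)"
begin

sublocale P1: observed_decision M S1 f1 U1
  by unfold_locales (use f1 U1 in auto)

sublocale P2: observed_decision M S2 f2 U2
  by unfold_locales (use f2 U2 in auto)

definition cost :: "('s1 \<Rightarrow> 'u1 measure) \<Rightarrow> ('s2 \<Rightarrow> 'u2 measure) \<Rightarrow> real" where
  "cost \<gamma>1 \<gamma>2 = (\<integral>w. (\<integral>u. (\<integral>v. c w u v \<partial>\<gamma>2 (f2 w)) \<partial>\<gamma>1 (f1 w)) \<partial>M)"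

text \<open>Integrating out the opponent leaves a single player's decision problem whose payoff
  still depends on w through the opponent's observation; hence decision problems have payoffs on all
  of w, not only on what the player sees.\<close>

definition response1 :: "('s2 \<Rightarrow> 'u2 measure) \<Rightarrow> 'w \<Rightarrow> 'u1 \<Rightarrow> real" where
  "response1 \<gamma>2 w u = (\<integral>v. c w u v \<partial>\<gamma>2 (f2 w))"

definition response2 :: "('s1 \<Rightarrow> 'u1 measure) \<Rightarrow> 'w \<Rightarrow> 'u2 \<Rightarrow> real" where
  "response2 \<gamma>1 w v = (\<integral>u. c w u v \<partial>\<gamma>1 (f1 w))"

lemma space_U [simp]: "space (borel_on U1) = U1" "space (borel_on U2) = U2"
  by (simp_all add: space_restrict_space)

lemma carath_response1:
  assumes \<gamma>: "\<gamma>2 \<in> P2.policies"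
  shows "carath_bounded M U1 (response1 \<gamma>2) b"
  unfolding carath_bounded_def
proof (intro conjI ballI)
  have "(\<lambda>z. \<integral>v. c (fst z) (snd z) v \<partial>\<gamma>2 (f2 (fst z))) \<in> borel_measurable (M \<Otimes>\<^sub>M borel_on U1)"
  proof (rule measurable_integral_kernel2)
    show "(\<lambda>z. \<gamma>2 (f2 (fst z))) \<in> M \<Otimes>\<^sub>M borel_on U1 \<rightarrow>\<^sub>M prob_algebra (borel_on U2)"
      by (rule measurable_compose[OF measurable_fst P2.policy_comp[OF \<gamma>]])
    have "(\<lambda>z. (fst (fst z), snd (fst z), snd z)) \<in> (M \<Otimes>\<^sub>M borel_on U1) \<Otimes>\<^sub>M borel_on U2 \<rightarrow>\<^sub>M M \<Otimes>\<^sub>M borel_on U1 \<Otimes>\<^sub>M borel_on U2"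
      by measurable
    from measurable_compose[OF this c_meas]
    show "(\<lambda>(z, v). c (fst z) (snd z) v) \<in> borel_measurable ((M \<Otimes>\<^sub>M borel_on U1) \<Otimes>\<^sub>M borel_on U2)"
      by (simp add: split_beta)
  qed
  then show "(\<lambda>(w, u). response1 \<gamma>2 w u) \<in> borel_measurable (M \<Otimes>\<^sub>M borel_on U1)"
    by (simp add: response1_def split_beta)
  fix w assume w: "w \<in> space M"
  have m: "c w u \<in> borel_measurable (borel_on U2)" if "u \<in> U1" for u
    using c_cont2[OF w that] by (rule borel_measurable_continuous_on_restrict)
  show "\<bar>response1 \<gamma>2 w u\<bar> \<le> b" if "u \<in> U1" for u
    unfolding response1_def
    by (rule integral_prob_bound(2)[OF P2.policy_space[OF \<gamma> w] m[OF that]]) (use c_bd[OF w that] in simp)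
  show "continuous_on U1 (response1 \<gamma>2 w)"
    unfolding response1_def[abs_def]
    by (rule continuous_integral[OF P2.policy_space[OF \<gamma> w] m, where B=b]) (use c_bd[OF w] c_cont1[OF w] in auto)
qed

lemma carath_response2:
  assumes \<gamma>: "\<gamma>1 \<in> P1.policies"
  shows "carath_bounded M U2 (response2 \<gamma>1) b"
  unfolding carath_bounded_def
proof (intro conjI ballI)
  have "(\<lambda>z. \<integral>u. c (fst z) u (snd z) \<partial>\<gamma>1 (f1 (fst z))) \<in> borel_measurable (M \<Otimes>\<^sub>M borel_on U2)"
  proof (rule measurable_integral_kernel2)
    show "(\<lambda>z. \<gamma>1 (f1 (fst z))) \<in> M \<Otimes>\<^sub>M borel_on U2 \<rightarrow>\<^sub>M prob_algebra (borel_on U1)"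
      by (rule measurable_compose[OF measurable_fst P1.policy_comp[OF \<gamma>]])
    have "(\<lambda>z. (fst (fst z), snd z, snd (fst z))) \<in> (M \<Otimes>\<^sub>M borel_on U2) \<Otimes>\<^sub>M borel_on U1 \<rightarrow>\<^sub>M M \<Otimes>\<^sub>M borel_on U1 \<Otimes>\<^sub>M borel_on U2"
      by measurable
    from measurable_compose[OF this c_meas]
    show "(\<lambda>(z, u). c (fst z) u (snd z)) \<in> borel_measurable ((M \<Otimes>\<^sub>M borel_on U2) \<Otimes>\<^sub>M borel_on U1)"
      by (simp add: split_beta)
  qed
  then show "(\<lambda>(w, v). response2 \<gamma>1 w v) \<in> borel_measurable (M \<Otimes>\<^sub>M borel_on U2)"
    by (simp add: response2_def split_beta)
  fix w assume w: "w \<in> space M"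
  have m: "(\<lambda>u. c w u v) \<in> borel_measurable (borel_on U1)" if "v \<in> U2" for v
    using c_cont1[OF w that] by (rule borel_measurable_continuous_on_restrict)
  show "\<bar>response2 \<gamma>1 w v\<bar> \<le> b" if "v \<in> U2" for v
    unfolding response2_def
    by (rule integral_prob_bound(2)[OF P1.policy_space[OF \<gamma> w] m[OF that]]) (use c_bd[OF w _ that] in simp)
  show "continuous_on U2 (response2 \<gamma>1 w)"
    unfolding response2_def[abs_def]
    by (rule continuous_integral[OF P1.policy_space[OF \<gamma> w] m, where B=b]) (use c_bd[OF w] c_cont2[OF w] in auto)
qed

lemma cost_payoff1: "cost \<gamma>1 \<gamma>2 = P1.payoff (response1 \<gamma>2) \<gamma>1"
  by (simp add: cost_def P1.payoff_def response1_def)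

text \<open>The decision problems of the two players describe the same cost once the inner integrals
  are exchanged, which Fubini's theorem allows for a bounded cost.\<close>

lemma cost_payoff2:
  assumes \<gamma>1: "\<gamma>1 \<in> P1.policies" and \<gamma>2: "\<gamma>2 \<in> P2.policies"
  shows "cost \<gamma>1 \<gamma>2 = P2.payoff (response2 \<gamma>1) \<gamma>2"
  unfolding cost_def P2.payoff_def response2_def
proof (rule Bochner_Integration.integral_cong)
  fix w assume w: "w \<in> space M"
  note P = P1.policy_space[OF \<gamma>1 w] P2.policy_space[OF \<gamma>2 w]
  note D1 = prob_algebra_borel_onD[OF P(1)] and D2 = prob_algebra_borel_onD[OF P(2)]
  interpret A: prob_space "\<gamma>1 (f1 w)" by (rule D1)
  interpret B: prob_space "\<gamma>2 (f2 w)" by (rule D2)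
  interpret pair_prob_space "\<gamma>1 (f1 w)" "\<gamma>2 (f2 w)" ..
  have "(\<lambda>(u, v). c w u v) \<in> borel_measurable (borel_on U1 \<Otimes>\<^sub>M borel_on U2)"
    using measurable_Pair2[OF c_meas w] by simp
  then have "(\<lambda>(u, v). c w u v) \<in> borel_measurable (\<gamma>1 (f1 w) \<Otimes>\<^sub>M \<gamma>2 (f2 w))"
    using D1(2) D2(2) by (simp cong: measurable_cong_sets sets_pair_measure_cong)
  then have "integrable (\<gamma>1 (f1 w) \<Otimes>\<^sub>M \<gamma>2 (f2 w)) (\<lambda>(u, v). c w u v)"
    using c_bd[OF w] D1(3) D2(3)
    by (intro integrable_const_bound[where B=b]) (auto simp: space_pair_measure intro!: AE_I2)
  from Fubini_integral[OF this]
  show "(\<integral>u. (\<integral>v. c w u v \<partial>\<gamma>2 (f2 w)) \<partial>\<gamma>1 (f1 w)) = (\<integral>v. (\<integral>u. c w u v \<partial>\<gamma>1 (f1 w)) \<partial>\<gamma>2 (f2 w))"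
    by simp
qed simp

lemma cost_bound:
  "\<gamma>1 \<in> P1.policies \<Longrightarrow> \<gamma>2 \<in> P2.policies \<Longrightarrow> \<bar>cost \<gamma>1 \<gamma>2\<bar> \<le> b"
  unfolding cost_payoff1 by (rule P1.payoff_bound[OF carath_response1])

text \<open>Player 1 carries the regularizer. A bound on cost plus regularizer passes to forward
  averages, since the cost is affine under mixtures and the regularizer obeys Jensen's inequality,
  and on to the limit by continuity of both. For player 2 the cost alone is followed.\<close>

theorem saddle_policies_exist:
  "\<exists>\<gamma>1\<in>P1.policies. \<exists>\<gamma>2\<in>P2.policies. \<forall>\<gamma>1'\<in>P1.policies. \<forall>\<gamma>2'\<in>P2.policies.
     cost \<gamma>1 \<gamma>2' \<le> cost \<gamma>1 \<gamma>2 \<and> cost \<gamma>1 \<gamma>2 \<le> cost \<gamma>1' \<gamma>2"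
proof -
  obtain N where "P1.regularizer N" using P1.regularizer_exists by blast
  note N = P1.regularizerD(1,2)[OF this] and strict = P1.regularizerD(3)[OF this]
    and convex = P1.regularizerD(4)[OF this] and cont = P1.regularizerD(5)[OF this]
  show ?thesis
  proof (rule saddle_point_exists[where V=cost and N=N and C=b])
    show "P1.policies \<noteq> {}" "P2.policies \<noteq> {}" by (rule P1.policies_nonempty P2.policies_nonempty)+
    show "\<bar>cost a b'\<bar> \<le> b" if "a \<in> P1.policies" "b' \<in> P2.policies" for a b'
      by (rule cost_bound[OF that])
    show "0 \<le> N a" "N a \<le> 1" if "a \<in> P1.policies" for a using N[OF that] .
  next
    fix x y t assume xy: "x \<in> P2.policies" "y \<in> P2.policies" and t: "0 \<le> (t::real)" "t \<le> 1"
    have "cost a (pair_mixture t x y) = (1 - t) * cost a x + t * cost a y" if a: "a \<in> P1.policies" for a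
      using P2.payoff_pair_mixture[OF carath_response2[OF a] xy t] a xy P2.pair_mixture_policy[OF xy]
      by (simp add: cost_payoff2)
    then show "\<exists>z\<in>P2.policies. \<forall>a\<in>P1.policies. cost a z = (1 - t) * cost a x + t * cost a y"
      using P2.pair_mixture_policy[OF xy] by blast
  next
    fix x y assume xy: "x \<in> P1.policies" "y \<in> P1.policies"
    have "cost (pair_mixture (1/2) x y) z = (cost x z + cost y z) / 2" if "z \<in> P2.policies" for z
      unfolding cost_payoff1 using P1.payoff_pair_mixture[OF carath_response1[OF that] xy, of "1/2"]
      by simp
    moreover have "N x = N y \<and> (\<forall>z\<in>P2.policies. cost x z = cost y z)"
      if "N x + N y \<le> 2 * N (pair_mixture (1/2) x y)"
      using strict[OF xy that] carath_response1 unfolding cost_payoff1 by blast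
    ultimately show "\<exists>z\<in>P1.policies. (\<forall>z'\<in>P2.policies. cost z z' = (cost x z' + cost y z') / 2) \<and>
        (N x + N y \<le> 2 * N z \<longrightarrow> N x = N y \<and> (\<forall>z'\<in>P2.policies. cost x z' = cost y z'))"
      using P1.pair_mixture_policy[OF xy] by blast
  next
    fix x :: "nat \<Rightarrow> _" assume x: "\<And>n. x n \<in> P1.policies"
    obtain p x' where p: "\<And>n. set_pmf (p n) \<subseteq> {n..}" and x': "x' \<in> P1.policies"
      and ae: "AE w in M. \<forall>a :: 'u1 \<Rightarrow> real. continuous_on U1 a \<longrightarrow>
        (\<lambda>n. \<integral>u. a u \<partial>kernel_mixture (p n) x (f1 w)) \<longlonglongrightarrow> (\<integral>u. a u \<partial>x' (f1 w))"
      and lim: "\<And>h b. carath_bounded M U1 h b \<Longrightarrow>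
        (\<lambda>n. P1.payoff h (kernel_mixture (p n) x)) \<longlonglongrightarrow> P1.payoff h x'"
      by (rule P1.policies_compact[of x, OF x]) blast
    note mix = P1.kernel_mixture_policy[of x, OF x]
    have Nlim: "(\<lambda>n. N (kernel_mixture (p n) x)) \<longlonglongrightarrow> N x'" by (rule cont[OF mix x' ae])
    show "\<exists>x'\<in>P1.policies. \<forall>y\<in>P2.policies. \<forall>d\<ge>0. \<forall>r.
      (\<forall>\<^sub>F n in sequentially. cost (x n) y + d * N (x n) \<le> r) \<longrightarrow> cost x' y + d * N x' \<le> r"
    proof (intro bexI[of _ x'] ballI allI impI x')
      fix y and d r :: real
      assume y: "y \<in> P2.policies" and d: "0 \<le> d"
        and ev: "\<forall>\<^sub>F n in sequentially. cost (x n) y + d * N (x n) \<le> r"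
      note h = carath_response1[OF y]
      have Nb: "\<bar>N (x n)\<bar> \<le> 1" for n using N[OF x[of n]] by simp
      have cb: "\<bar>cost (x n) y\<bar> \<le> b" for n by (rule cost_bound[OF x y])
      have "\<forall>\<^sub>F n in sequentially. pmf_mean (p n) (\<lambda>m. cost (x m) y + d * N (x m)) \<le> r"
      proof (rule tail_average_le[OF p _ ev])
        fix n
        have "\<bar>d * N (x n)\<bar> \<le> d" using Nb[of n] d by (simp add: abs_mult mult_left_le)
        then show "\<bar>cost (x n) y + d * N (x n)\<bar> \<le> b + d" using cb[of n] by linarith
      qed
      moreover have "cost (kernel_mixture (p n) x) y + d * N (kernel_mixture (p n) x)
          \<le> pmf_mean (p n) (\<lambda>m. cost (x m) y + d * N (x m))" for n
      proof -
        have "cost (kernel_mixture (p n) x) y = pmf_mean (p n) (\<lambda>m. cost (x m) y)"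
          unfolding cost_payoff1 by (rule P1.payoff_kernel_mixture[OF h x])
        moreover have "d * N (kernel_mixture (p n) x) \<le> d * pmf_mean (p n) (\<lambda>m. N (x m))"
          by (intro mult_left_mono convex x d)
        moreover have "pmf_mean (p n) (\<lambda>m. cost (x m) y + d * N (x m))
            = pmf_mean (p n) (\<lambda>m. cost (x m) y) + d * pmf_mean (p n) (\<lambda>m. N (x m))"
          using pmf_expectation_bounded(1)[of _ "\<lambda>m. cost (x m) y", OF cb]
            pmf_expectation_bounded(1)[of _ "\<lambda>m. N (x m)", OF Nb] by simp
        ultimately show ?thesis by linarith
      qed
      ultimately have "\<forall>\<^sub>F n in sequentially. cost (kernel_mixture (p n) x) y + d * N (kernel_mixture (p n) x) \<le> r"
        by (auto elim!: eventually_mono intro: order_trans)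
      moreover have "(\<lambda>n. cost (kernel_mixture (p n) x) y + d * N (kernel_mixture (p n) x)) \<longlonglongrightarrow> cost x' y + d * N x'"
        using lim[OF h] Nlim unfolding cost_payoff1 by (intro tendsto_intros)
      ultimately show "cost x' y + d * N x' \<le> r"
        by (rule tendsto_upperbound[OF _ _ sequentially_bot, rotated])
    qed
  next
    fix y :: "nat \<Rightarrow> _" assume y: "\<And>n. y n \<in> P2.policies"
    obtain p y' where p: "\<And>n. set_pmf (p n) \<subseteq> {n..}" and y': "y' \<in> P2.policies"
      and lim: "\<And>h b. carath_bounded M U2 h b \<Longrightarrow>
        (\<lambda>n. P2.payoff h (kernel_mixture (p n) y)) \<longlonglongrightarrow> P2.payoff h y'"
      by (rule P2.policies_compact[of y, OF y]) blast
    show "\<exists>y'\<in>P2.policies. \<forall>x\<in>P1.policies. \<forall>r.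
      (\<forall>\<^sub>F n in sequentially. r \<le> cost x (y n)) \<longrightarrow> r \<le> cost x y'"
    proof (intro bexI[of _ y'] ballI allI impI y')
      fix x and r :: real
      assume x: "x \<in> P1.policies" and ev: "\<forall>\<^sub>F n in sequentially. r \<le> cost x (y n)"
      note h = carath_response2[OF x]
      \<comment> \<open>The sign is changed because averages were shown to preserve upper bounds,
        whereas the maximizer has to preserve lower ones.\<close>
      have "\<forall>\<^sub>F n in sequentially. pmf_mean (p n) (\<lambda>m. - cost x (y m)) \<le> - r"
        by (rule tail_average_le[OF p, where B=b]) (use ev cost_bound[OF x y] in \<open>auto elim: eventually_mono\<close>)
      then have "\<forall>\<^sub>F n in sequentially. r \<le> P2.payoff (response2 x) (kernel_mixture (p n) y)"
        by (simp add: P2.payoff_kernel_mixture[OF h y] cost_payoff2[OF x y])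
      then have "r \<le> P2.payoff (response2 x) y'"
        using tendsto_lowerbound[OF lim[OF h]] by simp
      then show "r \<le> cost x y'" by (simp add: cost_payoff2[OF x y'])
    qed
  qed
qed

end

section \<open>Information structures and garbling\<close>

lemma measurable_ident_subset:
  assumes "(\<lambda>z. z) \<in> M \<rightarrow>\<^sub>M N" and "space M = space N"
  shows "sets N \<subseteq> sets M"
proof
  fix S assume S: "S \<in> sets N"
  have "(\<lambda>z. z) -` S \<inter> space M = S" using sets.sets_into_space[OF S] assms(2) by auto
  with measurable_sets[OF assms(1) S] show "S \<in> sets M" by simp
qed

text \<open>The identity is measurable in both directions: one way because in second countable
  spaces the Borel sets of the product are the product algebra, the other way through the continuous
  projections.\<close>

lemma sets_borel_on_prod:
  fixes A :: "'a::second_countable_topology set" and B :: "'b::second_countable_topology set"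
  shows "sets (borel_on A \<Otimes>\<^sub>M borel_on B) = sets (borel_on (A \<times> B))"
proof
  have sp: "space (borel_on A \<Otimes>\<^sub>M borel_on B) = A \<times> B" "space (borel_on (A \<times> B)) = A \<times> B"
    by (simp_all add: space_pair_measure space_restrict_space)
  have "fst \<in> borel_on A \<Otimes>\<^sub>M borel_on B \<rightarrow>\<^sub>M borel" "snd \<in> borel_on A \<Otimes>\<^sub>M borel_on B \<rightarrow>\<^sub>M borel"
    by (auto intro!: measurable_compose[OF measurable_fst] measurable_compose[OF measurable_snd] measurable_restrict_space1)
  from measurable_Pair[OF this] have "(\<lambda>z. z) \<in> borel_on A \<Otimes>\<^sub>M borel_on B \<rightarrow>\<^sub>M borel"
    by (simp add: borel_prod)
  then have "(\<lambda>z. z) \<in> borel_on A \<Otimes>\<^sub>M borel_on B \<rightarrow>\<^sub>M borel_on (A \<times> B)"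
    by (intro measurable_restrict_space2) (auto simp: sp)
  then show "sets (borel_on (A \<times> B)) \<subseteq> sets (borel_on A \<Otimes>\<^sub>M borel_on B)"
    by (rule measurable_ident_subset) (simp only: sp)
  have "fst \<in> borel_on (A \<times> B) \<rightarrow>\<^sub>M borel_on A"
    by (intro measurable_restrict_space2 measurable_restrict_space1 borel_measurable_continuous_onI
        continuous_on_fst continuous_on_id) (auto simp: sp)
  moreover have "snd \<in> borel_on (A \<times> B) \<rightarrow>\<^sub>M borel_on B"
    by (intro measurable_restrict_space2 measurable_restrict_space1 borel_measurable_continuous_onI
        continuous_on_snd continuous_on_id) (auto simp: sp)
  ultimately have "(\<lambda>z. (fst z, snd z)) \<in> borel_on (A \<times> B) \<rightarrow>\<^sub>M borel_on A \<Otimes>\<^sub>M borel_on B"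
    by (rule measurable_Pair)
  then have "(\<lambda>z. z) \<in> borel_on (A \<times> B) \<rightarrow>\<^sub>M borel_on A \<Otimes>\<^sub>M borel_on B"
    by simp
  then show "sets (borel_on A \<Otimes>\<^sub>M borel_on B) \<subseteq> sets (borel_on (A \<times> B))"
    by (rule measurable_ident_subset) (simp only: sp)
qed

abbreviation outcomes :: "'x::topological_space set \<Rightarrow> 'y1::topological_space set \<Rightarrow> 'y2::topological_space set
    \<Rightarrow> ('x \<times> 'y1 \<times> 'y2) measure" where
  "outcomes X Y1 Y2 \<equiv> borel_on X \<Otimes>\<^sub>M borel_on Y1 \<Otimes>\<^sub>M borel_on Y2"

lemma space_outcomes: "space (outcomes X Y1 Y2) = X \<times> Y1 \<times> Y2"
  by (simp add: space_pair_measure space_restrict_space)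

lemma prob_outcomesD:
  assumes "\<mu> \<in> space (prob_algebra (outcomes X Y1 Y2))"
  shows "prob_space \<mu>" and "sets \<mu> = sets (outcomes X Y1 Y2)" and "space \<mu> = X \<times> Y1 \<times> Y2"
  using assms sets_eq_imp_space_eq[of \<mu> "outcomes X Y1 Y2"] by (auto simp: space_prob_algebra space_outcomes)

lemma observation_measurable:
  assumes "\<mu> \<in> space (prob_algebra (outcomes X Y1 Y2))"
  shows "fst \<in> \<mu> \<rightarrow>\<^sub>M borel_on X" and "(\<lambda>w. fst (snd w)) \<in> \<mu> \<rightarrow>\<^sub>M borel_on Y1"
    and "(\<lambda>w. snd (snd w)) \<in> \<mu> \<rightarrow>\<^sub>M borel_on Y2"
  using prob_outcomesD(2)[OF assms] by (simp_all cong: measurable_cong_sets)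

text \<open>The sample point is the whole triple and the observations are its coordinates; joint
  continuity in the actions restricts to continuity in each.\<close>

lemma game_is_bayesian_game:
  assumes \<mu>: "\<mu> \<in> space (prob_algebra (outcomes X Y1 Y2))"
    and G: "(c, U1, U2) \<in> compact_continuous_games X"
  obtains b where "bayesian_game \<mu> (borel_on Y1) (borel_on Y2) (\<lambda>w. fst (snd w)) (\<lambda>w. snd (snd w)) U1 U2
    (\<lambda>w u v. c (fst w, u, v)) b"
proof -
  note \<mu>D = prob_outcomesD[OF \<mu>]
  interpret prob_space \<mu> by (rule \<mu>D)
  from G have cm: "c \<in> borel_measurable (borel_on X \<Otimes>\<^sub>M borel_on U1 \<Otimes>\<^sub>M borel_on U2)"
    and U: "compact U1" "U1 \<noteq> {}" "compact U2" "U2 \<noteq> {}"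
    and cont: "\<And>x. x \<in> X \<Longrightarrow> continuous_on (U1 \<times> U2) (\<lambda>(u1, u2). c (x, u1, u2))"
    by (auto simp: compact_continuous_games_def)
  from G obtain b where b: "\<And>x u1 u2. x \<in> X \<Longrightarrow> u1 \<in> U1 \<Longrightarrow> u2 \<in> U2 \<Longrightarrow> \<bar>c (x, u1, u2)\<bar> \<le> b"
    unfolding compact_continuous_games_def mem_Collect_eq prod.case by blast
  have "bayesian_game \<mu> (borel_on Y1) (borel_on Y2) (\<lambda>w. fst (snd w)) (\<lambda>w. snd (snd w)) U1 U2
    (\<lambda>w u v. c (fst w, u, v)) b"
  proof unfold_locales
    have "(\<lambda>z. (fst (fst z), snd z)) \<in> \<mu> \<Otimes>\<^sub>M borel_on U1 \<Otimes>\<^sub>M borel_on U2 \<rightarrow>\<^sub>M borel_on X \<Otimes>\<^sub>M borel_on U1 \<Otimes>\<^sub>M borel_on U2"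
      by (intro measurable_Pair measurable_compose[OF measurable_fst observation_measurable(1)[OF \<mu>]] measurable_snd)
    from measurable_compose[OF this cm]
    show "(\<lambda>(w, u, v). c (fst w, u, v)) \<in> borel_measurable (\<mu> \<Otimes>\<^sub>M borel_on U1 \<Otimes>\<^sub>M borel_on U2)"
      by (simp add: split_beta')
  next
    fix w v assume w: "w \<in> space \<mu>" and v: "v \<in> U2"
    then have x: "fst w \<in> X" by (auto simp: \<mu>D(3))
    have "continuous_on U1 (\<lambda>u. (\<lambda>(u1, u2). c (fst w, u1, u2)) (u, v))"
      by (rule continuous_on_compose2[OF cont[OF x]]) (use v in \<open>auto intro!: continuous_intros\<close>)
    then show "continuous_on U1 (\<lambda>u. c (fst w, u, v))" by simp
  next
    fix w u assume w: "w \<in> space \<mu>" and u: "u \<in> U1"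
    then have x: "fst w \<in> X" by (auto simp: \<mu>D(3))
    have "continuous_on U2 (\<lambda>v. (\<lambda>(u1, u2). c (fst w, u1, u2)) (u, v))"
      by (rule continuous_on_compose2[OF cont[OF x]]) (use u in \<open>auto intro!: continuous_intros\<close>)
    then show "continuous_on U2 (\<lambda>v. c (fst w, u, v))" by simp
  qed (use observation_measurable[OF \<mu>] U b \<mu>D(3) in auto)
  then show thesis by (rule that)
qed

text \<open>Boundedness of the cost makes the real infimum and supremum genuine, so equilibria are
  exactly saddle points. Their existence and interchangeability make \<open>game_value\<close> a
  proper description, and what remains is that optimal policies guarantee it.\<close>

lemma game_value_saddle:
  assumes \<mu>: "\<mu> \<in> space (prob_algebra (outcomes X Y1 Y2))"
    and G: "(c, U1, U2) \<in> compact_continuous_games X"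
  obtains \<gamma>1 \<gamma>2 where "\<gamma>1 \<in> kernels Y1 U1" and "\<gamma>2 \<in> kernels Y2 U2"
    and "\<And>\<gamma>. \<gamma> \<in> kernels Y1 U1 \<Longrightarrow> game_value Y1 Y2 (c, U1, U2) \<mu> \<le> expected_cost (c, U1, U2) \<mu> \<gamma> \<gamma>2"
    and "\<And>\<gamma>. \<gamma> \<in> kernels Y2 U2 \<Longrightarrow> expected_cost (c, U1, U2) \<mu> \<gamma>1 \<gamma> \<le> game_value Y1 Y2 (c, U1, U2) \<mu>"
proof -
  obtain b where "bayesian_game \<mu> (borel_on Y1) (borel_on Y2) (\<lambda>w. fst (snd w)) (\<lambda>w. snd (snd w)) U1 U2
    (\<lambda>w u v. c (fst w, u, v)) b"
    by (rule game_is_bayesian_game[OF \<mu> G])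
  then interpret g: bayesian_game \<mu> "borel_on Y1" "borel_on Y2" "\<lambda>w. fst (snd w)" "\<lambda>w. snd (snd w)" U1 U2
    "\<lambda>w u v. c (fst w, u, v)" b .
  let ?G = "(c, U1, U2)"
  have K: "g.P1.policies = kernels Y1 U1" "g.P2.policies = kernels Y2 U2"
    by (simp_all add: g.P1.policies_def g.P2.policies_def kernels_def)
  have cost: "expected_cost ?G \<mu> = g.cost"
    by (intro ext) (simp add: expected_cost_def g.cost_def split_beta')
  have bd: "\<bar>expected_cost ?G \<mu> a a'\<bar> \<le> b" if "a \<in> kernels Y1 U1" "a' \<in> kernels Y2 U2" for a a'
    using g.cost_bound that by (simp add: cost K)
  define saddle where "saddle a a' \<longleftrightarrow> a \<in> kernels Y1 U1 \<and> a' \<in> kernels Y2 U2 \<and>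
    (\<forall>\<gamma>\<in>kernels Y1 U1. expected_cost ?G \<mu> a a' \<le> expected_cost ?G \<mu> \<gamma> a') \<and>
    (\<forall>\<gamma>\<in>kernels Y2 U2. expected_cost ?G \<mu> a \<gamma> \<le> expected_cost ?G \<mu> a a')" for a a'
  have eq: "equilibrium Y1 Y2 ?G \<mu> a a' \<longleftrightarrow> saddle a a'" for a a'
  proof
    assume e: "equilibrium Y1 Y2 ?G \<mu> a a'"
    then have a: "a \<in> kernels Y1 U1" "a' \<in> kernels Y2 U2"
      and inf: "(INF \<gamma>\<in>kernels Y1 U1. expected_cost ?G \<mu> \<gamma> a') = expected_cost ?G \<mu> a a'"
      and sup: "(SUP \<gamma>\<in>kernels Y2 U2. expected_cost ?G \<mu> a \<gamma>) = expected_cost ?G \<mu> a a'"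
      by (auto simp: equilibrium_def)
    have "bdd_below ((\<lambda>\<gamma>. expected_cost ?G \<mu> \<gamma> a') ` kernels Y1 U1)"
      using bd[OF _ a(2)] by (intro bdd_belowI2[of _ "- b"]) (simp add: abs_le_iff minus_le_iff)
    moreover have "bdd_above ((\<lambda>\<gamma>. expected_cost ?G \<mu> a \<gamma>) ` kernels Y2 U2)"
      using bd[OF a(1)] by (intro bdd_aboveI2[of _ _ b]) (simp add: abs_le_iff)
    ultimately show "saddle a a'"
      unfolding saddle_def inf[symmetric] using a by (auto intro: cINF_lower) (auto simp: inf sup[symmetric] intro: cSUP_upper)
  next
    assume s: "saddle a a'"
    have "(INF \<gamma>\<in>kernels Y1 U1. expected_cost ?G \<mu> \<gamma> a') = expected_cost ?G \<mu> a a'"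
      using s unfolding saddle_def by (intro cInf_eq_minimum) auto
    moreover have "(SUP \<gamma>\<in>kernels Y2 U2. expected_cost ?G \<mu> a \<gamma>) = expected_cost ?G \<mu> a a'"
      using s unfolding saddle_def by (intro cSup_eq_maximum) auto
    ultimately show "equilibrium Y1 Y2 ?G \<mu> a a'"
      using s by (simp add: equilibrium_def saddle_def)
  qed
  obtain a a' where s: "saddle a a'"
    using g.saddle_policies_exist unfolding saddle_def K cost by blast
  have "game_value Y1 Y2 ?G \<mu> = expected_cost ?G \<mu> a a'"
    unfolding game_value_def eq
  proof (rule the_equality)
    show "\<exists>\<gamma>1 \<gamma>2. saddle \<gamma>1 \<gamma>2 \<and> expected_cost ?G \<mu> a a' = expected_cost ?G \<mu> \<gamma>1 \<gamma>2"
      using s by blast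
    fix v assume "\<exists>\<gamma>1 \<gamma>2. saddle \<gamma>1 \<gamma>2 \<and> v = expected_cost ?G \<mu> \<gamma>1 \<gamma>2"
    then obtain \<gamma>1 \<gamma>2 where "saddle \<gamma>1 \<gamma>2" and v: "v = expected_cost ?G \<mu> \<gamma>1 \<gamma>2" by blast
    \<comment> \<open>Crossing the two saddle points bounds each value by the other.\<close>
    with s show "v = expected_cost ?G \<mu> a a'"
      unfolding v saddle_def by (meson order_antisym order_trans)
  qed
  then show thesis using that[of a a'] s unfolding saddle_def by auto
qed

section \<open>Garbling as composition of policies with kernels\<close>

lemma garble1_kernel_measurable:
  assumes "\<kappa> \<in> kernels Y1 Y1"
  shows "(\<lambda>(x, y1, y2). distr (\<kappa> y1) (outcomes X Y1 Y2) (\<lambda>y. (x, y, y2)))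
    \<in> outcomes X Y1 Y2 \<rightarrow>\<^sub>M prob_algebra (outcomes X Y1 Y2)"
proof -
  have [measurable]: "\<kappa> \<in> borel_on Y1 \<rightarrow>\<^sub>M prob_algebra (borel_on Y1)" using assms by (simp add: kernels_def)
  show ?thesis by measurable
qed

lemma garble2_kernel_measurable:
  assumes "\<kappa> \<in> kernels Y2 Y2"
  shows "(\<lambda>(x, y1, y2). distr (\<kappa> y2) (outcomes X Y1 Y2) (\<lambda>y. (x, y1, y)))
    \<in> outcomes X Y1 Y2 \<rightarrow>\<^sub>M prob_algebra (outcomes X Y1 Y2)"
proof -
  have [measurable]: "\<kappa> \<in> borel_on Y2 \<rightarrow>\<^sub>M prob_algebra (borel_on Y2)" using assms by (simp add: kernels_def)
  show ?thesis by measurable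
qed

lemma integral_bind_distr:
  fixes F :: "'a \<Rightarrow> real"
  assumes \<mu>: "\<mu> \<in> space (prob_algebra P)" and D: "(\<lambda>w. distr (K w) P (e w)) \<in> P \<rightarrow>\<^sub>M prob_algebra P"
    and e: "\<And>w. w \<in> space P \<Longrightarrow> e w \<in> K w \<rightarrow>\<^sub>M P"
    and F: "F \<in> borel_measurable P" "\<And>z. z \<in> space P \<Longrightarrow> \<bar>F z\<bar> \<le> B"
  shows "(\<integral>z. F z \<partial>(\<mu> \<bind> (\<lambda>w. distr (K w) P (e w)))) = (\<integral>w. (\<integral>y. F (e w y) \<partial>K w) \<partial>\<mu>)"
    and "\<mu> \<bind> (\<lambda>w. distr (K w) P (e w)) \<in> space (prob_algebra P)"
proof -
  have \<mu>D: "prob_space \<mu>" "sets \<mu> = sets P" using \<mu> by (auto simp: space_prob_algebra)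
  then have sp: "space \<mu> = space P" by (intro sets_eq_imp_space_eq)
  have D': "prob_space (distr (K w) P (e w))" if "w \<in> space P" for w
    using measurable_space[OF D that] by (simp add: space_prob_algebra)
  have "(\<integral>z. F z \<partial>(\<mu> \<bind> (\<lambda>w. distr (K w) P (e w)))) = (\<integral>w. (\<integral>z. F z \<partial>distr (K w) P (e w)) \<partial>\<mu>)"
  proof (rule integral_bind[OF F, where B'=1])
    show "(\<lambda>w. distr (K w) P (e w)) \<in> \<mu> \<rightarrow>\<^sub>M subprob_algebra P"
      using measurable_prob_algebraD[OF D] \<mu>D(2) by (simp cong: measurable_cong_sets)
    show "AE w in \<mu>. emeasure (distr (K w) P (e w)) (space (distr (K w) P (e w))) \<le> ennreal 1"
      using prob_space.emeasure_space_1[OF D'] sp by (intro AE_I2) auto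
  qed (use \<mu>D(1) in \<open>auto simp: prob_space_def\<close>)
  also have "\<dots> = (\<integral>w. (\<integral>y. F (e w y) \<partial>K w) \<partial>\<mu>)"
    by (intro Bochner_Integration.integral_cong integral_distr e F refl) (simp add: sp)
  finally show "(\<integral>z. F z \<partial>(\<mu> \<bind> (\<lambda>w. distr (K w) P (e w)))) = (\<integral>w. (\<integral>y. F (e w y) \<partial>K w) \<partial>\<mu>)" .
  show "\<mu> \<bind> (\<lambda>w. distr (K w) P (e w)) \<in> space (prob_algebra P)"
    unfolding space_prob_algebra using prob_space_bind'[OF \<mu> D] sets_bind'[OF \<mu> D] by simp
qed

text \<open>Once the measure \<mu> that serves as target of \<open>distr\<close> is exchanged for
  the product space with the same algebra, integration against the garbled law is an iterated
  integral.\<close>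

lemma garble1_props:
  fixes F :: "'x::topological_space \<times> 'y1::topological_space \<times> 'y2::topological_space \<Rightarrow> real"
  assumes \<mu>: "\<mu> \<in> space (prob_algebra (outcomes X Y1 Y2))" and \<kappa>: "\<kappa> \<in> kernels Y1 Y1"
  shows "garble1 \<kappa> \<mu> \<in> space (prob_algebra (outcomes X Y1 Y2))"
    and "F \<in> borel_measurable (outcomes X Y1 Y2) \<Longrightarrow> (\<And>z. z \<in> X \<times> Y1 \<times> Y2 \<Longrightarrow> \<bar>F z\<bar> \<le> B) \<Longrightarrow>
      (\<integral>z. F z \<partial>garble1 \<kappa> \<mu>) = (\<integral>w. (\<integral>y. F (fst w, y, snd (snd w)) \<partial>\<kappa> (fst (snd w))) \<partial>\<mu>)"
proof -
  let ?P = "outcomes X Y1 Y2"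
  have D: "(\<lambda>w. distr (\<kappa> (fst (snd w))) ?P (\<lambda>y. (fst w, y, snd (snd w)))) \<in> ?P \<rightarrow>\<^sub>M prob_algebra ?P"
    using garble1_kernel_measurable[OF \<kappa>, of X Y2] by (simp add: split_beta')
  have eq: "garble1 \<kappa> \<mu> = \<mu> \<bind> (\<lambda>w. distr (\<kappa> (fst (snd w))) ?P (\<lambda>y. (fst w, y, snd (snd w))))"
    unfolding garble1_def using prob_outcomesD(2)[OF \<mu>] by (simp add: split_beta' cong: distr_cong)
  have e: "(\<lambda>y. (fst w, y, snd (snd w))) \<in> \<kappa> (fst (snd w)) \<rightarrow>\<^sub>M ?P" if w: "w \<in> space ?P" for w
  proof (rule borel_measurable_on_prob_algebra[where N="borel_on Y1"])
    have sp: "fst w \<in> space (borel_on X)" "fst (snd w) \<in> space (borel_on Y1)" "snd (snd w) \<in> space (borel_on Y2)"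
      using w by (auto simp: space_pair_measure)
    show "\<kappa> (fst (snd w)) \<in> space (prob_algebra (borel_on Y1))"
      using \<kappa> sp(2) unfolding kernels_def by (rule measurable_space)
    show "(\<lambda>y. (fst w, y, snd (snd w))) \<in> borel_on Y1 \<rightarrow>\<^sub>M ?P" using sp by measurable
  qed
  show "garble1 \<kappa> \<mu> \<in> space (prob_algebra (outcomes X Y1 Y2))"
    unfolding eq by (rule integral_bind_distr(2)[OF \<mu> D e, of "\<lambda>_. 0" 0]) auto
  show "(\<integral>z. F z \<partial>garble1 \<kappa> \<mu>) = (\<integral>w. (\<integral>y. F (fst w, y, snd (snd w)) \<partial>\<kappa> (fst (snd w))) \<partial>\<mu>)"
    if "F \<in> borel_measurable (outcomes X Y1 Y2)" "\<And>z. z \<in> X \<times> Y1 \<times> Y2 \<Longrightarrow> \<bar>F z\<bar> \<le> B"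
    unfolding eq by (rule integral_bind_distr(1)[OF \<mu> D e that]) (simp_all add: space_outcomes)
qed

lemma garble2_props:
  fixes F :: "'x::topological_space \<times> 'y1::topological_space \<times> 'y2::topological_space \<Rightarrow> real"
  assumes \<mu>: "\<mu> \<in> space (prob_algebra (outcomes X Y1 Y2))" and \<kappa>: "\<kappa> \<in> kernels Y2 Y2"
  shows "garble2 \<kappa> \<mu> \<in> space (prob_algebra (outcomes X Y1 Y2))"
    and "F \<in> borel_measurable (outcomes X Y1 Y2) \<Longrightarrow> (\<And>z. z \<in> X \<times> Y1 \<times> Y2 \<Longrightarrow> \<bar>F z\<bar> \<le> B) \<Longrightarrow>
      (\<integral>z. F z \<partial>garble2 \<kappa> \<mu>) = (\<integral>w. (\<integral>y. F (fst w, fst (snd w), y) \<partial>\<kappa> (snd (snd w))) \<partial>\<mu>)"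
proof -
  let ?P = "outcomes X Y1 Y2"
  have D: "(\<lambda>w. distr (\<kappa> (snd (snd w))) ?P (\<lambda>y. (fst w, fst (snd w), y))) \<in> ?P \<rightarrow>\<^sub>M prob_algebra ?P"
    using garble2_kernel_measurable[OF \<kappa>, of X Y1] by (simp add: split_beta')
  have eq: "garble2 \<kappa> \<mu> = \<mu> \<bind> (\<lambda>w. distr (\<kappa> (snd (snd w))) ?P (\<lambda>y. (fst w, fst (snd w), y)))"
    unfolding garble2_def using prob_outcomesD(2)[OF \<mu>] by (simp add: split_beta' cong: distr_cong)
  have e: "(\<lambda>y. (fst w, fst (snd w), y)) \<in> \<kappa> (snd (snd w)) \<rightarrow>\<^sub>M ?P" if w: "w \<in> space ?P" for w
  proof (rule borel_measurable_on_prob_algebra[where N="borel_on Y2"])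
    have sp: "fst w \<in> space (borel_on X)" "fst (snd w) \<in> space (borel_on Y1)" "snd (snd w) \<in> space (borel_on Y2)"
      using w by (auto simp: space_pair_measure)
    show "\<kappa> (snd (snd w)) \<in> space (prob_algebra (borel_on Y2))"
      using \<kappa> sp(3) unfolding kernels_def by (rule measurable_space)
    show "(\<lambda>y. (fst w, fst (snd w), y)) \<in> borel_on Y2 \<rightarrow>\<^sub>M ?P" using sp by measurable
  qed
  show "garble2 \<kappa> \<mu> \<in> space (prob_algebra (outcomes X Y1 Y2))"
    unfolding eq by (rule integral_bind_distr(2)[OF \<mu> D e, of "\<lambda>_. 0" 0]) auto
  show "(\<integral>z. F z \<partial>garble2 \<kappa> \<mu>) = (\<integral>w. (\<integral>y. F (fst w, fst (snd w), y) \<partial>\<kappa> (snd (snd w))) \<partial>\<mu>)"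
    if "F \<in> borel_measurable (outcomes X Y1 Y2)" "\<And>z. z \<in> X \<times> Y1 \<times> Y2 \<Longrightarrow> \<bar>F z\<bar> \<le> B"
    unfolding eq by (rule integral_bind_distr(1)[OF \<mu> D e that]) (simp_all add: space_outcomes)
qed

lemma integral_bind_kernel:
  fixes h :: "'u \<Rightarrow> real"
  assumes P: "P \<in> space (prob_algebra M)" and \<gamma>: "\<gamma> \<in> M \<rightarrow>\<^sub>M prob_algebra N"
    and h: "h \<in> borel_measurable N" "\<And>u. u \<in> space N \<Longrightarrow> \<bar>h u\<bar> \<le> B"
  shows "(\<integral>u. h u \<partial>(P \<bind> \<gamma>)) = (\<integral>y. (\<integral>u. h u \<partial>\<gamma> y) \<partial>P)"
proof -
  have PD: "prob_space P" "sets P = sets M" using P by (auto simp: space_prob_algebra)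
  then have sp: "space P = space M" by (intro sets_eq_imp_space_eq)
  show ?thesis
  proof (rule integral_bind[OF h, where B'=1])
    show "\<gamma> \<in> P \<rightarrow>\<^sub>M subprob_algebra N"
      using measurable_prob_algebraD[OF \<gamma>] PD(2) by (simp cong: measurable_cong_sets)
    show "AE y in P. emeasure (\<gamma> y) (space (\<gamma> y)) \<le> ennreal 1"
      using measurable_space[OF \<gamma>] sp by (intro AE_I2) (auto simp: space_prob_algebra prob_space.emeasure_space_1)
  qed (use PD(1) in \<open>auto simp: prob_space_def\<close>)
qed

lemma kernel_bind: "\<kappa> \<in> kernels S T \<Longrightarrow> \<gamma> \<in> kernels T U \<Longrightarrow> (\<lambda>y. \<kappa> y \<bind> \<gamma>) \<in> kernels S U"
  unfolding kernels_def by (rule measurable_bind_prob_space)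

text \<open>Playing \<gamma>1 on garbled data amounts to garbling privately before playing
  \<gamma>1. With the policy of player 2 integrated out, this is the composition rule for
  kernels.\<close>

lemma expected_cost_garble1:
  assumes \<mu>: "\<mu> \<in> space (prob_algebra (outcomes X Y1 Y2))" and \<kappa>: "\<kappa> \<in> kernels Y1 Y1"
    and G: "(c, U1, U2) \<in> compact_continuous_games X"
    and \<gamma>: "\<gamma>1 \<in> kernels Y1 U1" "\<gamma>2 \<in> kernels Y2 U2"
  shows "expected_cost (c, U1, U2) (garble1 \<kappa> \<mu>) \<gamma>1 \<gamma>2
    = expected_cost (c, U1, U2) \<mu> (\<lambda>y. \<kappa> y \<bind> \<gamma>1) \<gamma>2"
proof -
  obtain b where "bayesian_game \<mu> (borel_on Y1) (borel_on Y2) (\<lambda>w. fst (snd w)) (\<lambda>w. snd (snd w)) U1 U2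
    (\<lambda>w u v. c (fst w, u, v)) b"
    by (rule game_is_bayesian_game[OF \<mu> G])
  then interpret g: bayesian_game \<mu> "borel_on Y1" "borel_on Y2" "\<lambda>w. fst (snd w)" "\<lambda>w. snd (snd w)" U1 U2
    "\<lambda>w u v. c (fst w, u, v)" b .
  have K: "g.P1.policies = kernels Y1 U1" "g.P2.policies = kernels Y2 U2"
    by (simp_all add: g.P1.policies_def g.P2.policies_def kernels_def)
  note h = g.carath_response1[of \<gamma>2, unfolded K, OF \<gamma>(2)]
  let ?F = "\<lambda>w. \<integral>u. g.response1 \<gamma>2 w u \<partial>\<gamma>1 (fst (snd w))"
  have m: "?F \<in> borel_measurable (outcomes X Y1 Y2)"
    using g.P1.conditional_payoff(1)[OF h, of \<gamma>1, unfolded K, OF \<gamma>(1)] prob_outcomesD(2)[OF \<mu>]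
    by (simp cong: measurable_cong_sets)
  have b: "\<bar>?F z\<bar> \<le> b" if "z \<in> X \<times> Y1 \<times> Y2" for z
    using g.P1.conditional_payoff(2)[OF h, of \<gamma>1, unfolded K, OF \<gamma>(1)] that prob_outcomesD(3)[OF \<mu>] by simp
  have "expected_cost (c, U1, U2) (garble1 \<kappa> \<mu>) \<gamma>1 \<gamma>2 = (\<integral>w. ?F w \<partial>garble1 \<kappa> \<mu>)"
    by (simp add: expected_cost_def g.response1_def split_beta')
  also have "\<dots> = (\<integral>w. (\<integral>y. ?F (fst w, y, snd (snd w)) \<partial>\<kappa> (fst (snd w))) \<partial>\<mu>)"
    by (rule garble1_props(2)[OF \<mu> \<kappa> m b])
  also have "\<dots> = (\<integral>w. (\<integral>u. g.response1 \<gamma>2 w u \<partial>(\<kappa> (fst (snd w)) \<bind> \<gamma>1)) \<partial>\<mu>)"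
  proof (rule Bochner_Integration.integral_cong)
    fix w assume w: "w \<in> space \<mu>"
    then have "fst (snd w) \<in> space (borel_on Y1)" by (auto simp: prob_outcomesD(3)[OF \<mu>] space_restrict_space)
    then have "\<kappa> (fst (snd w)) \<in> space (prob_algebra (borel_on Y1))"
      using \<kappa> unfolding kernels_def by (auto intro: measurable_space)
    from integral_bind_kernel[OF this _ g.P1.carath_boundedD(4,2)[OF h w], of \<gamma>1] \<gamma>(1)
    show "(\<integral>y. ?F (fst w, y, snd (snd w)) \<partial>\<kappa> (fst (snd w))) = (\<integral>u. g.response1 \<gamma>2 w u \<partial>(\<kappa> (fst (snd w)) \<bind> \<gamma>1))"
      by (simp add: kernels_def g.response1_def)
  qed simp
  also have "\<dots> = expected_cost (c, U1, U2) \<mu> (\<lambda>y. \<kappa> y \<bind> \<gamma>1) \<gamma>2"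
    by (simp add: expected_cost_def g.response1_def split_beta')
  finally show ?thesis .
qed

text \<open>\<open>expected_cost\<close> integrates player 2's action innermost. Garbling the
  observation of player 2 calls for the action of player 1 to be integrated out inside, hence the
  other order.\<close>

lemma expected_cost_swap:
  assumes \<mu>: "\<mu> \<in> space (prob_algebra (outcomes X Y1 Y2))"
    and G: "(c, U1, U2) \<in> compact_continuous_games X"
    and \<gamma>: "\<gamma>1 \<in> kernels Y1 U1" "\<gamma>2 \<in> kernels Y2 U2"
  shows "expected_cost (c, U1, U2) \<mu> \<gamma>1 \<gamma>2
    = (\<integral>w. (\<integral>v. (\<integral>u. c (fst w, u, v) \<partial>\<gamma>1 (fst (snd w))) \<partial>\<gamma>2 (snd (snd w))) \<partial>\<mu>)"
proof -
  obtain b where "bayesian_game \<mu> (borel_on Y1) (borel_on Y2) (\<lambda>w. fst (snd w)) (\<lambda>w. snd (snd w)) U1 U2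
    (\<lambda>w u v. c (fst w, u, v)) b"
    by (rule game_is_bayesian_game[OF \<mu> G])
  then interpret g: bayesian_game \<mu> "borel_on Y1" "borel_on Y2" "\<lambda>w. fst (snd w)" "\<lambda>w. snd (snd w)" U1 U2
    "\<lambda>w u v. c (fst w, u, v)" b .
  have "\<gamma>1 \<in> g.P1.policies" "\<gamma>2 \<in> g.P2.policies"
    using \<gamma> by (simp_all add: g.P1.policies_def g.P2.policies_def kernels_def)
  from g.cost_payoff2[OF this] show ?thesis
    by (simp add: expected_cost_def g.cost_def g.P2.payoff_def g.response2_def split_beta')
qed

lemma expected_cost_garble2:
  assumes \<mu>: "\<mu> \<in> space (prob_algebra (outcomes X Y1 Y2))" and \<kappa>: "\<kappa> \<in> kernels Y2 Y2"
    and G: "(c, U1, U2) \<in> compact_continuous_games X"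
    and \<gamma>: "\<gamma>1 \<in> kernels Y1 U1" "\<gamma>2 \<in> kernels Y2 U2"
  shows "expected_cost (c, U1, U2) (garble2 \<kappa> \<mu>) \<gamma>1 \<gamma>2
    = expected_cost (c, U1, U2) \<mu> \<gamma>1 (\<lambda>y. \<kappa> y \<bind> \<gamma>2)"
proof -
  obtain b where "bayesian_game \<mu> (borel_on Y1) (borel_on Y2) (\<lambda>w. fst (snd w)) (\<lambda>w. snd (snd w)) U1 U2
    (\<lambda>w u v. c (fst w, u, v)) b"
    by (rule game_is_bayesian_game[OF \<mu> G])
  then interpret g: bayesian_game \<mu> "borel_on Y1" "borel_on Y2" "\<lambda>w. fst (snd w)" "\<lambda>w. snd (snd w)" U1 U2
    "\<lambda>w u v. c (fst w, u, v)" b .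
  have K: "g.P1.policies = kernels Y1 U1" "g.P2.policies = kernels Y2 U2"
    by (simp_all add: g.P1.policies_def g.P2.policies_def kernels_def)
  note h = g.carath_response2[of \<gamma>1, unfolded K, OF \<gamma>(1)]
  let ?F = "\<lambda>w. \<integral>u. g.response2 \<gamma>1 w u \<partial>\<gamma>2 (snd (snd w))"
  have m: "?F \<in> borel_measurable (outcomes X Y1 Y2)"
    using g.P2.conditional_payoff(1)[OF h, of \<gamma>2, unfolded K, OF \<gamma>(2)] prob_outcomesD(2)[OF \<mu>]
    by (simp cong: measurable_cong_sets)
  have b: "\<bar>?F z\<bar> \<le> b" if "z \<in> X \<times> Y1 \<times> Y2" for z
    using g.P2.conditional_payoff(2)[OF h, of \<gamma>2, unfolded K, OF \<gamma>(2)] that prob_outcomesD(3)[OF \<mu>] by simp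
  have "expected_cost (c, U1, U2) (garble2 \<kappa> \<mu>) \<gamma>1 \<gamma>2 = (\<integral>w. ?F w \<partial>garble2 \<kappa> \<mu>)"
    using expected_cost_swap[OF garble2_props(1)[OF \<mu> \<kappa>] G \<gamma>] by (simp add: g.response2_def)
  also have "\<dots> = (\<integral>w. (\<integral>y. ?F (fst w, fst (snd w), y) \<partial>\<kappa> (snd (snd w))) \<partial>\<mu>)"
    by (rule garble2_props(2)[OF \<mu> \<kappa> m b])
  also have "\<dots> = (\<integral>w. (\<integral>u. g.response2 \<gamma>1 w u \<partial>(\<kappa> (snd (snd w)) \<bind> \<gamma>2)) \<partial>\<mu>)"
  proof (rule Bochner_Integration.integral_cong)
    fix w assume w: "w \<in> space \<mu>"
    then have "snd (snd w) \<in> space (borel_on Y2)" by (auto simp: prob_outcomesD(3)[OF \<mu>] space_restrict_space)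
    then have "\<kappa> (snd (snd w)) \<in> space (prob_algebra (borel_on Y2))"
      using \<kappa> unfolding kernels_def by (auto intro: measurable_space)
    from integral_bind_kernel[OF this _ g.P2.carath_boundedD(4,2)[OF h w], of \<gamma>2] \<gamma>(2)
    show "(\<integral>y. ?F (fst w, fst (snd w), y) \<partial>\<kappa> (snd (snd w))) = (\<integral>u. g.response2 \<gamma>1 w u \<partial>(\<kappa> (snd (snd w)) \<bind> \<gamma>2))"
      by (simp add: kernels_def g.response2_def)
  qed simp
  also have "\<dots> = expected_cost (c, U1, U2) \<mu> \<gamma>1 (\<lambda>y. \<kappa> y \<bind> \<gamma>2)"
    using expected_cost_swap[OF \<mu> G \<gamma>(1) kernel_bind[OF \<kappa> \<gamma>(2)]] by (simp add: g.response2_def)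
  finally show ?thesis .
qed

section \<open>Sufficiency of a common garbled law\<close>

lemma better_for_maximizer_if_garbled:
  fixes \<nu> \<mu> :: "('x::polish_space \<times> 'y1::polish_space \<times> 'y2::polish_space) measure"
  assumes \<nu>: "\<nu> \<in> space (prob_algebra (outcomes X Y1 Y2))" and \<mu>: "\<mu> \<in> space (prob_algebra (outcomes X Y1 Y2))"
    and \<kappa>: "\<kappa>1 \<in> kernels Y1 Y1" "\<kappa>2 \<in> kernels Y2 Y2" and eq: "garble1 \<kappa>1 \<nu> = garble2 \<kappa>2 \<mu>"
  shows "better_for_maximizer Y1 Y2 (compact_continuous_games X) \<nu> \<mu>"
  unfolding better_for_maximizer_def
proof
  fix G :: "('x, 'a::polish_space, 'b::polish_space) game" assume "G \<in> compact_continuous_games X"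
  then obtain c U1 U2 where G: "(c, U1, U2) \<in> compact_continuous_games X" and G_eq: "G = (c, U1, U2)"
    by (cases G) auto
  obtain a2 where a2: "a2 \<in> kernels Y2 U2"
    "\<And>\<gamma>. \<gamma> \<in> kernels Y1 U1 \<Longrightarrow> game_value Y1 Y2 (c, U1, U2) \<nu> \<le> expected_cost (c, U1, U2) \<nu> \<gamma> a2"
    by (rule game_value_saddle[OF \<nu> G]) blast
  obtain b1 where b1: "b1 \<in> kernels Y1 U1"
    "\<And>\<gamma>. \<gamma> \<in> kernels Y2 U2 \<Longrightarrow> expected_cost (c, U1, U2) \<mu> b1 \<gamma> \<le> game_value Y1 Y2 (c, U1, U2) \<mu>"
    by (rule game_value_saddle[OF \<mu> G]) blast
  have "game_value Y1 Y2 (c, U1, U2) \<nu> \<le> expected_cost (c, U1, U2) \<nu> (\<lambda>y. \<kappa>1 y \<bind> b1) a2"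
    by (rule a2(2)[OF kernel_bind[OF \<kappa>(1) b1(1)]])
  also have "\<dots> = expected_cost (c, U1, U2) (garble2 \<kappa>2 \<mu>) b1 a2"
    using expected_cost_garble1[OF \<nu> \<kappa>(1) G b1(1) a2(1)] eq by simp
  also have "\<dots> = expected_cost (c, U1, U2) \<mu> b1 (\<lambda>y. \<kappa>2 y \<bind> a2)"
    by (rule expected_cost_garble2[OF \<mu> \<kappa>(2) G b1(1) a2(1)])
  also have "\<dots> \<le> game_value Y1 Y2 (c, U1, U2) \<mu>"
    by (rule b1(2)[OF kernel_bind[OF \<kappa>(2) a2(1)]])
  finally show "game_value Y1 Y2 G \<nu> \<le> game_value Y1 Y2 G \<mu>" unfolding G_eq .
qed

section \<open>Separation\<close>

text \<open>The geometric distribution charges every index, so a vanishing mean of squares leaves no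
  exceptional index.\<close>

lemma integral_geometric_eq_0:
  fixes h :: "nat \<Rightarrow> real"
  assumes b: "\<And>k. \<bar>h k\<bar> \<le> B" and "pmf_mean (geometric_pmf (1/2)) (\<lambda>k. (h k)\<^sup>2) = 0"
  shows "h k = 0"
proof -
  have "(h k)\<^sup>2 \<le> B\<^sup>2" for k using b[of k] by (metis abs_ge_zero abs_le_square_iff abs_of_nonneg order_trans)
  then have "integrable (measure_pmf (geometric_pmf (1/2))) (\<lambda>k. (h k)\<^sup>2)"
    by (intro pmf_expectation_bounded(1)[where B="B\<^sup>2"]) auto
  from integral_nonneg_eq_0_iff_AE[OF this] assms(2) show ?thesis
    by (simp add: AE_measure_pmf_iff set_pmf_geometric)
qed

text \<open>The separating functional is given by the element of least norm in a weighted \<open>\<ell>\<^sup>2\<close> space.\<close>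

lemma zero_or_separated:
  fixes l :: "nat \<Rightarrow> 'z \<Rightarrow> real"
  defines "g \<equiv> geometric_pmf (1/2)"
  assumes ne: "Z \<noteq> {}" and b: "\<And>k z. z \<in> Z \<Longrightarrow> \<bar>l k z\<bar> \<le> B"
    and convex: "\<And>z z' t. z \<in> Z \<Longrightarrow> z' \<in> Z \<Longrightarrow> 0 \<le> t \<Longrightarrow> t \<le> 1 \<Longrightarrow>
      \<exists>y\<in>Z. \<forall>k. l k y = (1 - t) * l k z + t * l k z'"
    and cpt: "\<And>z. (\<And>n. z n \<in> Z) \<Longrightarrow> \<exists>y\<in>Z. \<exists>p. (\<forall>n. set_pmf (p n) \<subseteq> {n..}) \<and>
      (\<forall>k. (\<lambda>n. pmf_mean (p n) (\<lambda>m. l k (z m))) \<longlonglongrightarrow> l k y)"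
    and nz: "\<not> (\<exists>z\<in>Z. \<forall>k. l k z = 0)"
  shows "\<exists>w d. 0 < d \<and> (\<forall>k. \<bar>w k\<bar> \<le> B) \<and> (\<forall>z\<in>Z. d \<le> pmf_mean g (\<lambda>k. w k * l k z))"
proof -
  define D where "D z = pmf_mean g (\<lambda>k. (l k z)\<^sup>2)" for z
  have b2: "(l k z)\<^sup>2 \<le> B\<^sup>2" if "z \<in> Z" for k z
    using b[OF that] by (metis abs_ge_zero abs_le_square_iff abs_of_nonneg order_trans)
  have D0: "0 \<le> D z" for z by (simp add: D_def)
  have DB: "\<bar>D z\<bar> \<le> B\<^sup>2" if "z \<in> Z" for z
    unfolding D_def using b2[OF that] by (intro pmf_expectation_bounded(2)) auto
  have bdd: "bdd_below (D ` Z)" using D0 by (auto intro!: bdd_belowI)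
  define d0 where "d0 = Inf (D ` Z)"
  have d0: "d0 \<le> D z" if "z \<in> Z" for z unfolding d0_def using that by (intro cInf_lower bdd) auto
  have "\<exists>z\<in>Z. D z < d0 + 1 / real (Suc n)" for n
  proof -
    have "Inf (D ` Z) < d0 + 1 / real (Suc n)" by (simp add: d0_def)
    then show ?thesis using cInf_lessD[of "D ` Z" "d0 + 1 / real (Suc n)"] ne by auto
  qed
  then obtain z where z: "\<And>n. z n \<in> Z" and zD: "\<And>n. D (z n) < d0 + 1 / real (Suc n)" by metis
  obtain y p where y: "y \<in> Z" and p: "\<And>n. set_pmf (p n) \<subseteq> {n..}"
    and lim: "\<And>k. (\<lambda>n. pmf_mean (p n) (\<lambda>m. l k (z m))) \<longlonglongrightarrow> l k y"
    using cpt[of z, OF z] by blast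
  \<comment> \<open>Lower semicontinuity under forward averages: by Jensen's inequality the squared
    norm of an average is at most the average of the squared norms, so the limit y attains the
    infimum.\<close>
  have "D y \<le> d0"
  proof (rule field_le_epsilon)
    fix e :: real assume e: "0 < e"
    have "\<forall>\<^sub>F n in sequentially. 1 / real (Suc n) < e" by (rule order_tendstoD(2)[OF _ e]) real_asymp
    then have "\<forall>\<^sub>F n in sequentially. D (z n) \<le> d0 + e"
    proof eventually_elim
      fix n assume "1 / real (Suc n) < e"
      then show "D (z n) \<le> d0 + e" using zD[of n] by argo
    qed
    then have ev: "\<forall>\<^sub>F n in sequentially. pmf_mean (p n) (\<lambda>m. D (z m)) \<le> d0 + e"
      by (rule tail_average_le[OF p DB[OF z]])
    let ?a = "\<lambda>n k. pmf_mean (p n) (\<lambda>m. l k (z m))"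
    have ab: "\<bar>?a n k\<bar> \<le> B" for n k by (rule pmf_expectation_bounded(2)) (rule b[OF z])
    have ab2: "(?a n k)\<^sup>2 \<le> B\<^sup>2" for n k
      using ab[of n k] by (metis abs_ge_zero abs_le_square_iff abs_of_nonneg order_trans)
    have le: "pmf_mean g (\<lambda>k. (?a n k)\<^sup>2) \<le> pmf_mean (p n) (\<lambda>m. D (z m))" for n
    proof -
      have "pmf_mean g (\<lambda>k. (?a n k)\<^sup>2)
          \<le> pmf_mean g (\<lambda>k. pmf_mean (p n) (\<lambda>m. (l k (z m))\<^sup>2))"
      proof (rule integral_mono)
        show "integrable (measure_pmf g) (\<lambda>k. (?a n k)\<^sup>2)"
          using ab2 by (intro pmf_expectation_bounded(1)[where B="B\<^sup>2"]) auto
        show "integrable (measure_pmf g) (\<lambda>k. pmf_mean (p n) (\<lambda>m. (l k (z m))\<^sup>2))"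
          by (rule pmf_expectation_bounded(1)[where B="B\<^sup>2"], rule pmf_expectation_bounded(2)) (use b2[OF z] in auto)
        show "(?a n k)\<^sup>2 \<le> pmf_mean (p n) (\<lambda>m. (l k (z m))\<^sup>2)" for k
          by (rule square_pmf_average_le[where B=B]) (rule b[OF z])
      qed
      also have "\<dots> = pmf_mean (p n) (\<lambda>m. D (z m))"
        unfolding D_def by (rule integral_pmf_average[where B="B\<^sup>2"])
          (use b2[OF z] measure_pmf.prob_space_axioms in auto)
      finally show ?thesis .
    qed
    have "(\<lambda>n. pmf_mean g (\<lambda>k. (?a n k)\<^sup>2)) \<longlonglongrightarrow> D y"
      unfolding D_def
    proof (rule integral_dominated_convergence[where w="\<lambda>_. B\<^sup>2"])
      show "AE k in measure_pmf g. (\<lambda>n. (?a n k)\<^sup>2) \<longlonglongrightarrow> (l k y)\<^sup>2"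
        by (intro AE_I2 tendsto_power lim)
      show "AE k in measure_pmf g. norm ((?a n k)\<^sup>2) \<le> B\<^sup>2" for n using ab2 by (intro AE_I2) simp
    qed simp_all
    moreover have "\<forall>\<^sub>F n in sequentially. pmf_mean g (\<lambda>k. (?a n k)\<^sup>2) \<le> d0 + e"
      using ev by eventually_elim (rule order_trans[OF le])
    ultimately show "D y \<le> d0 + e" by (rule tendsto_upperbound[OF _ _ sequentially_bot])
  qed
  then have min: "D y \<le> D z" if "z \<in> Z" for z using d0[OF that] by simp
  have "D y \<noteq> 0"
  proof
    assume "D y = 0"
    then have "l k y = 0" for k
      using integral_geometric_eq_0[of "\<lambda>k. l k y", OF b[OF y]] by (simp add: D_def g_def)
    then show False using nz y by blast
  qed
  then have Dy: "0 < D y" using D0[of y] by simp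
  have "D y \<le> pmf_mean g (\<lambda>k. l k y * l k x)" if x: "x \<in> Z" for x
  proof -
    define P where "P = pmf_mean g (\<lambda>k. l k y * (l k x - l k y))"
    define Q where "Q = pmf_mean g (\<lambda>k. (l k x - l k y)\<^sup>2)"
    have Bn: "0 \<le> B" using b[OF x, of 0] by linarith
    have bd: "\<bar>l k x - l k y\<bar> \<le> 2 * B" for k using b[OF x, of k] b[OF y, of k] by linarith
    have i1: "integrable (measure_pmf g) (\<lambda>k. l k y * (l k x - l k y))"
      using b[OF y] bd Bn by (intro pmf_expectation_bounded(1)[where B="B * (2 * B)"]) (auto simp: abs_mult intro!: mult_mono)
    have i2: "integrable (measure_pmf g) (\<lambda>k. (l k x - l k y)\<^sup>2)"
    proof (rule pmf_expectation_bounded(1)[where B="(2 * B)\<^sup>2"])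
      fix k show "\<bar>(l k x - l k y)\<^sup>2\<bar> \<le> (2 * B)\<^sup>2"
        using power_mono[OF bd[of k], of 2] by simp
    qed
    have i3: "integrable (measure_pmf g) (\<lambda>k. (l k y)\<^sup>2)"
      using b2[OF y] by (intro pmf_expectation_bounded(1)[where B="B\<^sup>2"]) auto
    \<comment> \<open>Moving from y towards x cannot decrease the squared norm; dividing its
      increment by t leaves \<open>2 * P\<close> as t tends to 0. Nonnegativity of P says that x has
      inner product at least \<open>D y\<close> with y.\<close>
    have quad: "0 \<le> 2 * P + t * Q" if t: "0 < t" "t \<le> 1" for t
    proof -
      obtain u where u: "u \<in> Z" "\<And>k. l k u = (1 - t) * l k y + t * l k x"
        using convex[OF y x, of t] t by auto
      have "D u = pmf_mean g (\<lambda>k. (l k y)\<^sup>2 + (2 * t * (l k y * (l k x - l k y)) + t\<^sup>2 * (l k x - l k y)\<^sup>2))"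
        unfolding D_def u(2) by (intro Bochner_Integration.integral_cong) (auto simp: power2_eq_square algebra_simps)
      also have "\<dots> = D y + (2 * t * P + t\<^sup>2 * Q)"
        using i1 i2 i3 by (simp add: D_def P_def Q_def)
      finally have "0 \<le> 2 * t * P + t\<^sup>2 * Q" using min[OF u(1)] by simp
      then have "0 \<le> t * (2 * P + t * Q)" by (simp add: power2_eq_square algebra_simps)
      then show ?thesis using t(1) by (simp add: zero_le_mult_iff)
    qed
    have "(\<lambda>n. 2 * P + 1 / real (Suc n) * Q) \<longlonglongrightarrow> 2 * P + 0 * Q"
      by (intro tendsto_intros) real_asymp
    then have "0 \<le> 2 * P + 0 * Q"
      by (rule tendsto_lowerbound[OF _ _ sequentially_bot]) (intro always_eventually allI quad; simp)
    moreover have "pmf_mean g (\<lambda>k. l k y * l k x) = P + D y"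
    proof -
      have "pmf_mean g (\<lambda>k. l k y * l k x)
          = pmf_mean g (\<lambda>k. l k y * (l k x - l k y) + (l k y)\<^sup>2)"
        by (intro Bochner_Integration.integral_cong) (auto simp: power2_eq_square algebra_simps)
      then show ?thesis using i1 i3 by (simp add: P_def D_def)
    qed
    ultimately show ?thesis by simp
  qed
  then show ?thesis using Dy b[OF y] by (intro exI[of _ "\<lambda>k. l k y"] exI[of _ "D y"]) simp
qed

text \<open>A point is recorded by its distances to a dense sequence, a continuous injection;
  compactness makes the inverse continuous. Signals can thereby serve as actions in the sequence
  space while the cost stays continuous.\<close>

lemma compact_sequence_embedding:
  fixes Y :: "'a::polish_space set"
  assumes "compact Y"
  obtains e :: "'a \<Rightarrow> nat \<Rightarrow> real" and r where "continuous_on UNIV e" and "compact (e ` Y)"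
    and "continuous_on (e ` Y) r" and "\<And>y. y \<in> Y \<Longrightarrow> r (e y) = y"
proof -
  obtain D :: "'a set" where D: "countable D" "\<And>X. open X \<Longrightarrow> X \<noteq> {} \<Longrightarrow> \<exists>d\<in>D. d \<in> X"
    using countable_dense_exists by metis
  then have "D \<noteq> {}" by fastforce
  define d where "d = from_nat_into D"
  have rd: "range d = D" unfolding d_def by (rule range_from_nat_into) fact+
  define e where "e y = (\<lambda>i. dist y (d i))" for y
  have ce: "continuous_on UNIV e"
    unfolding e_def by (intro continuous_on_coordinatewise_then_product continuous_intros)
  have inj: "y = y'" if eq: "e y = e y'" for y y'
  proof (rule ccontr)
    assume "y \<noteq> y'"
    then obtain x where x: "x \<in> D" "x \<in> ball y (dist y y' / 2)"
      using D(2)[of "ball y (dist y y' / 2)"] by auto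
    then obtain i where "x = d i" using rd by auto
    with x have "dist y (d i) < dist y y' / 2" by (simp add: dist_commute)
    moreover have "dist y' (d i) = dist y (d i)" using fun_cong[OF eq, of i] by (simp add: e_def)
    ultimately show False using dist_triangle2[of y y' "d i"] by simp
  qed
  have ceY: "continuous_on Y e" using ce by (rule continuous_on_subset) auto
  have inv: "inv_into Y e (e y) = y" if "y \<in> Y" for y
    using that inj by (intro inv_into_f_f inj_onI) auto
  show thesis
    by (rule that[OF ce compact_continuous_image[OF ceY assms] continuous_on_inv[OF ceY assms], of "inv_into Y e"])
      (auto simp: inv)
qed

text \<open>A garbling of player 1's observation is a policy whose actions are signals; the integral
  of F under the garbled law is the payoff of reporting by that policy.\<close>

lemma carath_bounded_garbling1:
  fixes F :: "'x::polish_space \<times> 'y1::polish_space \<times> 'y2::polish_space \<Rightarrow> real"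
  assumes \<nu>: "\<nu> \<in> space (prob_algebra (outcomes X Y1 Y2))"
    and F: "F \<in> borel_measurable (outcomes X Y1 Y2)" "\<And>z. z \<in> X \<times> Y1 \<times> Y2 \<Longrightarrow> \<bar>F z\<bar> \<le> B"
    and cont: "\<And>x y2. x \<in> X \<Longrightarrow> y2 \<in> Y2 \<Longrightarrow> continuous_on Y1 (\<lambda>y. F (x, y, y2))"
  shows "carath_bounded \<nu> Y1 (\<lambda>w y. F (fst w, y, snd (snd w))) B"
  unfolding carath_bounded_def
proof (intro conjI ballI)
  note \<nu>D = prob_outcomesD[OF \<nu>]
  have "(\<lambda>z. (fst (fst z), snd z, snd (snd (fst z)))) \<in> \<nu> \<Otimes>\<^sub>M borel_on Y1 \<rightarrow>\<^sub>M outcomes X Y1 Y2"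
    by (intro measurable_Pair measurable_snd measurable_compose[OF measurable_fst observation_measurable(1)[OF \<nu>]]
        measurable_compose[OF measurable_fst observation_measurable(3)[OF \<nu>]])
  from measurable_compose[OF this F(1)]
  show "(\<lambda>(w, y). F (fst w, y, snd (snd w))) \<in> borel_measurable (\<nu> \<Otimes>\<^sub>M borel_on Y1)"
    by (simp add: split_beta')
qed (use F(2) cont prob_outcomesD(3)[OF \<nu>] in auto)

lemma carath_bounded_garbling2:
  fixes F :: "'x::polish_space \<times> 'y1::polish_space \<times> 'y2::polish_space \<Rightarrow> real"
  assumes \<mu>: "\<mu> \<in> space (prob_algebra (outcomes X Y1 Y2))"
    and F: "F \<in> borel_measurable (outcomes X Y1 Y2)" "\<And>z. z \<in> X \<times> Y1 \<times> Y2 \<Longrightarrow> \<bar>F z\<bar> \<le> B"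
    and cont: "\<And>x y1. x \<in> X \<Longrightarrow> y1 \<in> Y1 \<Longrightarrow> continuous_on Y2 (\<lambda>y. F (x, y1, y))"
  shows "carath_bounded \<mu> Y2 (\<lambda>w y. F (fst w, fst (snd w), y)) B"
  unfolding carath_bounded_def
proof (intro conjI ballI)
  have "(\<lambda>z. (fst (fst z), fst (snd (fst z)), snd z)) \<in> \<mu> \<Otimes>\<^sub>M borel_on Y2 \<rightarrow>\<^sub>M outcomes X Y1 Y2"
    by (intro measurable_Pair measurable_snd measurable_compose[OF measurable_fst observation_measurable(1)[OF \<mu>]]
        measurable_compose[OF measurable_fst observation_measurable(2)[OF \<mu>]])
  from measurable_compose[OF this F(1)]
  show "(\<lambda>(w, y). F (fst w, fst (snd w), y)) \<in> borel_measurable (\<mu> \<Otimes>\<^sub>M borel_on Y2)"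
    by (simp add: split_beta')
qed (use F(2) cont prob_outcomesD(3)[OF \<mu>] in auto)

text \<open>Garbling kernels are policies with signals as actions, so convexity and compactness of
  the set of pairs come from the decision problems. The coordinates l compare the two garbled laws
  on countably many continuous tests, and all vanish only if the laws agree.\<close>

lemma separating_cost:
  fixes \<nu> \<mu> :: "('x::polish_space \<times> 'y1::polish_space \<times> 'y2::polish_space) measure"
  assumes X: "X \<in> sets borel" and Y: "compact Y1" "compact Y2"
    and \<nu>: "\<nu> \<in> space (prob_algebra (outcomes X Y1 Y2))" and \<mu>: "\<mu> \<in> space (prob_algebra (outcomes X Y1 Y2))"
    and no: "\<not> (\<exists>\<kappa>1\<in>kernels Y1 Y1. \<exists>\<kappa>2\<in>kernels Y2 Y2. garble1 \<kappa>1 \<nu> = garble2 \<kappa>2 \<mu>)"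
  obtains F :: "'x \<times> 'y1 \<times> 'y2 \<Rightarrow> real" and d where "0 < d" and "continuous_on UNIV F" and "\<And>z. \<bar>F z\<bar> \<le> 2"
    and "\<And>\<kappa>1 \<kappa>2. \<kappa>1 \<in> kernels Y1 Y1 \<Longrightarrow> \<kappa>2 \<in> kernels Y2 Y2 \<Longrightarrow>
      (\<integral>z. F z \<partial>garble2 \<kappa>2 \<mu>) + d \<le> (\<integral>z. F z \<partial>garble1 \<kappa>1 \<nu>)"
proof -
  let ?P = "outcomes X Y1 Y2" and ?U = "X \<times> Y1 \<times> Y2"
  note \<nu>D = prob_outcomesD[OF \<nu>] and \<mu>D = prob_outcomesD[OF \<mu>]
  have "?U \<noteq> {}" using prob_space.not_empty[OF \<nu>D(1)] \<nu>D(3) by simp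
  then have Yne: "Y1 \<noteq> {}" "Y2 \<noteq> {}" by auto
  interpret D1: observed_decision \<nu> "borel_on Y1" "\<lambda>w. fst (snd w)" Y1
    by (intro observed_decision.intro \<nu>D observed_decision_axioms.intro observation_measurable[OF \<nu>] Y Yne)
  interpret D2: observed_decision \<mu> "borel_on Y2" "\<lambda>w. snd (snd w)" Y2
    by (intro observed_decision.intro \<mu>D observed_decision_axioms.intro observation_measurable[OF \<mu>] Y Yne)
  have K: "D1.policies = kernels Y1 Y1" "D2.policies = kernels Y2 Y2"
    by (simp_all add: D1.policies_def D2.policies_def kernels_def)
  have sets_P: "sets ?P = sets (borel_on ?U)"
    using sets_pair_measure_cong[OF refl sets_borel_on_prod[of Y1 Y2], of "borel_on X"] sets_borel_on_prod[of X "Y1 \<times> Y2"]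
    by simp
  have sP: "space (prob_algebra ?P) = space (prob_algebra (borel_on ?U))"
    unfolding space_prob_algebra sets_P ..
  have Ub: "?U \<in> sets borel"
    using X Y by (simp add: borel_prod[symmetric] borel_closed compact_imp_closed)
  obtain G :: "nat \<Rightarrow> ('x \<times> 'y1 \<times> 'y2) set" and \<phi> where G\<phi>: "determining G \<phi>"
    using determining_exists by blast
  note G = determiningD(1-3)[OF G\<phi>] and \<phi> = determiningD(4-7)[OF G\<phi>]
  define \<psi> where "\<psi> k = \<phi> (fst (prod_decode k)) (snd (prod_decode k))" for k
  have c\<psi>: "continuous_on UNIV (\<psi> k)" for k unfolding \<psi>_def by (rule \<phi>(1))
  have cm: "f \<in> borel_measurable ?P" if "continuous_on UNIV f" for f :: "'x \<times> 'y1 \<times> 'y2 \<Rightarrow> real"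
    using measurable_restrict_space1[OF borel_measurable_continuous_onI[OF that], of ?U] sets_P
    by (simp cong: measurable_cong_sets)
  note m\<psi> = cm[OF c\<psi>]
  have b\<psi>: "\<bar>\<psi> k z\<bar> \<le> 1" for k z
    using \<phi>(2,3)[where i="fst (prod_decode k)" and j="snd (prod_decode k)" and x=z] by (simp add: \<psi>_def)
  define h1 where "h1 k w y = \<psi> k (fst w, y, snd (snd w))" for k and w :: "'x \<times> 'y1 \<times> 'y2" and y
  define h2 where "h2 k w y = \<psi> k (fst w, fst (snd w), y)" for k and w :: "'x \<times> 'y1 \<times> 'y2" and y
  have h1: "carath_bounded \<nu> Y1 (h1 k) 1" for k
    unfolding h1_def
    by (rule carath_bounded_garbling1[OF \<nu> m\<psi> b\<psi>]) (auto intro!: continuous_on_compose2[OF c\<psi>] continuous_intros)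
  have h2: "carath_bounded \<mu> Y2 (h2 k) 1" for k
    unfolding h2_def
    by (rule carath_bounded_garbling2[OF \<mu> m\<psi> b\<psi>]) (auto intro!: continuous_on_compose2[OF c\<psi>] continuous_intros)
  define l where "l k z = D1.payoff (h1 k) (fst z) - D2.payoff (h2 k) (snd z)" for k z
  define Z where "Z = kernels Y1 Y1 \<times> kernels Y2 Y2"
  have J1: "D1.payoff (h1 k) \<kappa> = (\<integral>z. \<psi> k z \<partial>garble1 \<kappa> \<nu>)" if "\<kappa> \<in> kernels Y1 Y1" for k \<kappa>
    using garble1_props(2)[OF \<nu> that m\<psi> b\<psi>] by (simp add: D1.payoff_def h1_def)
  have J2: "D2.payoff (h2 k) \<kappa> = (\<integral>z. \<psi> k z \<partial>garble2 \<kappa> \<mu>)" if "\<kappa> \<in> kernels Y2 Y2" for k \<kappa>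
    using garble2_props(2)[OF \<mu> that m\<psi> b\<psi>] by (simp add: D2.payoff_def h2_def)
  have ne: "Z \<noteq> {}" using D1.policies_nonempty D2.policies_nonempty by (auto simp: Z_def K)
  have bJ1: "\<bar>D1.payoff (h1 k) \<kappa>\<bar> \<le> 1" if "\<kappa> \<in> kernels Y1 Y1" for k \<kappa>
    using D1.payoff_bound[OF h1] that by (simp add: K)
  have bJ2: "\<bar>D2.payoff (h2 k) \<kappa>\<bar> \<le> 1" if "\<kappa> \<in> kernels Y2 Y2" for k \<kappa>
    using D2.payoff_bound[OF h2] that by (simp add: K)
  have b: "\<bar>l k z\<bar> \<le> 2" if z: "z \<in> Z" for k z
    using bJ1[of "fst z" k] bJ2[of "snd z" k] z unfolding l_def Z_def mem_Times_iff by linarith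
  have convex: "\<exists>y\<in>Z. \<forall>k. l k y = (1 - t) * l k z + t * l k z'"
    if z: "z \<in> Z" and z': "z' \<in> Z" and t: "0 \<le> t" "t \<le> 1" for z z' t
  proof -
    from z z' have m: "fst z \<in> D1.policies" "fst z' \<in> D1.policies" "snd z \<in> D2.policies" "snd z' \<in> D2.policies"
      by (simp_all only: Z_def K mem_Times_iff)
    let ?y = "(pair_mixture t (fst z) (fst z'), pair_mixture t (snd z) (snd z'))"
    have "?y \<in> Z"
      using D1.pair_mixture_policy[OF m(1,2)] D2.pair_mixture_policy[OF m(3,4)] by (simp add: Z_def K)
    moreover have "l k ?y = (1 - t) * l k z + t * l k z'" for k
      using D1.payoff_pair_mixture[OF h1 m(1,2) t] D2.payoff_pair_mixture[OF h2 m(3,4) t]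
      by (simp add: l_def algebra_simps)
    ultimately show ?thesis by blast
  qed
  have cpt: "\<exists>y\<in>Z. \<exists>p. (\<forall>n. set_pmf (p n) \<subseteq> {n..}) \<and>
      (\<forall>k. (\<lambda>n. pmf_mean (p n) (\<lambda>m. l k (z m))) \<longlonglongrightarrow> l k y)" if z: "\<And>n. z n \<in> Z" for z
  proof -
    define a1 where "a1 m = fst (z m)" for m
    define a2 where "a2 m = snd (z m)" for m
    have a1: "\<And>m. a1 m \<in> D1.policies" and a2: "\<And>m. a2 m \<in> D2.policies"
      using z by (simp_all only: Z_def K mem_Times_iff a1_def a2_def)
    obtain p x1 where p: "\<And>n. set_pmf (p n) \<subseteq> {n..}" and x1: "x1 \<in> D1.policies"
      and lim1: "\<And>h b. carath_bounded \<nu> Y1 h b \<Longrightarrow>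
        (\<lambda>n. D1.payoff h (kernel_mixture (p n) a1)) \<longlonglongrightarrow> D1.payoff h x1"
      by (rule D1.policies_compact[of a1, OF a1]) blast
    \<comment> \<open>The weights p were found for player 1 alone. The second round q averages the
      already averaged policies of player 2, and the composed weights P serve both
      coordinates.\<close>
    define a2' where "a2' n = kernel_mixture (p n) a2" for n
    have a2': "\<And>n. a2' n \<in> D2.policies" unfolding a2'_def by (rule D2.kernel_mixture_policy[OF a2])
    obtain q x2 where q: "\<And>n. set_pmf (q n) \<subseteq> {n..}" and x2: "x2 \<in> D2.policies"
      and lim2: "\<And>h b. carath_bounded \<mu> Y2 h b \<Longrightarrow>
        (\<lambda>n. D2.payoff h (kernel_mixture (q n) a2')) \<longlonglongrightarrow> D2.payoff h x2"
      by (rule D2.policies_compact[of a2', OF a2']) blast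
    define P where "P n = bind_pmf (q n) p" for n
    have P: "set_pmf (P n) \<subseteq> {n..}" for n
    proof
      fix i assume "i \<in> set_pmf (P n)"
      then obtain m where "m \<in> set_pmf (q n)" "i \<in> set_pmf (p m)" by (auto simp: P_def)
      then show "i \<in> {n..}" using p[of m] q[of n] by (auto intro: order_trans)
    qed
    have "(\<lambda>n. pmf_mean (P n) (\<lambda>m. l k (z m))) \<longlonglongrightarrow> l k (x1, x2)" for k
    proof -
      have c1: "\<bar>D1.payoff (h1 k) (a1 m)\<bar> \<le> 1" for m by (rule D1.payoff_bound[OF h1 a1])
      have c2: "\<bar>D2.payoff (h2 k) (a2 m)\<bar> \<le> 1" for m by (rule D2.payoff_bound[OF h2 a2])
      have c1': "\<bar>D1.payoff (h1 k) (kernel_mixture (p m) a1)\<bar> \<le> 1" for m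
        by (rule D1.payoff_bound[OF h1 D1.kernel_mixture_policy[OF a1]])
      have "pmf_mean (P n) (\<lambda>m. l k (z m))
          = pmf_mean (P n) (\<lambda>m. D1.payoff (h1 k) (a1 m))
          - pmf_mean (P n) (\<lambda>m. D2.payoff (h2 k) (a2 m))" for n
        unfolding l_def a1_def[symmetric] a2_def[symmetric]
        by (rule Bochner_Integration.integral_diff)
          (rule pmf_expectation_bounded(1)[where B=1], rule c1 c2)+
      also have "\<And>n. \<dots> n = pmf_mean (q n) (\<lambda>m. D1.payoff (h1 k) (kernel_mixture (p m) a1))
          - D2.payoff (h2 k) (kernel_mixture (q n) a2')"
        by (simp add: P_def expectation_bind_pmf_bounded[of _ 1] c1 c2 a2'_def
            D1.payoff_kernel_mixture[OF h1 a1] D2.payoff_kernel_mixture[OF h2 a2]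
            D2.payoff_kernel_mixture[OF h2 a2'])
      finally have eq: "pmf_mean (P n) (\<lambda>m. l k (z m))
          = pmf_mean (q n) (\<lambda>m. D1.payoff (h1 k) (kernel_mixture (p m) a1))
          - D2.payoff (h2 k) (kernel_mixture (q n) a2')" for n .
      show ?thesis unfolding eq
        using tendsto_diff[OF tail_average_tendsto[OF q c1' lim1[OF h1]] lim2[OF h2]] by (simp add: l_def)
    qed
    then show ?thesis using P x1 x2 by (intro bexI[of _ "(x1, x2)"] exI[of _ P]) (auto simp: Z_def K)
  qed
  have nz: "\<not> (\<exists>z\<in>Z. \<forall>k. l k z = 0)"
  proof
    assume "\<exists>z\<in>Z. \<forall>k. l k z = 0"
    then obtain \<kappa>1 \<kappa>2 where \<kappa>: "\<kappa>1 \<in> kernels Y1 Y1" "\<kappa>2 \<in> kernels Y2 Y2" and z: "\<And>k. l k (\<kappa>1, \<kappa>2) = 0"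
      by (auto simp: Z_def)
    note g1 = garble1_props(1)[OF \<nu> \<kappa>(1), unfolded sP] and g2 = garble2_props(1)[OF \<mu> \<kappa>(2), unfolded sP]
    have "garble1 \<kappa>1 \<nu> = garble2 \<kappa>2 \<mu>"
    proof (rule prob_eq_if_open_eq[OF g1 g2 Ub G(2,3)])
      fix i
      have "(\<integral>u. \<phi> i j u \<partial>garble1 \<kappa>1 \<nu>) = (\<integral>u. \<phi> i j u \<partial>garble2 \<kappa>2 \<mu>)" for j
        using z[of "prod_encode (i, j)"] by (simp add: l_def J1 J2 \<kappa> \<psi>_def)
      then show "measure (garble1 \<kappa>1 \<nu>) (?U \<inter> G i) = measure (garble2 \<kappa>2 \<mu>) (?U \<inter> G i)"
        using measure_open_limit[OF g1 G(1)[of i] \<phi>] measure_open_limit[OF g2 G(1)[of i] \<phi>]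
        by (simp add: LIMSEQ_unique)
    qed
    then show False using no \<kappa> by blast
  qed
  obtain w d where d: "0 < d" and w: "\<And>k. \<bar>w k\<bar> \<le> 2"
    and sep: "\<And>z. z \<in> Z \<Longrightarrow> d \<le> pmf_mean (geometric_pmf (1/2)) (\<lambda>k. w k * l k z)"
    using zero_or_separated[where Z=Z and l=l and B=2, OF ne b convex cpt nz] by auto
  \<comment> \<open>The separating weights are absorbed into one function. Weights of size at most 2
    and tests between 0 and 1 dominate the series, which makes F continuous with bound 2.\<close>
  define F where "F z = pmf_mean (geometric_pmf (1/2)) (\<lambda>k. w k * \<psi> k z)" for z
  have wb: "\<bar>w k * \<psi> k z\<bar> \<le> 2" for k z
    using mult_mono[OF w[of k] b\<psi>[of k z]] by (simp add: abs_mult)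
  have Fb: "\<bar>F z\<bar> \<le> 2" for z unfolding F_def by (rule pmf_expectation_bounded(2)) (rule wb)
  have cF: "continuous_on UNIV F"
    unfolding F_def
    by (rule continuous_integral[where N="count_space UNIV" and B=2])
      (auto simp: space_prob_algebra measure_pmf.prob_space_axioms intro!: wb continuous_intros c\<psi>)
  have intF: "(\<integral>z. F z \<partial>Q) = pmf_mean (geometric_pmf (1/2)) (\<lambda>k. w k * (\<integral>z. \<psi> k z \<partial>Q))"
    if Q: "Q \<in> space (prob_algebra ?P)" for Q
  proof -
    have "(\<integral>z. F z \<partial>Q) = pmf_mean (geometric_pmf (1/2)) (\<lambda>k. \<integral>z. w k * \<psi> k z \<partial>Q)"
      unfolding F_def
      by (rule integral_pmf_average[OF prob_outcomesD(1)[OF Q] _ wb])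
        (intro borel_measurable_times borel_measurable_const borel_measurable_on_prob_algebra[OF Q m\<psi>])
    then show ?thesis by simp
  qed
  have "(\<integral>z. F z \<partial>garble2 \<kappa>2 \<mu>) + d \<le> (\<integral>z. F z \<partial>garble1 \<kappa>1 \<nu>)"
    if \<kappa>: "\<kappa>1 \<in> kernels Y1 Y1" "\<kappa>2 \<in> kernels Y2 Y2" for \<kappa>1 \<kappa>2
  proof -
    have i1: "integrable (measure_pmf (geometric_pmf (1/2))) (\<lambda>k. w k * (\<integral>z. \<psi> k z \<partial>garble1 \<kappa>1 \<nu>))"
    proof (rule pmf_expectation_bounded(1))
      fix k show "\<bar>w k * (\<integral>z. \<psi> k z \<partial>garble1 \<kappa>1 \<nu>)\<bar> \<le> 2 * 1"
        unfolding abs_mult using bJ1[OF \<kappa>(1), of k] by (intro mult_mono w) (auto simp: J1 \<kappa>)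
    qed
    have i2: "integrable (measure_pmf (geometric_pmf (1/2))) (\<lambda>k. w k * (\<integral>z. \<psi> k z \<partial>garble2 \<kappa>2 \<mu>))"
    proof (rule pmf_expectation_bounded(1))
      fix k show "\<bar>w k * (\<integral>z. \<psi> k z \<partial>garble2 \<kappa>2 \<mu>)\<bar> \<le> 2 * 1"
        unfolding abs_mult using bJ2[OF \<kappa>(2), of k] by (intro mult_mono w) (auto simp: J2 \<kappa>)
    qed
    have "d \<le> pmf_mean (geometric_pmf (1/2)) (\<lambda>k. w k * l k (\<kappa>1, \<kappa>2))"
      using \<kappa> by (intro sep) (simp add: Z_def)
    also have "\<dots> = pmf_mean (geometric_pmf (1/2))
        (\<lambda>k. w k * (\<integral>z. \<psi> k z \<partial>garble1 \<kappa>1 \<nu>) - w k * (\<integral>z. \<psi> k z \<partial>garble2 \<kappa>2 \<mu>))"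
      by (simp add: l_def J1 J2 \<kappa> right_diff_distrib)
    also have "\<dots> = (\<integral>z. F z \<partial>garble1 \<kappa>1 \<nu>) - (\<integral>z. F z \<partial>garble2 \<kappa>2 \<mu>)"
      using Bochner_Integration.integral_diff[OF i1 i2]
      by (simp add: intF garble1_props(1)[OF \<nu> \<kappa>(1)] garble2_props(1)[OF \<mu> \<kappa>(2)])
    finally show ?thesis by simp
  qed
  then show thesis using that d cF Fb by blast
qed

section \<open>Necessity through a game of reporting signals\<close>

lemma garbled_if_better_for_maximizer:
  fixes \<nu> \<mu> :: "('x::polish_space \<times> 'y1::polish_space \<times> 'y2::polish_space) measure"
  assumes X: "X \<in> sets borel" and Y: "compact Y1" "compact Y2"
    and \<nu>: "\<nu> \<in> space (prob_algebra (outcomes X Y1 Y2))" and \<mu>: "\<mu> \<in> space (prob_algebra (outcomes X Y1 Y2))"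
    and better: "better_for_maximizer Y1 Y2 (compact_continuous_games X :: 'x universal_game set) \<nu> \<mu>"
  shows "\<exists>\<kappa>1\<in>kernels Y1 Y1. \<exists>\<kappa>2\<in>kernels Y2 Y2. garble1 \<kappa>1 \<nu> = garble2 \<kappa>2 \<mu>"
proof (rule ccontr)
  assume no: "\<not> ?thesis"
  let ?P = "outcomes X Y1 Y2"
  note \<nu>D = prob_outcomesD[OF \<nu>] and \<mu>D = prob_outcomesD[OF \<mu>]
  obtain F :: "'x \<times> 'y1 \<times> 'y2 \<Rightarrow> real" and d where d: "0 < d" and cF: "continuous_on UNIV F" and Fb: "\<And>z. \<bar>F z\<bar> \<le> 2"
    and sep: "\<And>\<kappa>1 \<kappa>2. \<kappa>1 \<in> kernels Y1 Y1 \<Longrightarrow> \<kappa>2 \<in> kernels Y2 Y2 \<Longrightarrow>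
      (\<integral>z. F z \<partial>garble2 \<kappa>2 \<mu>) + d \<le> (\<integral>z. F z \<partial>garble1 \<kappa>1 \<nu>)"
    by (rule separating_cost[OF X Y \<nu> \<mu> no]) blast
  obtain e1 :: "'y1 \<Rightarrow> nat \<Rightarrow> real" and r1 where e1: "continuous_on UNIV e1" "compact (e1 ` Y1)"
    "continuous_on (e1 ` Y1) r1" "\<And>y. y \<in> Y1 \<Longrightarrow> r1 (e1 y) = y"
    by (rule compact_sequence_embedding[OF Y(1)]) blast
  obtain e2 :: "'y2 \<Rightarrow> nat \<Rightarrow> real" and r2 where e2: "continuous_on UNIV e2" "compact (e2 ` Y2)"
    "continuous_on (e2 ` Y2) r2" "\<And>y. y \<in> Y2 \<Longrightarrow> r2 (e2 y) = y"
    by (rule compact_sequence_embedding[OF Y(2)]) blast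
  \<comment> \<open>Actions are encoded signals; the decoders turn them back into arguments of the
    separating function.\<close>
  define c where "c = (\<lambda>(x, u1, u2). F (x, r1 u1, r2 u2))"
  let ?U1 = "e1 ` Y1" and ?U2 = "e2 ` Y2"
  let ?G = "(c, ?U1, ?U2)"
  have Yne: "Y1 \<noteq> {}" "Y2 \<noteq> {}" using prob_space.not_empty[OF \<nu>D(1)] \<nu>D(3) by auto
  have mF: "F \<in> borel_measurable borel" using cF by (rule borel_measurable_continuous_onI)
  have r1m: "r1 \<in> borel_on ?U1 \<rightarrow>\<^sub>M borel_on Y1"
    using e1(4) borel_measurable_continuous_on_restrict[OF e1(3)]
    by (intro measurable_restrict_space2) (auto simp: space_restrict_space)
  have r2m: "r2 \<in> borel_on ?U2 \<rightarrow>\<^sub>M borel_on Y2"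
    using e2(4) borel_measurable_continuous_on_restrict[OF e2(3)]
    by (intro measurable_restrict_space2) (auto simp: space_restrict_space)
  have G: "?G \<in> compact_continuous_games X"
    unfolding compact_continuous_games_def mem_Collect_eq prod.case
  proof (intro conjI ballI)
    have "(\<lambda>z. (fst z, r1 (fst (snd z)), r2 (snd (snd z)))) \<in> borel_on X \<Otimes>\<^sub>M borel_on ?U1 \<Otimes>\<^sub>M borel_on ?U2 \<rightarrow>\<^sub>M borel \<Otimes>\<^sub>M borel \<Otimes>\<^sub>M borel"
    proof (intro measurable_Pair)
      show "fst \<in> borel_on X \<Otimes>\<^sub>M borel_on ?U1 \<Otimes>\<^sub>M borel_on ?U2 \<rightarrow>\<^sub>M borel"
        by (rule measurable_compose[OF measurable_fst]) (rule measurable_restrict_space1, simp)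
      show "(\<lambda>z. r1 (fst (snd z))) \<in> borel_on X \<Otimes>\<^sub>M borel_on ?U1 \<Otimes>\<^sub>M borel_on ?U2 \<rightarrow>\<^sub>M borel"
        by (rule measurable_compose[OF measurable_compose[OF measurable_snd measurable_fst]
              borel_measurable_continuous_on_restrict[OF e1(3)]])
      show "(\<lambda>z. r2 (snd (snd z))) \<in> borel_on X \<Otimes>\<^sub>M borel_on ?U1 \<Otimes>\<^sub>M borel_on ?U2 \<rightarrow>\<^sub>M borel"
        by (rule measurable_compose[OF measurable_compose[OF measurable_snd measurable_snd]
              borel_measurable_continuous_on_restrict[OF e2(3)]])
    qed
    then have "(\<lambda>z. (fst z, r1 (fst (snd z)), r2 (snd (snd z)))) \<in> borel_on X \<Otimes>\<^sub>M borel_on ?U1 \<Otimes>\<^sub>M borel_on ?U2 \<rightarrow>\<^sub>M borel"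
      by (simp only: borel_prod)
    from measurable_compose[OF this mF]
    show "c \<in> borel_measurable (borel_on X \<Otimes>\<^sub>M borel_on ?U1 \<Otimes>\<^sub>M borel_on ?U2)"
      by (simp add: c_def split_beta')
    show "\<exists>b. \<forall>x\<in>X. \<forall>u1\<in>?U1. \<forall>u2\<in>?U2. \<bar>c (x, u1, u2)\<bar> \<le> b"
      using Fb by (intro exI[of _ 2]) (simp add: c_def)
    show "continuous_on (?U1 \<times> ?U2) (\<lambda>(u1, u2). c (x, u1, u2))" for x
    proof -
      have c1: "continuous_on (?U1 \<times> ?U2) (\<lambda>u. r1 (fst u))"
        by (rule continuous_on_compose2[OF e1(3) continuous_on_fst[OF continuous_on_id]]) auto
      have c2: "continuous_on (?U1 \<times> ?U2) (\<lambda>u. r2 (snd u))"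
        by (rule continuous_on_compose2[OF e2(3) continuous_on_snd[OF continuous_on_id]]) auto
      have "continuous_on (?U1 \<times> ?U2) (\<lambda>u. F (x, r1 (fst u), r2 (snd u)))"
        by (rule continuous_on_compose2[OF cF continuous_on_Pair[OF continuous_on_const continuous_on_Pair[OF c1 c2]]]) simp
      then show ?thesis by (simp add: c_def split_beta')
    qed
  qed (use e1(2) e2(2) Yne in \<open>auto intro: borel_closed compact_imp_closed\<close>)
  \<comment> \<open>The truthful reports, as deterministic policies.\<close>
  have ret1: "(\<lambda>y. return (borel_on ?U1) (e1 y)) \<in> kernels Y1 ?U1"
    unfolding kernels_def
    by (intro measurable_compose[OF _ measurable_return_prob_space] measurable_restrict_space2
        measurable_restrict_space1 borel_measurable_continuous_onI e1(1)) (auto simp: space_restrict_space)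
  have ret2: "(\<lambda>y. return (borel_on ?U2) (e2 y)) \<in> kernels Y2 ?U2"
    unfolding kernels_def
    by (intro measurable_compose[OF _ measurable_return_prob_space] measurable_restrict_space2
        measurable_restrict_space1 borel_measurable_continuous_onI e2(1)) (auto simp: space_restrict_space)
  have FP: "F \<in> borel_measurable ?P"
    using measurable_restrict_space1[OF mF, of "X \<times> Y1 \<times> Y2"] sets_borel_on_prod[of X "Y1 \<times> Y2"]
      sets_pair_measure_cong[OF refl sets_borel_on_prod[of Y1 Y2], of "borel_on X"]
    by (simp cong: measurable_cong_sets)
  have cm2: "(\<lambda>u2. c (x, u1, u2)) \<in> borel_measurable (borel_on ?U2)" if "u1 \<in> ?U1" for x u1
    by (rule borel_measurable_continuous_on_restrict)
      (auto simp: c_def intro!: continuous_on_compose2[OF cF] continuous_intros e2(3))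
  have cm1: "(\<lambda>u1. c (x, u1, u2)) \<in> borel_measurable (borel_on ?U1)" if "u2 \<in> ?U2" for x u2
    by (rule borel_measurable_continuous_on_restrict)
      (auto simp: c_def intro!: continuous_on_compose2[OF cF] continuous_intros e1(3))
  \<comment> \<open>An optimal policy of the minimizer keeps the cost at or below the value against
    every reply, truthful reporting included; this bounds the value under \<nu> from below. The
    maximizer's optimal policy under \<mu> is used symmetrically.\<close>
  obtain \<gamma>1 where \<gamma>1: "\<gamma>1 \<in> kernels Y1 ?U1"
    "\<And>\<gamma>. \<gamma> \<in> kernels Y2 ?U2 \<Longrightarrow> expected_cost ?G \<nu> \<gamma>1 \<gamma> \<le> game_value Y1 Y2 ?G \<nu>"
    by (rule game_value_saddle[OF \<nu> G]) blast
  obtain \<gamma>2 where \<gamma>2: "\<gamma>2 \<in> kernels Y2 ?U2"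
    "\<And>\<gamma>. \<gamma> \<in> kernels Y1 ?U1 \<Longrightarrow> game_value Y1 Y2 ?G \<mu> \<le> expected_cost ?G \<mu> \<gamma> \<gamma>2"
    by (rule game_value_saddle[OF \<mu> G]) blast
  \<comment> \<open>Decoded, an optimal report becomes a garbling kernel, to which the separation
    applies.\<close>
  define \<kappa>1 where "\<kappa>1 y = distr (\<gamma>1 y) (borel_on Y1) r1" for y
  define \<kappa>2 where "\<kappa>2 y = distr (\<gamma>2 y) (borel_on Y2) r2" for y
  have \<kappa>: "\<kappa>1 \<in> kernels Y1 Y1" "\<kappa>2 \<in> kernels Y2 Y2"
    unfolding kernels_def \<kappa>1_def[abs_def] \<kappa>2_def[abs_def]
    using measurable_compose[OF \<gamma>1(1)[unfolded kernels_def] measurable_distr_prob_space[OF r1m]]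
      measurable_compose[OF \<gamma>2(1)[unfolded kernels_def] measurable_distr_prob_space[OF r2m]] by auto
  have "(\<integral>z. F z \<partial>garble1 \<kappa>1 \<nu>) = expected_cost ?G \<nu> \<gamma>1 (\<lambda>y. return (borel_on ?U2) (e2 y))"
  proof -
    have "(\<integral>z. F z \<partial>garble1 \<kappa>1 \<nu>) = (\<integral>w. (\<integral>y. F (fst w, y, snd (snd w)) \<partial>\<kappa>1 (fst (snd w))) \<partial>\<nu>)"
      by (rule garble1_props(2)[OF \<nu> \<kappa>(1) FP Fb])
    also have "\<dots> = (\<integral>w. (\<integral>u1. (\<integral>u2. c (fst w, u1, u2) \<partial>return (borel_on ?U2) (e2 (snd (snd w)))) \<partial>\<gamma>1 (fst (snd w))) \<partial>\<nu>)"
    proof (rule Bochner_Integration.integral_cong)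
      fix w assume "w \<in> space \<nu>"
      then have w: "fst (snd w) \<in> Y1" "snd (snd w) \<in> Y2" by (auto simp: \<nu>D(3))
      have \<gamma>P: "\<gamma>1 (fst (snd w)) \<in> space (prob_algebra (borel_on ?U1))"
        using measurable_space[OF \<gamma>1(1)[unfolded kernels_def], of "fst (snd w)"] w(1) by (simp add: space_restrict_space)
      have Fm: "(\<lambda>y. F (fst w, y, snd (snd w))) \<in> borel_measurable (borel_on Y1)"
        by (intro borel_measurable_continuous_on_restrict continuous_on_compose2[OF cF] continuous_intros) auto
      have "(\<integral>y. F (fst w, y, snd (snd w)) \<partial>\<kappa>1 (fst (snd w))) = (\<integral>u. F (fst w, r1 u, snd (snd w)) \<partial>\<gamma>1 (fst (snd w)))"
        unfolding \<kappa>1_def by (rule integral_distr[OF borel_measurable_on_prob_algebra[OF \<gamma>P r1m] Fm])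
      also have "\<dots> = (\<integral>u1. (\<integral>u2. c (fst w, u1, u2) \<partial>return (borel_on ?U2) (e2 (snd (snd w)))) \<partial>\<gamma>1 (fst (snd w)))"
      proof (rule Bochner_Integration.integral_cong)
        fix u assume "u \<in> space (\<gamma>1 (fst (snd w)))"
        then have u: "u \<in> ?U1" using prob_algebra_borel_onD(3)[OF \<gamma>P] by simp
        have "(\<integral>u2. c (fst w, u, u2) \<partial>return (borel_on ?U2) (e2 (snd (snd w)))) = c (fst w, u, e2 (snd (snd w)))"
          by (rule integral_return) (use w cm2[OF u] in \<open>auto simp: space_restrict_space\<close>)
        then show "F (fst w, r1 u, snd (snd w)) = (\<integral>u2. c (fst w, u, u2) \<partial>return (borel_on ?U2) (e2 (snd (snd w))))"
          using e2(4)[OF w(2)] by (simp add: c_def)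
      qed simp
      finally show "(\<integral>y. F (fst w, y, snd (snd w)) \<partial>\<kappa>1 (fst (snd w))) =
        (\<integral>u1. (\<integral>u2. c (fst w, u1, u2) \<partial>return (borel_on ?U2) (e2 (snd (snd w)))) \<partial>\<gamma>1 (fst (snd w)))" .
    qed simp
    finally show ?thesis by (simp add: expected_cost_def split_beta')
  qed
  also have "\<dots> \<le> game_value Y1 Y2 ?G \<nu>" by (rule \<gamma>1(2)[OF ret2])
  finally have v\<nu>: "(\<integral>z. F z \<partial>garble1 \<kappa>1 \<nu>) \<le> game_value Y1 Y2 ?G \<nu>" .
  have "game_value Y1 Y2 ?G \<mu> \<le> expected_cost ?G \<mu> (\<lambda>y. return (borel_on ?U1) (e1 y)) \<gamma>2"
    by (rule \<gamma>2(2)[OF ret1])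
  also have "\<dots> = (\<integral>z. F z \<partial>garble2 \<kappa>2 \<mu>)"
  proof -
    have "(\<integral>z. F z \<partial>garble2 \<kappa>2 \<mu>) = (\<integral>w. (\<integral>y. F (fst w, fst (snd w), y) \<partial>\<kappa>2 (snd (snd w))) \<partial>\<mu>)"
      by (rule garble2_props(2)[OF \<mu> \<kappa>(2) FP Fb])
    also have "\<dots> = (\<integral>w. (\<integral>u2. (\<integral>u1. c (fst w, u1, u2) \<partial>return (borel_on ?U1) (e1 (fst (snd w)))) \<partial>\<gamma>2 (snd (snd w))) \<partial>\<mu>)"
    proof (rule Bochner_Integration.integral_cong)
      fix w assume "w \<in> space \<mu>"
      then have w: "fst (snd w) \<in> Y1" "snd (snd w) \<in> Y2" by (auto simp: \<mu>D(3))
      have \<gamma>P: "\<gamma>2 (snd (snd w)) \<in> space (prob_algebra (borel_on ?U2))"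
        using measurable_space[OF \<gamma>2(1)[unfolded kernels_def], of "snd (snd w)"] w(2) by (simp add: space_restrict_space)
      have Fm: "(\<lambda>y. F (fst w, fst (snd w), y)) \<in> borel_measurable (borel_on Y2)"
        by (intro borel_measurable_continuous_on_restrict continuous_on_compose2[OF cF] continuous_intros) auto
      have "(\<integral>y. F (fst w, fst (snd w), y) \<partial>\<kappa>2 (snd (snd w))) = (\<integral>u. F (fst w, fst (snd w), r2 u) \<partial>\<gamma>2 (snd (snd w)))"
        unfolding \<kappa>2_def by (rule integral_distr[OF borel_measurable_on_prob_algebra[OF \<gamma>P r2m] Fm])
      also have "\<dots> = (\<integral>u2. (\<integral>u1. c (fst w, u1, u2) \<partial>return (borel_on ?U1) (e1 (fst (snd w)))) \<partial>\<gamma>2 (snd (snd w)))"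
      proof (rule Bochner_Integration.integral_cong)
        fix u assume "u \<in> space (\<gamma>2 (snd (snd w)))"
        then have u: "u \<in> ?U2" using prob_algebra_borel_onD(3)[OF \<gamma>P] by simp
        have "(\<integral>u1. c (fst w, u1, u) \<partial>return (borel_on ?U1) (e1 (fst (snd w)))) = c (fst w, e1 (fst (snd w)), u)"
          by (rule integral_return) (use w cm1[OF u] in \<open>auto simp: space_restrict_space\<close>)
        then show "F (fst w, fst (snd w), r2 u) = (\<integral>u1. c (fst w, u1, u) \<partial>return (borel_on ?U1) (e1 (fst (snd w))))"
          using e1(4)[OF w(1)] by (simp add: c_def)
      qed simp
      finally show "(\<integral>y. F (fst w, fst (snd w), y) \<partial>\<kappa>2 (snd (snd w))) =
        (\<integral>u2. (\<integral>u1. c (fst w, u1, u2) \<partial>return (borel_on ?U1) (e1 (fst (snd w)))) \<partial>\<gamma>2 (snd (snd w)))" .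
    qed simp
    also have "\<dots> = expected_cost ?G \<mu> (\<lambda>y. return (borel_on ?U1) (e1 y)) \<gamma>2"
      by (rule expected_cost_swap[OF \<mu> G ret1 \<gamma>2(1), symmetric])
    finally show ?thesis by simp
  qed
  finally have v\<mu>: "game_value Y1 Y2 ?G \<mu> \<le> (\<integral>z. F z \<partial>garble2 \<kappa>2 \<mu>)" .
  have "game_value Y1 Y2 ?G \<nu> \<le> game_value Y1 Y2 ?G \<mu>"
    using better G unfolding better_for_maximizer_def by blast
  then show False using v\<nu> v\<mu> sep[OF \<kappa>] d by linarith
qed

text \<open>Necessity rests on a single separating game, whose action spaces can be placed in the
  sequence space; sufficiency has to cover actions of every Polish type, which the second conjunct
  records.\<close>

theorem theorem4p4:
  fixes X :: "'x::polish_space set"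
    and Y1 :: "'y1::polish_space set" and Y2 :: "'y2::polish_space set"
    and \<zeta> :: "'x measure"
    and \<nu> \<mu> :: "('x \<times> 'y1 \<times> 'y2) measure"
  assumes "standard_borel X" and "\<zeta> \<in> space (prob_algebra (borel_on X))"
    and "standard_borel Y1" and "compact Y1"
    and "standard_borel Y2" and "compact Y2"
    and "info_structure X Y1 Y2 \<zeta> \<nu>" and "abs_cont_product X Y1 Y2 \<zeta> \<nu>"
    and "info_structure X Y1 Y2 \<zeta> \<mu>" and "abs_cont_product X Y1 Y2 \<zeta> \<mu>"
  shows "(better_for_maximizer Y1 Y2 (compact_continuous_games X :: 'x universal_game set) \<nu> \<mu>
            \<longleftrightarrow> (\<exists>\<kappa>1\<in>kernels Y1 Y1. \<exists>\<kappa>2\<in>kernels Y2 Y2. garble1 \<kappa>1 \<nu> = garble2 \<kappa>2 \<mu>))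
       \<and> ((\<exists>\<kappa>1\<in>kernels Y1 Y1. \<exists>\<kappa>2\<in>kernels Y2 Y2. garble1 \<kappa>1 \<nu> = garble2 \<kappa>2 \<mu>)
            \<longrightarrow> better_for_maximizer Y1 Y2
                  (compact_continuous_games X :: ('x, 'u1::polish_space, 'u2::polish_space) game set) \<nu> \<mu>)"
proof -
  have \<nu>: "\<nu> \<in> space (prob_algebra (outcomes X Y1 Y2))"
    and \<mu>: "\<mu> \<in> space (prob_algebra (outcomes X Y1 Y2))"
    using assms(7,9) by (simp_all add: info_structure_def)
  note garbled = better_for_maximizer_if_garbled[OF \<nu> \<mu>]
  show ?thesis
  proof (intro conjI iffI impI)
    assume "better_for_maximizer Y1 Y2 (compact_continuous_games X :: 'x universal_game set) \<nu> \<mu>"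
    then show "\<exists>\<kappa>1\<in>kernels Y1 Y1. \<exists>\<kappa>2\<in>kernels Y2 Y2. garble1 \<kappa>1 \<nu> = garble2 \<kappa>2 \<mu>"
      by (rule garbled_if_better_for_maximizer[OF assms(1,4,6) \<nu> \<mu>])
  next
    assume "\<exists>\<kappa>1\<in>kernels Y1 Y1. \<exists>\<kappa>2\<in>kernels Y2 Y2. garble1 \<kappa>1 \<nu> = garble2 \<kappa>2 \<mu>"
    then show "better_for_maximizer Y1 Y2 (compact_continuous_games X :: 'x universal_game set) \<nu> \<mu>"
      by (elim bexE) (rule garbled)
  next
    assume "\<exists>\<kappa>1\<in>kernels Y1 Y1. \<exists>\<kappa>2\<in>kernels Y2 Y2. garble1 \<kappa>1 \<nu> = garble2 \<kappa>2 \<mu>"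
    then show "better_for_maximizer Y1 Y2
        (compact_continuous_games X :: ('x, 'u1, 'u2) game set) \<nu> \<mu>"
      by (elim bexE) (rule garbled)
  qed
qed

end
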